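(* Let $\mathfrak{B}\in\mathfrak{L}^{\mathtt w}$ be an uncontrollable behavior with input cardinality $\mathtt m=\mathtt m(\mathfrak{B})$ whose set of uncontrollable modes $\Lambda_{un}$ satisfies $\Lambda_{un}\cap(-\Lambda_{un})=\emptyset$. Let $$\Sigma=\begin{bmatrix} I_{\mathtt m}&0&0\\ 0&I_{\mathtt q}&0\\ 0&0&-I_{\mathtt p}\end{bmatrix}\in\mathbb{R}^{\mathtt w\times\mathtt w},\qquad J_{pq}:=\begin{bmatrix} I_{\mathtt q}&0\\ 0&-I_{\mathtt p}\end{bmatrix}.$$ Suppose the controllable part $\mathfrak{B}_{cont}$ of $\mathfrak{B}$ has an observable image representation $w=M(\frac{d}{dt})\ell$ with $$M(\xi)=\begin{bmatrix} W_1(\xi) \\ W_2(\xi) \end{bmatrix},\qquad W_1\in\mathbb{R}^{\mathtt m\times\mathtt m}[\xi],\quad W_2\in\mathbb{R}^{(\mathtt p+\mathtt q)\times\mathtt m}[\xi],$$ where $W_1$ is nonsingular (as a polynomial matrix) and $G(s):=W_2(s)W_1(s)^{-1}$ is proper. Let $D:=\lim_{s\to\infty}G(s)$ and assume $I_{\mathtt m}+D^TJ_{pq}D>0$. Then the following are equivalent. 1. $\mathfrak{B}_{cont}$ is $\Sigma$-dissipative. 2. There exists $\Psi\in\mathbb{R}^{\mathtt w\times\mathtt w}[\zeta,\eta]$ such that $Q_\Psi(w)$ is a storage function, i.e. $\frac{d}{dt}Q_\Psi(w)\leqslant w^T\Sigma w$ for all $w\in\mathfrak{B}$. 3. There exist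 a matrix $K$ and an observable state variable $x$ for $\mathfrak{B}$ such that $\frac{d}{dt}\,x^TKx\leqslant w^T\Sigma w$ for all $w\in\mathfrak{B}$ (with $x$ the state trajectory corresponding to $w$).
   Context: A linear differential behavior with $\mathtt w$ variables is a set $\mathfrak{B}=\{w\in C^\infty(\mathbb{R},\mathbb{R}^{\mathtt w}) : R(\frac{d}{dt})w=0\}$ for some polynomial matrix $R(\xi)$ with real coefficients and $\mathtt w$ columns (a kernel representation of $\mathfrak{B}$). $\mathfrak{L}^{\mathtt w}$ is the set of all such behaviors. The input cardinality is $\mathtt m(\mathfrak{B}):=\mathtt w-\operatorname{rank}R$ (rank as a polynomial matrix). $\mathfrak{B}$ is controllable if for all $w_1,w_2\in\mathfrak{B}$ there exist $w_3\in\mathfrak{B}$ and $\tau>0$ with $w_3(t)=w_1(t)$ for $t\le 0$ and $w_3(t)=w_2(t)$ for $t\ge\tau$; otherwise it is uncontrollable. The controllable part $\mathfrak{B}_{cont}$ is the largest controllable behavior contained in $\mathfrak{B}$; it has the same input cardinality as $\mathfrak{B}$. A controllable behavior admits an image representation $\{w: \exists\,\ell\in C^\infty(\mathbb{R},\mathbb{R}^{\mathtt m}),\ w=M(\frac{d}{dt})\ell\}$; it is called observable if $M(\lambda)$ has full column rank for every $\lambda\in\mathbb{C}$. $\Lambda_{un}$ is the set of $\lambda\in\mathbb{C}$ with $\operatorname{rank}R(\lambda)<\operatorname{rank}R$. For $\Psi(\zeta,\eta)=\sum_{j,k}\Psi_{jk}\zeta^j\eta^k\in\mathbb{R}^{\mathtt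 w\times\mathtt w}[\zeta,\eta]$, the quadratic differential form (QDF) $Q_\Psi$ is $Q_\Psi(w)=\sum_{j,k}(\frac{d^jw}{dt^j})^T\Psi_{jk}\frac{d^kw}{dt^k}$. A behavior $\mathfrak{B}'$ is $\Sigma$-dissipative if there exists a QDF $Q_\Psi$ such that $\frac{d}{dt}Q_\Psi(w)\leqslant w^T\Sigma w$ (pointwise in time) for all $w\in\mathfrak{B}'$. A state variable $x$ for $\mathfrak{B}$ is a latent variable (there is a linear differential behavior $\mathfrak{B}_f$ of pairs $(w,x)$ whose projection onto $w$ is $\mathfrak{B}$) with the state property: whenever $(w_1,x_1),(w_2,x_2)\in\mathfrak{B}_f$ and $x_1(0)=x_2(0)$, the concatenation at $t=0$ of $(w_1,x_1)$ (for $t\le0$) and $(w_2,x_2)$ (for $t>0$) satisfies the equations of $\mathfrak{B}_f$ in the distributional sense. It is observable if $(w,x_1),(w,x_2)\in\mathfrak{B}_f$ implies $x_1=x_2$. With input/output partition $w=(w_1,w_2)$, a state representation takes the form $\frac{d}{dt}x=Ax+Bw_1$, $w_2=Cx+Dw_1$, and observability of $x$ from $w$ is equivalent to observability of the pair $(C,A)$. *)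

theory Defs
  imports
    "HOL-Analysis.Analysis"
    "HOL-Computational_Algebra.Computational_Algebra"
    "Jordan_Normal_Form.DL_Rank"
    "Jordan_Normal_Form.Gauss_Jordan_Elimination"
begin

(* Cartesian vectors and set-based dimensions from HOL-Analysis clash with the
   matrices of Jordan_Normal_Form, which are the ones used throughout. *)
hide_const (open) Finite_Cartesian_Product.vec Finite_Cartesian_Product.row
  Finite_Cartesian_Product.column Cartesian_Space.rank Determinants.det Inner_Product.real_inner_class.inner
no_notation Finite_Cartesian_Product.vec.vec_nth (infixl "$" 90)
no_notation Inner_Product.real_inner_class.inner (infixl "\<bullet>" 70)

section \<open>Smooth trajectories and kernel representations\<close>

definition smooth :: "(real \<Rightarrow> real) \<Rightarrow> bool" where
  "smooth f \<longleftrightarrow> (\<forall>k. (deriv ^^ k) f differentiable_on UNIV)"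

definition smooth_trajectories :: "nat \<Rightarrow> (real \<Rightarrow> real vec) set" where
  "smooth_trajectories n =
     {w. (\<forall>t. w t \<in> carrier_vec n) \<and> (\<forall>i<n. smooth (\<lambda>t. w t $ i))}"

definition diff_op :: "real poly \<Rightarrow> (real \<Rightarrow> real) \<Rightarrow> real \<Rightarrow> real" where
  "diff_op p f t = (\<Sum>k\<le>degree p. coeff p k * (deriv ^^ k) f t)"

definition mat_diff_op :: "real poly mat \<Rightarrow> (real \<Rightarrow> real vec) \<Rightarrow> real \<Rightarrow> real vec" where
  "mat_diff_op R w t =
     vec (dim_row R) (\<lambda>i. \<Sum>j<dim_col R. diff_op (R $$ (i, j)) (\<lambda>s. w s $ j) t)"

definition kernel_behavior :: "real poly mat \<Rightarrow> (real \<Rightarrow> real vec) set" where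
  "kernel_behavior R =
     {w \<in> smooth_trajectories (dim_col R). \<forall>t. mat_diff_op R w t = 0\<^sub>v (dim_row R)}"

definition linear_diff_behaviors :: "nat \<Rightarrow> (real \<Rightarrow> real vec) set set" where
  "linear_diff_behaviors n = {kernel_behavior R | R. dim_col R = n}"

section \<open>Ranks, input cardinality and uncontrollable modes\<close>

(* Rank over the field of rational functions. *)
definition poly_mat_rank :: "real poly mat \<Rightarrow> nat" where
  "poly_mat_rank R = vec_space.rank (dim_row R) (map_mat to_fract R)"

definition eval_poly_mat :: "real poly mat \<Rightarrow> complex \<Rightarrow> complex mat" where
  "eval_poly_mat R s = map_mat (\<lambda>p. poly (map_poly of_real p) s) R"

(* The input cardinality and the uncontrollable modes of a behavior are read off an
   arbitrary kernel representation R of it; they do not depend on the choice of R. *)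
definition input_cardinality :: "real poly mat \<Rightarrow> nat" where
  "input_cardinality R = dim_col R - poly_mat_rank R"

definition uncontrollable_modes :: "real poly mat \<Rightarrow> complex set" where
  "uncontrollable_modes R =
     {s. vec_space.rank (dim_row R) (eval_poly_mat R s) < poly_mat_rank R}"

section \<open>Controllability and image representations\<close>

definition controllable :: "(real \<Rightarrow> real vec) set \<Rightarrow> bool" where
  "controllable \<BB> \<longleftrightarrow>
     (\<forall>w1\<in>\<BB>. \<forall>w2\<in>\<BB>. \<exists>w3\<in>\<BB>. \<exists>\<tau>>0.
        (\<forall>t\<le>0. w3 t = w1 t) \<and> (\<forall>t\<ge>\<tau>. w3 t = w2 t))"

definition is_controllable_part ::
    "nat \<Rightarrow> (real \<Rightarrow> real vec) set \<Rightarrow> (real \<Rightarrow> real vec) set \<Rightarrow> bool" where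
  "is_controllable_part n \<BB> \<CC> \<longleftrightarrow>
     \<CC> \<in> linear_diff_behaviors n \<and> controllable \<CC> \<and> \<CC> \<subseteq> \<BB> \<and>
     (\<forall>\<CC>'\<in>linear_diff_behaviors n. controllable \<CC>' \<and> \<CC>' \<subseteq> \<BB> \<longrightarrow> \<CC>' \<subseteq> \<CC>)"

definition image_behavior :: "real poly mat \<Rightarrow> (real \<Rightarrow> real vec) set" where
  "image_behavior M = mat_diff_op M ` smooth_trajectories (dim_col M)"

definition observable_image :: "real poly mat \<Rightarrow> bool" where
  "observable_image M \<longleftrightarrow>
     (\<forall>s. vec_space.rank (dim_row M) (eval_poly_mat M s) = dim_col M)"

section \<open>Rational matrices\<close>

definition transfer_matrix :: "real poly mat \<Rightarrow> real poly mat \<Rightarrow> real poly fract mat" where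
  "transfer_matrix W1 W2 = map_mat to_fract W2 * the (mat_inverse (map_mat to_fract W1))"

(* Degree conditions and limits are stated for some representing fraction a/b; they do
   not depend on the representative. *)
definition proper :: "real poly fract mat \<Rightarrow> bool" where
  "proper G \<longleftrightarrow> (\<forall>i<dim_row G. \<forall>j<dim_col G.
     \<exists>a b. b \<noteq> 0 \<and> G $$ (i, j) = Fraction_Field.Fract a b \<and> degree a \<le> degree b)"

definition limit_at_infinity :: "real poly fract mat \<Rightarrow> real mat \<Rightarrow> bool" where
  "limit_at_infinity G D \<longleftrightarrow> D \<in> carrier_mat (dim_row G) (dim_col G) \<and>
     (\<forall>i<dim_row G. \<forall>j<dim_col G.
        \<exists>a b. b \<noteq> 0 \<and> G $$ (i, j) = Fraction_Field.Fract a b \<and>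
          ((\<lambda>s::complex. poly (map_poly of_real a) s / poly (map_poly of_real b) s)
             \<longlongrightarrow> of_real (D $$ (i, j))) at_infinity)"

definition positive_definite :: "real mat \<Rightarrow> bool" where
  "positive_definite A \<longleftrightarrow> A\<^sup>T = A \<and>
     (\<forall>v\<in>carrier_vec (dim_row A). v \<noteq> 0\<^sub>v (dim_row A) \<longrightarrow> v \<bullet> (A *\<^sub>v v) > 0)"

section \<open>Quadratic differential forms and dissipativity\<close>

definition J_mat :: "nat \<Rightarrow> nat \<Rightarrow> real mat" where
  "J_mat p q = diag_block_mat [1\<^sub>m q, - 1\<^sub>m p]"

definition Sigma_mat :: "nat \<Rightarrow> nat \<Rightarrow> nat \<Rightarrow> real mat" where
  "Sigma_mat m q p = diag_block_mat [1\<^sub>m m, 1\<^sub>m q, - 1\<^sub>m p]"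

(* A two-variable polynomial is a polynomial in \<zeta> whose coefficients are polynomials
   in \<eta>: the coefficient of \<zeta>^j * \<eta>^k in P is coeff (coeff P j) k. *)
definition qdf :: "real poly poly mat \<Rightarrow> (real \<Rightarrow> real vec) \<Rightarrow> real \<Rightarrow> real" where
  "qdf \<Psi> w t = (\<Sum>a<dim_row \<Psi>. \<Sum>b<dim_col \<Psi>.
     \<Sum>j\<le>degree (\<Psi> $$ (a, b)). \<Sum>k\<le>degree (coeff (\<Psi> $$ (a, b)) j).
       (deriv ^^ j) (\<lambda>s. w s $ a) t * coeff (coeff (\<Psi> $$ (a, b)) j) k
         * (deriv ^^ k) (\<lambda>s. w s $ b) t)"

definition is_storage_function ::
    "real mat \<Rightarrow> (real \<Rightarrow> real vec) set \<Rightarrow> real poly poly mat \<Rightarrow> bool" where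
  "is_storage_function \<Sigma> \<BB> \<Psi> \<longleftrightarrow>
     (\<forall>w\<in>\<BB>. \<forall>t. deriv (qdf \<Psi> w) t \<le> w t \<bullet> (\<Sigma> *\<^sub>v w t))"

definition dissipative :: "real mat \<Rightarrow> (real \<Rightarrow> real vec) set \<Rightarrow> bool" where
  "dissipative \<Sigma> \<BB> \<longleftrightarrow>
     (\<exists>\<Psi>\<in>carrier_mat (dim_row \<Sigma>) (dim_row \<Sigma>). is_storage_function \<Sigma> \<BB> \<Psi>)"

section \<open>State variables\<close>

definition pair_traj :: "(real \<Rightarrow> real vec) \<Rightarrow> (real \<Rightarrow> real vec) \<Rightarrow> real \<Rightarrow> real vec" where
  "pair_traj w x t = w t @\<^sub>v x t"

definition full_behavior ::
    "nat \<Rightarrow> nat \<Rightarrow> real poly mat \<Rightarrow> ((real \<Rightarrow> real vec) \<times> (real \<Rightarrow> real vec)) set" where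
  "full_behavior nw nx F =
     {(w, x). w \<in> smooth_trajectories nw \<and> x \<in> smooth_trajectories nx \<and>
              pair_traj w x \<in> kernel_behavior F}"

definition concat_at_0 :: "(real \<Rightarrow> real vec) \<Rightarrow> (real \<Rightarrow> real vec) \<Rightarrow> real \<Rightarrow> real vec" where
  "concat_at_0 f g t = (if t \<le> 0 then f t else g t)"

definition test_function :: "(real \<Rightarrow> real) \<Rightarrow> bool" where
  "test_function \<phi> \<longleftrightarrow> smooth \<phi> \<and> compact (closure {t. \<phi> t \<noteq> 0})"

(* Each row of F(d/dt) f = 0 is tested against \<phi>, with the derivatives moved onto \<phi>:
   the formal adjoint of p(d/dt) is p(-d/dt). *)
definition distributional_solution :: "real poly mat \<Rightarrow> (real \<Rightarrow> real vec) \<Rightarrow> bool" where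
  "distributional_solution F f \<longleftrightarrow>
     (\<forall>\<phi>. test_function \<phi> \<longrightarrow> (\<forall>i<dim_row F.
        (LINT t|lborel. (\<Sum>j<dim_col F.
           diff_op (pcompose (F $$ (i, j)) [:0, -1:]) \<phi> t * f t $ j)) = 0))"

definition state_property :: "nat \<Rightarrow> nat \<Rightarrow> real poly mat \<Rightarrow> bool" where
  "state_property nw nx F \<longleftrightarrow>
     (\<forall>(w1, x1)\<in>full_behavior nw nx F. \<forall>(w2, x2)\<in>full_behavior nw nx F.
        x1 0 = x2 0 \<longrightarrow>
        distributional_solution F (concat_at_0 (pair_traj w1 x1) (pair_traj w2 x2)))"

(* F(d/dt) [w; x] = 0 exhibits x, with nx components, as an observable state variable
   of the behavior \<BB> with nw variables. *)
definition observable_state_variable ::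
    "nat \<Rightarrow> nat \<Rightarrow> (real \<Rightarrow> real vec) set \<Rightarrow> real poly mat \<Rightarrow> bool" where
  "observable_state_variable nw nx \<BB> F \<longleftrightarrow>
     dim_col F = nw + nx \<and> fst ` full_behavior nw nx F = \<BB> \<and> state_property nw nx F \<and>
     (\<forall>w x1 x2. (w, x1) \<in> full_behavior nw nx F \<and> (w, x2) \<in> full_behavior nw nx F \<longrightarrow> x1 = x2)"

end

theory Submission
  imports Defs "HOL-Computational_Algebra.Field_as_Ring"
begin

text \<open>
  Modulo the equations of the behavior, the differential operators on trajectories whose transfer
  function is strictly proper form a finite-dimensional space. A basis of it, chosen so that its last
  members vanish on the controllable part, is an observable state \<open>x = (x\<^sub>1, x\<^sub>2)\<close> with
  \<open>x\<^sub>1' = A\<^sub>1 x\<^sub>1 + A\<^sub>1\<^sub>2 x\<^sub>2 + B\<^sub>1 u\<close> and \<open>x\<^sub>2' = A\<^sub>2 x\<^sub>2\<close>, where \<open>(A\<^sub>1, B\<^sub>1)\<close> is controllable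
  and the eigenvalues of \<open>A\<^sub>2\<close> are uncontrollable modes.

  On the controllable part, \<open>x\<^sub>2 = 0\<close>, and a storage function is a quadratic form in \<open>x\<^sub>1\<close>, \<open>u\<close> and
  derivatives of \<open>u\<close>. The dissipation inequality is affine in the highest derivative, so the storage
  function depends on \<open>x\<^sub>1\<close> only: \<open>K\<^sub>1\<close> solves a linear matrix inequality. Completing the square (here
  \<open>I + D\<^sup>T J D > 0\<close> enters) turns it into a Riccati inequality. By controllability, closed-loop eigenvalues
  can be replaced by their negatives without changing the residual of that inequality; as no
  uncontrollable mode is the negative of another one, \<open>K\<^sub>1\<close> can be chosen such that no closed-loop
  eigenvalue is the negative of an eigenvalue of \<open>A\<^sub>2\<close>. The equations that make the remaining blocks of
  the residual vanish are then Sylvester equations for \<open>K\<^sub>1\<^sub>2\<close> and \<open>K\<^sub>2\<^sub>2\<close> with disjoint spectra.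

  Conversely, an observable state is the image of \<open>w\<close> under a polynomial differential operator, so a
  quadratic form in the state is a quadratic differential form in \<open>w\<close>.
\<close>

section \<open>Linear systems\<close>

text \<open>The crux is the off-diagonal block of the residual. With \<open>Ac\<close> the
  closed-loop matrix belonging to \<open>K1\<close>, making this block vanish means
  \<open>tr Ac * K12 + K12 * A2 = C12\<close>, which is guaranteed to be solvable when no eigenvalue
  of \<open>Ac\<close> is the negative of one of \<open>A2\<close>. The storage function supplied by
  dissipativity is arbitrary, so its closed loop may clash with \<open>A2\<close>, and the
  hypothesis on the uncontrollable modes relates \<open>A2\<close> only to itself. This suffices
  because the clashing eigenvalues are negatives of eigenvalues of \<open>A2\<close>. Reflecting
  exactly these sends them to eigenvalues of \<open>A2\<close>, which by hypothesis are not
  negatives of one another, so the clash disappears and no new one arises. The residual must survive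
  the reflection because \<open>K0\<close> satisfies only an inequality: its residual is
  semidefinite and becomes the residual of the full system. In the matrix argument, disjointness of
  spectra is coprimality of real annihilating polynomials and spectral projections come from Bezout
  identities, so it stays over the reals.\<close>

lemma kernel_functionals:
  fixes f :: "nat \<Rightarrow> ('i \<Rightarrow> 'k::field) \<Rightarrow> 'k"
  assumes lin: "\<And>i x y c. i < k \<Longrightarrow> f i (\<lambda>j. x j + c * y j) = f i x + c * f i y"
    and ling: "\<And>x y c. g (\<lambda>j. x j + c * y j) = g x + c * g y"
    and V: "\<And>x y c. V x \<Longrightarrow> V y \<Longrightarrow> V (\<lambda>j. x j + c * y j)"
    and ker: "\<And>x. V x \<Longrightarrow> (\<forall>i<k. f i x = 0) \<Longrightarrow> g x = 0"
  shows "\<exists>c. \<forall>x. V x \<longrightarrow> g x = (\<Sum>i<k. c i * f i x)"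
  using lin V ker
proof (induction k arbitrary: V)
  case 0
  then show ?case by auto
next
  case (Suc k)
  \<comment> \<open>Induction on the number of functionals: inside the kernel of \<open>f k\<close>
    only \<open>k\<close> of them remain. This is why the statement is relative to a subspace
    \<open>V\<close>.\<close>
  define V' where "V' x \<longleftrightarrow> V x \<and> f k x = 0" for x
  have "\<exists>c. \<forall>x. V' x \<longrightarrow> g x = (\<Sum>i<k. c i * f i x)"
  proof (rule Suc.IH)
    show "\<And>i x y c. i < k \<Longrightarrow> f i (\<lambda>j. x j + c * y j) = f i x + c * f i y"
      using Suc.prems(1) by simp
    show "\<And>x y c. V' x \<Longrightarrow> V' y \<Longrightarrow> V' (\<lambda>j. x j + c * y j)"
      unfolding V'_def using Suc.prems(1)[of k] Suc.prems(2) by simp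
    show "\<And>x. V' x \<Longrightarrow> \<forall>i<k. f i x = 0 \<Longrightarrow> g x = 0"
      unfolding V'_def using Suc.prems(3) by (metis less_Suc_eq)
  qed
  then obtain c where c: "\<And>x. V' x \<Longrightarrow> g x = (\<Sum>i<k. c i * f i x)" by blast
  show ?case
  proof (cases "\<exists>v. V v \<and> f k v \<noteq> 0")
    case False
    then have "g x = (\<Sum>i<Suc k. c i * f i x)" if "V x" for x
      using c[of x] that unfolding V'_def by simp
    then show ?thesis by (intro exI[of _ c]) simp
  next
    case True
    then obtain v where v: "V v" "f k v \<noteq> 0" by blast
    \<comment> \<open>The other coefficients are fixed on the kernel of \<open>f k\<close>; the last
      one is forced by the value at a single vector outside it.\<close>
    define d where "d = (g v - (\<Sum>i<k. c i * f i v)) / f k v"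
    have "g x = (\<Sum>i<Suc k. (c(k := d)) i * f i x)" if "V x" for x
    proof -
      define s where "s = - f k x / f k v"
      have "V' (\<lambda>j. x j + s * v j)"
        unfolding V'_def using Suc.prems(2)[OF that v(1), of s] Suc.prems(1)[of k x s v] v(2)
        by (simp add: s_def)
      from c[OF this] have "g x + s * g v = (\<Sum>i<k. c i * (f i x + s * f i v))"
        using ling Suc.prems(1) by simp
      also have "\<dots> = (\<Sum>i<k. c i * f i x) + s * (\<Sum>i<k. c i * f i v)"
        by (simp add: algebra_simps sum.distrib sum_distrib_left)
      finally have "g x = (\<Sum>i<k. c i * f i x) + f k x * d"
        using v(2) by (simp add: s_def d_def field_simps)
      moreover have "(\<Sum>i<k. (c(k := d)) i * f i x) = (\<Sum>i<k. c i * f i x)"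
        by (rule sum.cong) auto
      ultimately show ?thesis by (simp add: mult.commute)
    qed
    then show ?thesis by (intro exI[of _ "c(k := d)"]) (simp del: fun_upd_apply)
  qed
qed

text \<open>Produces multipliers without speaking of ranks; it serves for matrices over the reals,
  the complex numbers and the rational functions.\<close>

lemma row_space_if_kernel:
  fixes A :: "nat \<Rightarrow> 'i \<Rightarrow> 'k::field"
  assumes I: "finite I"
    and ker: "\<And>x. (\<forall>i<k. (\<Sum>j\<in>I. A i j * x j) = 0) \<Longrightarrow> (\<Sum>j\<in>I. r j * x j) = 0"
  shows "\<exists>c. \<forall>j\<in>I. r j = (\<Sum>i<k. c i * A i j)"
proof -
  have "\<exists>c. \<forall>x. True \<longrightarrow> (\<Sum>j\<in>I. r j * x j) = (\<Sum>i<k. c i * (\<Sum>j\<in>I. A i j * x j))"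
    by (rule kernel_functionals)
      (use ker in \<open>auto simp: algebra_simps sum.distrib sum_distrib_left\<close>)
  then obtain c where
    c: "\<And>x. (\<Sum>j\<in>I. r j * x j) = (\<Sum>i<k. c i * (\<Sum>j\<in>I. A i j * x j))" by blast
  have "r j = (\<Sum>i<k. c i * A i j)" if "j \<in> I" for j
    using c[of "\<lambda>l. if l = j then 1 else 0"] I that by (simp add: if_distrib cong: if_cong)
  then show ?thesis by (intro exI[of _ c]) simp
qed

text \<open>Row \<open>i\<close> is not a combination of the other rows, so some vector is
  annihilated by them but not by row \<open>i\<close>. Rescaled, these vectors are dual to the
  rows.\<close>

lemma independent_rows_surjective:
  fixes A :: "nat \<Rightarrow> 'i \<Rightarrow> 'k::field"
  assumes I: "finite I"
    and ind: "\<And>c. (\<forall>j\<in>I. (\<Sum>i<k. c i * A i j) = 0) \<Longrightarrow> \<forall>i<k. c i = 0"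
  shows "\<exists>x. \<forall>i<k. (\<Sum>j\<in>I. A i j * x j) = b i"
proof -
  have "\<exists>x. (\<Sum>j\<in>I. A i j * x j) = 1 \<and> (\<forall>l<k. l \<noteq> i \<longrightarrow> (\<Sum>j\<in>I. A l j * x j) = 0)"
    if i: "i < k" for i
  proof (rule ccontr)
    assume neg: "\<not> ?thesis"
    define A' where "A' l j = (if l = i then 0 else A l j)" for l j
    have "\<exists>c. \<forall>j\<in>I. A i j = (\<Sum>l<k. c l * A' l j)"
    proof (rule row_space_if_kernel[OF I])
      fix x assume x: "\<forall>l<k. (\<Sum>j\<in>I. A' l j * x j) = 0"
      show "(\<Sum>j\<in>I. A i j * x j) = 0"
      proof (rule ccontr)
        assume s: "(\<Sum>j\<in>I. A i j * x j) \<noteq> 0" (is "?s \<noteq> 0")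
        have "(\<Sum>j\<in>I. A l j * (x j / ?s)) = (\<Sum>j\<in>I. A l j * x j) / ?s" for l
          by (simp add: sum_divide_distrib)
        moreover have "(\<Sum>j\<in>I. A l j * x j) = 0" if "l < k" "l \<noteq> i" for l
          using x that by (auto simp: A'_def)
        ultimately have "(\<Sum>j\<in>I. A i j * (x j / ?s)) = 1 \<and>
            (\<forall>l<k. l \<noteq> i \<longrightarrow> (\<Sum>j\<in>I. A l j * (x j / ?s)) = 0)"
          using s by simp
        with neg[unfolded not_ex, THEN spec, of "\<lambda>j. x j / ?s"] show False by (rule notE)
      qed
    qed
    then obtain c where c: "\<And>j. j \<in> I \<Longrightarrow> A i j = (\<Sum>l<k. c l * A' l j)" by blast
    have "(\<Sum>l<k. (if l = i then -1 else c l) * A l j) = 0" if "j \<in> I" for j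
    proof -
      have "(\<Sum>l<k. (if l = i then -1 else c l) * A l j)
          = (\<Sum>l<k. c l * A' l j + (if l = i then - A i j else 0))"
        by (rule sum.cong) (auto simp: A'_def)
      also have "\<dots> = 0" using c[OF that] i by (simp add: sum.distrib)
      finally show ?thesis .
    qed
    then have "\<forall>l<k. (if l = i then -1 else c l) = 0" by (intro ind) auto
    with i show False by auto
  qed
  then have "\<forall>i\<in>{..<k}. \<exists>x. (\<Sum>j\<in>I. A i j * x j) = 1 \<and>
      (\<forall>l<k. l \<noteq> i \<longrightarrow> (\<Sum>j\<in>I. A l j * x j) = 0)"
    by (intro ballI) simp
  from bchoice[OF this] obtain X where "\<forall>i\<in>{..<k}. (\<Sum>j\<in>I. A i j * X i j) = 1 \<and>
      (\<forall>l<k. l \<noteq> i \<longrightarrow> (\<Sum>j\<in>I. A l j * X i j) = 0)" ..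
  then have X: "\<And>i. i < k \<Longrightarrow> (\<Sum>j\<in>I. A i j * X i j) = 1"
    "\<And>i l. i < k \<Longrightarrow> l < k \<Longrightarrow> l \<noteq> i \<Longrightarrow> (\<Sum>j\<in>I. A l j * X i j) = 0"
    by simp_all
  have "(\<Sum>j\<in>I. A l j * (\<Sum>i<k. b i * X i j)) = b l" if l: "l < k" for l
  proof -
    have "(\<Sum>j\<in>I. A l j * (\<Sum>i<k. b i * X i j)) = (\<Sum>i<k. b i * (\<Sum>j\<in>I. A l j * X i j))"
      by (simp add: sum_distrib_left sum.swap[of _ I] algebra_simps)
    also have "\<dots> = (\<Sum>i<k. if i = l then b i else 0)"
      by (rule sum.cong) (use X l in auto)
    finally show ?thesis using l by simp
  qed
  then show ?thesis by (intro exI[of _ "\<lambda>j. \<Sum>i<k. b i * X i j"]) simp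
qed

text \<open>Gaussian elimination: an unknown with non-zero coefficient in the last equation is
  solved for and substituted into the others.\<close>

lemma wide_system_nontrivial:
  fixes A :: "nat \<Rightarrow> 'i \<Rightarrow> 'k::field"
  assumes I: "finite I" and "k < card I"
  shows "\<exists>x. (\<exists>j\<in>I. x j \<noteq> 0) \<and> (\<forall>i<k. (\<Sum>j\<in>I. A i j * x j) = 0)"
  using assms
proof (induction k arbitrary: A I)
  case 0
  then have "I \<noteq> {}" by auto
  then show ?case by (intro exI[of _ "\<lambda>_. 1"]) auto
next
  case (Suc k)
  show ?case
  proof (cases "\<exists>j\<in>I. A k j \<noteq> 0")
    case False
    obtain x where "\<exists>j\<in>I. x j \<noteq> 0" "\<forall>i<k. (\<Sum>j\<in>I. A i j * x j) = 0"
      using Suc.IH[of I A] Suc.prems by auto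
    with False show ?thesis by (intro exI[of _ x]) (auto simp: less_Suc_eq)
  next
    case True
    then obtain j0 where j0: "j0 \<in> I" "A k j0 \<noteq> 0" by blast
    define A' where "A' i j = A i j - A i j0 * A k j / A k j0" for i j
    have "k < card (I - {j0})" using Suc.prems j0 by simp
    then obtain x where x: "\<exists>j\<in>I - {j0}. x j \<noteq> 0"
      "\<forall>i<k. (\<Sum>j\<in>I - {j0}. A' i j * x j) = 0"
      using Suc.IH[of "I - {j0}" A'] Suc.prems by auto
    define y where "y = x(j0 := - (\<Sum>j\<in>I - {j0}. A k j * x j) / A k j0)"
    have split: "(\<Sum>j\<in>I. A i j * y j)
        = - A i j0 * (\<Sum>j\<in>I - {j0}. A k j * x j) / A k j0 + (\<Sum>j\<in>I - {j0}. A i j * x j)" for i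
    proof -
      have "(\<Sum>j\<in>I. A i j * y j) = A i j0 * y j0 + (\<Sum>j\<in>I - {j0}. A i j * y j)"
        using sum.remove[OF Suc.prems(1) j0(1)] by simp
      also have "(\<Sum>j\<in>I - {j0}. A i j * y j) = (\<Sum>j\<in>I - {j0}. A i j * x j)"
        by (rule sum.cong) (auto simp: y_def)
      finally show ?thesis by (simp add: y_def)
    qed
    have "(\<Sum>j\<in>I. A i j * y j) = 0" if "i < Suc k" for i
    proof (cases "i = k")
      case True
      then show ?thesis unfolding split using j0 by simp
    next
      case False
      then have "(\<Sum>j\<in>I - {j0}. A' i j * x j) = 0" using x(2) that by auto
      then show ?thesis unfolding split
        by (simp add: A'_def left_diff_distrib sum_subtractf sum_distrib_left sum_divide_distrib
          mult.assoc sum_negf)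
    qed
    moreover have "\<exists>j\<in>I. y j \<noteq> 0" using x(1) by (auto simp: y_def)
    ultimately show ?thesis by blast
  qed
qed

text \<open>If the bound failed, there would be more kernel vectors than indices outside a maximal
  independent set of columns, and a nontrivial combination of them would vanish at all those
  indices. Its remaining entries would be a linear dependence among independent columns.\<close>

lemma rank_plus_kernel_le:
  fixes A :: "'k::field mat" and X :: "nat \<Rightarrow> nat \<Rightarrow> 'k"
  assumes A: "A \<in> carrier_mat nr nc"
    and ker: "\<And>i l. i < nr \<Longrightarrow> l < k \<Longrightarrow> (\<Sum>j<nc. A $$ (i, j) * X l j) = 0"
    and ind: "\<And>c. (\<And>j. j < nc \<Longrightarrow> (\<Sum>l<k. c l * X l j) = 0) \<Longrightarrow> \<forall>l<k. c l = 0"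
  shows "vec_space.rank nr A + k \<le> nc"
proof (rule ccontr)
  assume neg: "\<not> ?thesis"
  interpret vec_space "TYPE('k)" nr .
  have "lin_indpt {}" by (rule finite_lin_indpt2) auto
  then obtain S where S: "maximal S (\<lambda>T. T \<subseteq> set (cols A) \<and> lin_indpt T)"
    using maximal_exists_superset[of "set (cols A)" "\<lambda>T. T \<subseteq> set (cols A) \<and> lin_indpt T" "{}"]
    by auto
  then have card: "rank A = card S" using rank_card_indpt[OF A] by blast
  from S have Ssub: "S \<subseteq> set (cols A)" and Sind: "lin_indpt S"
    unfolding maximal_def by auto
  have finS: "finite S" using Ssub finite_subset by blast
  have "\<forall>s\<in>S. \<exists>j<nc. s = col A j" using Ssub A
    by (fastforce simp: cols_def)
  \<comment> \<open>\<open>S\<close> is a set of vectors, so equal columns are counted once;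
    \<open>ix\<close> selects one index for each of them.\<close>
  from bchoice[OF this] obtain ix
    where ix: "\<And>s. s \<in> S \<Longrightarrow> ix s < nc \<and> s = col A (ix s)" by blast
  define I where "I = {..<nc} - ix ` S"
  have inj: "inj_on ix S" by (rule inj_on_inverseI[of _ "col A"]) (use ix in simp)
  have cI: "card I = nc - rank A"
    unfolding I_def card using inj ix
    by (subst card_Diff_subset) (auto simp: finS card_image)
  obtain h where h: "bij_betw h {..<card I} I"
    using ex_bij_betw_nat_finite[of I] unfolding I_def by (auto simp: lessThan_atLeast0)
  have "card I < card {..<k}" using neg cI rank_le_nc[OF A] by simp
  from wide_system_nontrivial[OF _ this, of "\<lambda>i l. X l (h i)"] obtain c where
    c0: "\<exists>l<k. c l \<noteq> 0" and c: "\<And>i. i < card I \<Longrightarrow> (\<Sum>l<k. X l (h i) * c l) = 0" by auto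
  define y where "y j = (\<Sum>l<k. c l * X l j)" for j
  have yI: "y j = 0" if "j \<in> I" for j
  proof -
    have "j \<in> h ` {..<card I}" using h \<open>j \<in> I\<close> unfolding bij_betw_def by simp
    then obtain i where "i < card I" "h i = j" by auto
    with c[of i] show ?thesis by (simp add: y_def mult.commute)
  qed
  have Ay: "(\<Sum>j<nc. A $$ (i, j) * y j) = 0" if "i < nr" for i
  proof -
    have "(\<Sum>j<nc. A $$ (i, j) * y j) = (\<Sum>l<k. c l * (\<Sum>j<nc. A $$ (i, j) * X l j))"
      unfolding y_def by (simp add: sum_distrib_left sum.swap[of _ "{..<k}"] algebra_simps)
    also have "\<dots> = 0" using ker that by simp
    finally show ?thesis .
  qed
  have "lincomb (\<lambda>s. y (ix s)) S = 0\<^sub>v nr"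
  proof (rule eq_vecI)
    have SV: "S \<subseteq> carrier_vec nr" using Ssub A cols_dim by blast
    then have dim: "dim_vec (lincomb (\<lambda>s. y (ix s)) S) = nr" using lincomb_dim[OF finS] by auto
    then show "dim_vec (lincomb (\<lambda>s. y (ix s)) S) = dim_vec (0\<^sub>v nr)" by simp
    fix i assume "i < dim_vec (0\<^sub>v nr :: 'k vec)"
    then have i: "i < nr" by simp
    have "lincomb (\<lambda>s. y (ix s)) S $ i = (\<Sum>s\<in>S. y (ix s) * s $ i)"
      by (rule lincomb_index[OF i SV])
    also have "\<dots> = (\<Sum>s\<in>S. A $$ (i, ix s) * y (ix s))"
    proof (rule sum.cong[OF refl])
      fix s assume "s \<in> S"
      with ix have "s = col A (ix s)" "ix s < nc" by auto
      then have "s $ i = A $$ (i, ix s)" using A i by (metis carrier_matD index_col)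
      then show "y (ix s) * s $ i = A $$ (i, ix s) * y (ix s)" by simp
    qed
    also have "\<dots> = (\<Sum>j\<in>ix ` S. A $$ (i, j) * y j)"
      by (simp add: sum.reindex[OF inj])
    also have "\<dots> = (\<Sum>j<nc. A $$ (i, j) * y j)"
      by (rule sum.mono_neutral_left) (use ix yI in \<open>auto simp: I_def\<close>)
    finally show "lincomb (\<lambda>s. y (ix s)) S $ i = 0\<^sub>v nr $ i" using Ay i by simp
  qed
  then have "y (ix s) = 0" if "s \<in> S" for s
    using not_lindepD[OF Sind finS subset_refl, of "\<lambda>s. y (ix s)"] that by auto
  then have "y j = 0" if "j < nc" for j
    using yI[of j] that unfolding I_def by blast
  then have "\<forall>l<k. c l = 0" unfolding y_def by (rule ind)
  with c0 show False by blast
qed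

section \<open>Sylvester and Riccati equations\<close>

text \<open>Row- and column-finite infinite matrices form a ring with transposition that contains the matrices
  of all sizes: \<open>proj {..<n} * x * proj {..<m} = x\<close> says that \<open>x\<close> is an \<open>n \<times> m\<close> matrix, and vectors
  are carried by column \<open>0\<close>.\<close>

typedef rcmat = "{f :: nat \<Rightarrow> nat \<Rightarrow> real. (\<forall>i. finite {j. f i j \<noteq> 0}) \<and> (\<forall>j. finite {i. f i j \<noteq> 0})}"
  morphisms ent Abs_rcmat
  by (intro exI[of _ "\<lambda>_ _. 0"]) auto

setup_lifting type_definition_rcmat

lemma rcmat_eqI: "(\<And>i j. ent a i j = ent b i j) \<Longrightarrow> a = b"
  by (metis ent_inject ext)

lemma finite_ent_row: "finite {j. ent a i j \<noteq> 0}" and finite_ent_col: "finite {i. ent a i j \<noteq> 0}"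
  using ent[of a] by auto

lemma finite_support_add: "finite {i. f i + g i \<noteq> (0::real)}"
  and finite_support_diff: "finite {i. f i \<noteq> g i}"
  if "finite {i. f i \<noteq> 0}" "finite {i. g i \<noteq> 0}" for f g :: "nat \<Rightarrow> real"
  by (rule finite_subset[OF _ finite_UnI[OF that]]; auto)+

instantiation rcmat :: real_vector
begin

lift_definition zero_rcmat :: rcmat is "\<lambda>_ _. 0" by auto

lift_definition plus_rcmat :: "rcmat \<Rightarrow> rcmat \<Rightarrow> rcmat" is "\<lambda>f g i j. f i j + g i j"
  by (simp add: finite_support_add)

lift_definition uminus_rcmat :: "rcmat \<Rightarrow> rcmat" is "\<lambda>f i j. - f i j" by simp

lift_definition minus_rcmat :: "rcmat \<Rightarrow> rcmat \<Rightarrow> rcmat" is "\<lambda>f g i j. f i j - g i j"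
  by (simp add: finite_support_diff)

lift_definition scaleR_rcmat :: "real \<Rightarrow> rcmat \<Rightarrow> rcmat" is "\<lambda>c f i j. c * f i j"
  by (simp add: finite_subset)

instance
  by standard (transfer; auto simp: algebra_simps fun_eq_iff)+

end

lemma ent_simps [simp]:
  "ent 0 i j = 0" "ent (a + b) i j = ent a i j + ent b i j" "ent (a - b) i j = ent a i j - ent b i j"
  "ent (- a) i j = - ent a i j" "ent (c *\<^sub>R a) i j = c * ent a i j"
  by (transfer, simp)+

lemma ent_sum: "ent (\<Sum>x\<in>X. f x) i j = (\<Sum>x\<in>X. ent (f x) i j)"
  by (induction X rule: infinite_finite_induct) auto

lift_definition proj :: "nat set \<Rightarrow> rcmat" is "\<lambda>S i j. if i = j \<and> i \<in> S then 1 else 0"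
  by (auto intro: finite_subset[of _ "{_}"])

lift_definition tr :: "rcmat \<Rightarrow> rcmat" is "\<lambda>f i j. f j i" by simp

lemma ent_tr [simp]: "ent (tr a) i j = ent a j i" by transfer simp

lemma ent_proj: "ent (proj S) i j = (if i = j \<and> i \<in> S then 1 else 0)" by transfer simp

instantiation rcmat :: real_algebra_1
begin

lift_definition times_rcmat :: "rcmat \<Rightarrow> rcmat \<Rightarrow> rcmat"
  is "\<lambda>f g i j. \<Sum>k | f i k \<noteq> 0. f i k * g k j"
proof (intro conjI allI)
  fix f g :: "nat \<Rightarrow> nat \<Rightarrow> real" and i j
  assume f: "(\<forall>i. finite {j. f i j \<noteq> 0}) \<and> (\<forall>j. finite {i. f i j \<noteq> 0})"
    and g: "(\<forall>i. finite {j. g i j \<noteq> 0}) \<and> (\<forall>j. finite {i. g i j \<noteq> 0})"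
  show "finite {j. (\<Sum>k | f i k \<noteq> 0. f i k * g k j) \<noteq> 0}"
    by (rule finite_subset[of _ "\<Union>k\<in>{k. f i k \<noteq> 0}. {j. g k j \<noteq> 0}"])
      (use f g in \<open>auto elim!: sum.not_neutral_contains_not_neutral\<close>)
  show "finite {i. (\<Sum>k | f i k \<noteq> 0. f i k * g k j) \<noteq> 0}"
    by (rule finite_subset[of _ "\<Union>k\<in>{k. g k j \<noteq> 0}. {i. f i k \<noteq> 0}"])
      (use f g in \<open>auto elim!: sum.not_neutral_contains_not_neutral\<close>)
qed

definition one_rcmat :: rcmat where "1 = proj UNIV"

lemma ent_times0: "ent (a * b) i j = (\<Sum>k | ent a i k \<noteq> 0. ent a i k * ent b k j)"
  by transfer simp

lemma ent_times:
  assumes "finite K" "\<And>k. k \<notin> K \<Longrightarrow> ent a i k = 0 \<or> ent b k j = 0"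
  shows "ent (a * b) i j = (\<Sum>k\<in>K. ent a i k * ent b k j)"
proof -
  have "ent (a * b) i j = (\<Sum>k\<in>K \<union> {k. ent a i k \<noteq> 0}. ent a i k * ent b k j)"
    unfolding ent_times0 by (rule sum.mono_neutral_left) (auto simp: assms finite_ent_row)
  also have "\<dots> = (\<Sum>k\<in>K. ent a i k * ent b k j)"
    by (rule sum.mono_neutral_right) (use assms finite_ent_row in auto)
  finally show ?thesis .
qed

instance
proof
  fix a b c :: rcmat and r :: real
  show "a * b * c = a * (b * c)"
  proof (rule rcmat_eqI)
    fix i j
    define K where "K = {k. ent a i k \<noteq> 0}"
    define L where "L = (\<Union>k\<in>K. {l. ent b k l \<noteq> 0})"
    have fin: "finite K" "finite L" unfolding K_def L_def by (auto simp: finite_ent_row)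
    have ab: "ent (a * b) i l = (\<Sum>k\<in>K. ent a i k * ent b k l)" for l
      by (rule ent_times) (auto simp: finite_ent_row K_def)
    have "ent (a * b * c) i j = (\<Sum>l\<in>L. ent (a * b) i l * ent c l j)"
      by (rule ent_times[OF fin(2)]) (auto simp: ab L_def intro!: sum.neutral)
    also have "\<dots> = (\<Sum>k\<in>K. \<Sum>l\<in>L. ent a i k * (ent b k l * ent c l j))"
      unfolding ab by (subst sum.swap) (simp add: sum_distrib_right mult.assoc)
    also have "\<dots> = (\<Sum>k\<in>K. ent a i k * ent (b * c) k j)"
      by (rule sum.cong[OF refl], subst ent_times[OF fin(2)]) (auto simp: L_def sum_distrib_left)
    also have "\<dots> = ent (a * (b * c)) i j"
      by (rule ent_times[symmetric]) (auto simp: finite_ent_row K_def)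
    finally show "ent (a * b * c) i j = ent (a * (b * c)) i j" .
  qed
  show "1 * a = a"
    by (rule rcmat_eqI, rule trans[OF ent_times[of "{i}" for i]])
      (auto simp: one_rcmat_def ent_proj)
  show "a * 1 = a"
  proof (rule rcmat_eqI)
    fix i j
    show "ent (a * 1) i j = ent a i j"
      by (rule trans[OF ent_times[of "{j}"]]) (auto simp: one_rcmat_def ent_proj)
  qed
  show "(a + b) * c = a * c + b * c"
  proof (rule rcmat_eqI)
    fix i j
    let ?K = "{k. ent a i k \<noteq> 0} \<union> {k. ent b i k \<noteq> 0}"
    have K: "finite ?K" by (simp add: finite_ent_row)
    have "ent ((a + b) * c) i j = (\<Sum>k\<in>?K. ent (a + b) i k * ent c k j)"
      by (rule ent_times[OF K]) auto
    moreover have "ent (a * c) i j = (\<Sum>k\<in>?K. ent a i k * ent c k j)"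
      by (rule ent_times[OF K]) auto
    moreover have "ent (b * c) i j = (\<Sum>k\<in>?K. ent b i k * ent c k j)"
      by (rule ent_times[OF K]) auto
    ultimately show "ent ((a + b) * c) i j = ent (a * c + b * c) i j"
      by (simp add: distrib_right sum.distrib)
  qed
  show "a * (b + c) = a * b + a * c"
    by (rule rcmat_eqI) (simp add: ent_times0 distrib_left sum.distrib)
  show "(r *\<^sub>R a) * b = r *\<^sub>R (a * b)"
  proof (rule rcmat_eqI)
    fix i j
    have "ent ((r *\<^sub>R a) * b) i j = (\<Sum>k\<in>{k. ent a i k \<noteq> 0}. ent (r *\<^sub>R a) i k * ent b k j)"
      by (rule ent_times) (auto simp: finite_ent_row)
    then show "ent ((r *\<^sub>R a) * b) i j = ent (r *\<^sub>R (a * b)) i j"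
      by (simp add: ent_times0 sum_distrib_left mult.assoc)
  qed
  show "a * (r *\<^sub>R b) = r *\<^sub>R (a * b)"
    by (rule rcmat_eqI) (simp add: ent_times0 sum_distrib_left algebra_simps)
  have "ent (0 :: rcmat) 0 0 \<noteq> ent 1 0 0" by (simp add: one_rcmat_def ent_proj)
  then show "(0 :: rcmat) \<noteq> 1" by metis
qed

end

lemma tr_simps [simp]:
  "tr 0 = 0" "tr (a + b) = tr a + tr b" "tr (a - b) = tr a - tr b" "tr (- a) = - tr a"
  "tr (c *\<^sub>R a) = c *\<^sub>R tr a" "tr (tr a) = a" "tr 1 = 1" "tr (proj S) = proj S"
  by (rule rcmat_eqI; auto simp: one_rcmat_def ent_proj)+

lemma tr_mult [simp]: "tr (a * b) = tr b * tr a"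
proof (rule rcmat_eqI)
  fix i j
  have "ent (tr b * tr a) i j = (\<Sum>k | ent a j k \<noteq> 0. ent (tr b) i k * ent (tr a) k j)"
    by (rule ent_times) (auto simp: finite_ent_row)
  then show "ent (tr (a * b)) i j = ent (tr b * tr a) i j"
    by (simp add: ent_times0 mult.commute)
qed

lemma tr_mult_eq: "a * b = c \<Longrightarrow> tr b * tr a = tr c"
  by auto

lemma tr_power [simp]: "tr (a ^ k) = tr a ^ k"
  by (induction k) (simp_all add: power_commutes)

lemma ent_proj_mult: "ent (proj S * a) i j = (if i \<in> S then ent a i j else 0)"
  by (rule trans[OF ent_times[of "{i}"]]) (auto simp: ent_proj)

lemma ent_mult_proj: "ent (a * proj S) i j = (if j \<in> S then ent a i j else 0)"
  by (rule trans[OF ent_times[of "{j}"]]) (auto simp: ent_proj)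

lemma proj_mult_proj [simp]: "proj S * proj T = proj (S \<inter> T)"
  by (rule rcmat_eqI) (auto simp: ent_proj_mult ent_proj)

lemma proj_empty [simp]: "proj {} = 0"
  by (rule rcmat_eqI) (auto simp: ent_proj)

lemma proj_mult_eq_iff: "proj S * a = a \<longleftrightarrow> (\<forall>i j. i \<notin> S \<longrightarrow> ent a i j = 0)"
  by (metis (full_types) ent_proj_mult rcmat_eqI)

lemma mult_proj_eq_iff: "a * proj S = a \<longleftrightarrow> (\<forall>i j. j \<notin> S \<longrightarrow> ent a i j = 0)"
  by (metis (full_types) ent_mult_proj rcmat_eqI)

text \<open>Index sets instead of sizes allow a block to sit anywhere, such as \<open>A2\<close> at
  \<open>{n1..<n}\<close>. The finiteness guard makes the definition total.\<close>

lift_definition block :: "nat set \<Rightarrow> nat set \<Rightarrow> (nat \<Rightarrow> nat \<Rightarrow> real) \<Rightarrow> rcmat" is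
  "\<lambda>I J f i j. if finite I \<and> finite J \<and> i \<in> I \<and> j \<in> J then f i j else 0"
  by (intro conjI allI) (auto intro: finite_subset)

lemma ent_block: "finite I \<Longrightarrow> finite J \<Longrightarrow> ent (block I J f) i j = (if i \<in> I \<and> j \<in> J then f i j else 0)"
  by transfer simp

lemma proj_block: "finite I \<Longrightarrow> finite J \<Longrightarrow> I \<subseteq> S \<Longrightarrow> proj S * block I J f = block I J f"
  by (auto simp: proj_mult_eq_iff ent_block)

lemma block_proj: "finite I \<Longrightarrow> finite J \<Longrightarrow> J \<subseteq> S \<Longrightarrow> block I J f * proj S = block I J f"
  by (auto simp: mult_proj_eq_iff ent_block)

section \<open>Polynomials in a ring element and Sylvester equations\<close>

definition peval :: "real poly \<Rightarrow> 'a::real_algebra_1 \<Rightarrow> 'a" where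
  "peval p A = fold_coeffs (\<lambda>c acc. c *\<^sub>R 1 + A * acc) p 0"

lemma peval_0 [simp]: "peval 0 A = 0" by (simp add: peval_def)

lemma peval_pCons [simp]: "peval (pCons c p) A = c *\<^sub>R 1 + A * peval p A"
  by (cases "p = 0 \<and> c = 0") (auto simp: peval_def)

lemma peval_1 [simp]: "peval 1 A = 1"
  unfolding one_pCons by simp

lemma peval_add: "peval (p + q) A = peval p A + peval q A"
  by (induction p q rule: poly_induct2) (auto simp: algebra_simps)

lemma peval_smult: "peval (Polynomial.smult c p) A = c *\<^sub>R peval p A"
  by (induction p) (auto simp: algebra_simps)

lemma peval_minus: "peval (- p) A = - peval p A"
  using peval_smult[of "-1" p A] by simp

lemma peval_mult: "peval (p * q) A = peval p A * peval q A"
  by (induction p) (auto simp: algebra_simps peval_add peval_smult)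

lemma peval_sum: "peval (\<Sum>x\<in>X. f x) A = (\<Sum>x\<in>X. peval (f x) A)"
  by (induction X rule: infinite_finite_induct) (auto simp: peval_add)

lemma peval_monom: "peval (monom c k) A = c *\<^sub>R A ^ k"
  by (induction k) (auto simp: monom_Suc monom_0)

text \<open>Covers commutation (\<open>B = A\<close>) and also transports an annihilating polynomial
  from one matrix to another through \<open>X\<close>.\<close>

lemma peval_intertwine: "A * X = X * B \<Longrightarrow> peval p A * X = X * peval p B"
proof (induction p)
  case (pCons c p)
  have "A * (X * peval p B) = X * (B * peval p B)"
    using pCons.prems by (simp flip: mult.assoc)
  with pCons show ?case by (simp add: algebra_simps)
qed simp

lemma tr_peval [simp]: "tr (peval p A) = peval p (tr A)"
  by (induction p) (auto simp: peval_intertwine)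

lemma peval_neg: "peval (pcompose p [:0, -1:]) A = peval p (- A)"
  by (induction p) (auto simp: pcompose_pCons peval_add peval_minus algebra_simps)

text \<open>Up to the factor that inverts \<open>q(M)\<close>, this is the divided difference
  \<open>(q(M) - q(N)) / (M - N)\<close> applied to \<open>C\<close>.\<close>

lemma sylvester_divided_difference:
  fixes M N C :: "'a::real_algebra_1"
  shows "\<exists>S. M * S - S * N = peval q M * C - C * peval q N \<and>
    (\<forall>E. E * M = M * E \<longrightarrow> E * C = C \<longrightarrow> E * S = S) \<and>
    (\<forall>E. E * N = N * E \<longrightarrow> C * E = C \<longrightarrow> S * E = S)"
proof (induction q)
  case 0
  show ?case by (intro exI[of _ 0]) auto
next
  case (pCons c q)
  then obtain S where S: "M * S - S * N = peval q M * C - C * peval q N"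
    "\<And>E. E * M = M * E \<Longrightarrow> E * C = C \<Longrightarrow> E * S = S"
    "\<And>E. E * N = N * E \<Longrightarrow> C * E = C \<Longrightarrow> S * E = S" by blast
  have N: "peval q N * N = N * peval q N" by (rule peval_intertwine) simp
  show ?case
  proof (intro exI[of _ "peval q M * C + S * N"] conjI allI impI)
    have "M * S = peval q M * C - C * peval q N + S * N" using S(1) by (simp add: algebra_simps)
    then have "M * (S * N) = (peval q M * C - C * peval q N + S * N) * N"
      by (simp flip: mult.assoc)
    then show "M * (peval q M * C + S * N) - (peval q M * C + S * N) * N =
        peval (pCons c q) M * C - C * peval (pCons c q) N"
      using N by (simp add: algebra_simps)
    fix E
    show "E * (peval q M * C + S * N) = peval q M * C + S * N" if "E * M = M * E" "E * C = C"
      using S(2)[OF that] peval_intertwine[OF that(1)[symmetric], of q] that(2)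
      by (metis distrib_left mult.assoc)
    show "(peval q M * C + S * N) * E = peval q M * C + S * N" if "E * N = N * E" "C * E = C"
      using S(3)[OF that] that by (metis distrib_right mult.assoc)
  qed
qed

text \<open>The Bezout factor \<open>v\<close> makes \<open>peval v M\<close> invert
  \<open>peval q M\<close> on \<open>C\<close>, which turns the divided difference into a solution.
  The polynomials are only required to annihilate \<open>C\<close>, because in the ring of infinite
  matrices a polynomial in a corner matrix does not vanish outside the corner. The last two clauses
  keep the solution in the corner of \<open>C\<close>.\<close>

lemma sylvester_solvable:
  fixes M N C :: "'a::real_algebra_1"
  assumes a: "peval a M * C = 0" and q: "C * peval q N = 0" and "coprime a q"
  obtains K where "M * K - K * N = C"
    "\<And>E. E * M = M * E \<Longrightarrow> E * C = C \<Longrightarrow> E * K = K"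
    "\<And>E. E * N = N * E \<Longrightarrow> C * E = C \<Longrightarrow> K * E = K"
proof -
  obtain u v where uv: "u * a + v * q = 1"
    using \<open>coprime a q\<close> by (metis bezout_coefficients_fst_snd coprime_iff_gcd_eq_1)
  obtain S where S: "M * S - S * N = peval q M * C - C * peval q N"
    "\<And>E. E * M = M * E \<Longrightarrow> E * C = C \<Longrightarrow> E * S = S"
    "\<And>E. E * N = N * E \<Longrightarrow> C * E = C \<Longrightarrow> S * E = S"
    using sylvester_divided_difference[of M N q C] by blast
  have vM: "peval v M * M = M * peval v M" by (rule peval_intertwine) simp
  have "peval (u * a + v * q) M * C = C" unfolding uv by simp
  then have vq: "peval v M * (peval q M * C) = C"
    using a by (simp add: peval_add peval_mult distrib_right mult.assoc)
  show ?thesis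
  proof (rule that[of "peval v M * S"])
    have "M * (peval v M * S) - peval v M * S * N = peval v M * (M * S - S * N)"
      using vM by (simp add: algebra_simps flip: mult.assoc)
    then show "M * (peval v M * S) - peval v M * S * N = C"
      using S(1) q vq by simp
    show "E * (peval v M * S) = peval v M * S" if "E * M = M * E" "E * C = C" for E
      using S(2)[OF that] peval_intertwine[OF that(1)[symmetric], of v] by (metis mult.assoc)
    show "peval v M * S * E = peval v M * S" if "E * N = N * E" "C * E = C" for E
      using S(3)[OF that] by (simp add: mult.assoc)
  qed
qed

text \<open>Common factors with \<open>c\<close> are divided out until none is left. For an
  annihilating polynomial \<open>a\<close> this separates the eigenvalues that are roots of
  \<open>c\<close> from the others.\<close>

lemma split_coprime_part:
  fixes a c :: "real poly"
  assumes "a \<noteq> 0"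
  shows "\<exists>g b k. a = g * b \<and> coprime g c \<and> b dvd c ^ k"
  using assms
proof (induction "degree a" arbitrary: a rule: less_induct)
  case less
  show ?case
  proof (cases "coprime a c")
    case True
    then show ?thesis by (intro exI[of _ a] exI[of _ 1]) auto
  next
    case False
    define h where "h = gcd a c"
    obtain a' where a': "a = h * a'" unfolding h_def by (metis gcd_dvd1 dvdE)
    have "h \<noteq> 0" "a' \<noteq> 0" using less.prems a' by auto
    moreover have "\<not> is_unit h" using False unfolding h_def by (simp add: coprime_iff_gcd_eq_1 is_unit_gcd)
    ultimately have "degree a' < degree a"
      using a' by (simp add: degree_mult_eq is_unit_iff_degree)
    from less.hyps[OF this \<open>a' \<noteq> 0\<close>] obtain g b k where
      gb: "a' = g * b" "coprime g c" "b dvd c ^ k" by blast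
    have "h * b dvd c ^ Suc k" unfolding power_Suc using gb(3) h_def by (intro mult_dvd_mono) auto
    then show ?thesis using gb a' by (intro exI[of _ g] exI[of _ "h * b"] exI[of _ "Suc k"]) auto
  qed
qed

text \<open>Each row of \<open>G\<close> lies in the row space of \<open>Y\<close>. With a
  projection as \<open>G\<close>, this inverts \<open>Y\<close> on a corner.\<close>

lemma left_quotient_if_kernel:
  assumes Y: "proj {..<n} * Y = Y" "Y * proj {..<n} = Y"
    and G: "proj {..<n} * G = G" "G * proj {..<n} = G"
    and ker: "\<And>y. Y * y = 0 \<Longrightarrow> G * y = 0"
  shows "\<exists>Z. Z * Y = G"
proof -
  have Y0: "ent Y i j = 0" if "i \<ge> n \<or> j \<ge> n" for i j
    using Y that unfolding proj_mult_eq_iff mult_proj_eq_iff by auto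
  have G0: "ent G i j = 0" if "i \<ge> n \<or> j \<ge> n" for i j
    using G that unfolding proj_mult_eq_iff mult_proj_eq_iff by auto
  have "\<exists>c. \<forall>j\<in>{..<n}. ent G i j = (\<Sum>l<n. c l * ent Y l j)" for i
  proof (rule row_space_if_kernel)
    fix x assume x: "\<forall>l<n. (\<Sum>j<n. ent Y l j * x j) = 0"
    define y where "y = block {..<n} {0} (\<lambda>l _. x l)"
    have ent: "ent (M * y) l t = (\<Sum>j<n. ent M l j * (if t = 0 then x j else 0))" for M l t
      unfolding y_def by (rule trans[OF ent_times[of "{..<n}"]]) (auto simp: ent_block)
    have "Y * y = 0"
    proof (rule rcmat_eqI)
      fix l t
      show "ent (Y * y) l t = ent 0 l t"
        unfolding ent using x Y0 by (cases "l < n"; cases "t = 0") auto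
    qed
    from ker[OF this] have "ent (G * y) i 0 = 0" by simp
    then show "(\<Sum>j<n. ent G i j * x j) = 0" unfolding ent by simp
  qed auto
  then obtain c where c: "\<And>i j. j < n \<Longrightarrow> ent G i j = (\<Sum>l<n. c i l * ent Y l j)"
    by (metis lessThan_iff)
  have "block {..<n} {..<n} c * Y = G"
  proof (rule rcmat_eqI)
    fix i j
    have "ent (block {..<n} {..<n} c * Y) i j = (\<Sum>l<n. (if i < n then c i l else 0) * ent Y l j)"
      by (rule trans[OF ent_times[of "{..<n}"]]) (auto simp: ent_block)
    also have "\<dots> = ent G i j"
      using c[of j i] G0[of i j] Y0 by (cases "i < n"; cases "j < n") auto
    finally show "ent (block {..<n} {..<n} c * Y) i j = ent G i j" .
  qed
  then show ?thesis by blast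
qed

text \<open>Restricted to the corner, the powers live in a space of dimension
  \<open>card (S \<times> S)\<close>, so one more power than that gives a dependence. Outside the
  corner \<open>peval a A\<close> still has the constant coefficient of \<open>a\<close> on the
  diagonal, hence the factor \<open>proj S\<close>.\<close>

lemma annihilating_poly_exists:
  assumes "finite S" "proj S * A = A" 
  shows "\<exists>a. a \<noteq> 0 \<and> peval a A * proj S = 0"
proof -
  define e where "e = proj S"
  obtain h where h: "bij_betw h {..<card (S \<times> S)} (S \<times> S)"
    using ex_bij_betw_nat_finite[of "S \<times> S"] \<open>finite S\<close> by (auto simp: lessThan_atLeast0)
  let ?N = "card (S \<times> S)"
  obtain x where x: "\<exists>k\<in>{..?N}. x k \<noteq> 0"
    "\<And>i. i < ?N \<Longrightarrow> (\<Sum>k\<le>?N. ent (A ^ k * e) (fst (h i)) (snd (h i)) * x k) = 0"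
    using wide_system_nontrivial[of "{..?N}" ?N "\<lambda>i k. ent (A ^ k * e) (fst (h i)) (snd (h i))"]
    by auto
  define a where "a = (\<Sum>k\<le>?N. monom (x k) k)"
  have coeff: "coeff a k = x k" if "k \<le> ?N" for k
    unfolding a_def using that by (simp add: coeff_sum)
  have "peval a A * e = 0"
  proof (rule rcmat_eqI)
    fix i j
    have corner: "ent (A ^ k * e) i j = 0" if "\<not> (i \<in> S \<and> j \<in> S)" for k
    proof -
      have "proj S * (A ^ k * e) = A ^ k * e"
        using assms(2) unfolding e_def by (cases k) (simp_all flip: mult.assoc)
      moreover have "A ^ k * e * proj S = A ^ k * e" unfolding e_def by (simp add: mult.assoc)
      ultimately show ?thesis using that unfolding proj_mult_eq_iff mult_proj_eq_iff by blast
    qed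
    have eq: "ent (peval a A * e) i j = (\<Sum>k\<le>?N. ent (A ^ k * e) i j * x k)"
      unfolding a_def peval_sum peval_monom sum_distrib_right ent_sum by (simp add: mult.commute)
    show "ent (peval a A * e) i j = ent 0 i j"
    proof (cases "i \<in> S \<and> j \<in> S")
      case True
      then have "(i, j) \<in> h ` {..<?N}" using h unfolding bij_betw_def by simp
      then obtain l where "l < ?N" "h l = (i, j)" by auto
      with x(2)[of l] show ?thesis unfolding eq by simp
    qed (simp add: eq corner)
  qed
  moreover have "a \<noteq> 0" using x(1) coeff by auto
  ultimately show ?thesis unfolding e_def by blast
qed

text \<open>The Lyapunov solution \<open>Y\<close> on the spectral part cut out by \<open>E\<close> is invertible there by
  controllability; its inverse \<open>\<Delta>\<close> moves these closed-loop eigenvalues to their negatives without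
  changing the residual of the Riccati equation.\<close>

lemma riccati_flip:
  fixes A B Wi :: rcmat and a c :: "real poly" and n :: nat
  defines "e \<equiv> proj {..<n}" and "S \<equiv> B * Wi * tr B"
  assumes eA: "e * A = A" "A * e = A"
    and eB: "e * B = B" "B * em = B" and trem: "tr em = em" and trWi: "tr Wi = Wi"
    and pos: "\<And>z. tr z * Wi * z = 0 \<Longrightarrow> em * z = 0"
    and ctrl: "\<And>y. (\<And>k. y * A ^ k * B = 0) \<Longrightarrow> y * e = 0"
    and a0: "a \<noteq> 0" and aA: "peval a A * e = 0"
    and cop: "coprime c (pcompose c [:0, -1:])"
  shows "\<exists>\<Delta> a'. tr \<Delta> = \<Delta> \<and> e * \<Delta> = \<Delta> \<and> tr A * \<Delta> + \<Delta> * A + \<Delta> * S * \<Delta> = 0 \<and>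
    coprime a' c \<and> peval a' (A + S * \<Delta>) * e = 0"
proof -
  have ee: "e * e = e" "tr e = e" by (simp_all add: e_def)
  have trS: "tr S = S" by (simp add: S_def trWi mult.assoc)
  obtain g b k where gb: "a = g * b" "coprime g c" "b dvd c ^ k"
    using split_coprime_part[OF a0] by blast
  \<comment> \<open>The roots of \<open>b\<close> are roots of \<open>c\<close>: these are the
    eigenvalues to be reflected, and \<open>bn\<close> has their negatives as roots. Coprimality of
    \<open>c\<close> with its reflection makes \<open>b\<close> coprime to \<open>bn\<close> and
    \<open>bn\<close> coprime to \<open>c\<close>.\<close>
  define bn where "bn = pcompose b [:0, -1:]"
  obtain b' where b': "c ^ k = b * b'" using gb(3) by blast
  have "coprime (c ^ k) (pcompose c [:0, -1:] ^ k)"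
    using cop by (cases "k = 0") (auto simp: coprime_power_left_iff coprime_power_right_iff)
  moreover have "pcompose c [:0, -1:] ^ k = bn * pcompose b' [:0, -1:]"
    unfolding bn_def pcompose_mult[symmetric] b'[symmetric]
    by (induction k) (simp_all add: pcompose_mult pcompose_1)
  ultimately have b_bn: "coprime b bn" unfolding b' by (auto simp: coprime_mult_left_iff)
  have "bn dvd pcompose c [:0, -1:] ^ k"
    by (simp add: \<open>pcompose c [:0, -1:] ^ k = bn * pcompose b' [:0, -1:]\<close>)
  moreover have "coprime (pcompose c [:0, -1:] ^ k) c"
    using cop by (cases "k = 0") (auto simp: coprime_power_left_iff coprime_commute)
  ultimately have bn_c: "coprime bn c" by (rule coprime_divisors[OF _ dvd_refl])
  have "coprime g (c ^ k)" using gb(2) by (cases "k = 0") (auto simp: coprime_power_right_iff)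
  then have "coprime g b" unfolding b' by (auto simp: coprime_mult_right_iff)
  then obtain u v where uv: "u * g + v * b = 1"
    by (metis bezout_coefficients_fst_snd coprime_iff_gcd_eq_1)
  \<comment> \<open>The Bezout identity yields complementary spectral projections: \<open>E\<close>
    onto the part annihilated by \<open>b\<close>, \<open>E'\<close> onto the part annihilated by
    \<open>g\<close>.\<close>
  define E where "E = peval (u * g) A * e"
  define E' where "E' = peval (v * b) A * e"
  have pe: "peval p A * e = e * peval p A" for p
    by (rule peval_intertwine) (simp add: eA)
  have pA: "peval p A * A = A * peval p A" for p
    by (rule peval_intertwine) simp
  have eE: "e * E = E" "E * e = E"
    unfolding E_def using ee by (simp_all add: pe mult.assoc) (simp_all add: pe flip: mult.assoc)
  have EE': "E + E' = e" unfolding E_def E'_def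
    by (simp add: uv flip: distrib_right peval_add)
  have EA: "E * A = A * E" unfolding E_def by (metis eA mult.assoc pA)
  have bE: "peval b A * E = 0"
  proof -
    have "peval b A * E = peval (b * (u * g)) A * e" unfolding E_def peval_mult by (simp add: mult.assoc)
    also have "b * (u * g) = u * a" using gb(1) by simp
    finally show ?thesis using aA by (simp add: peval_mult mult.assoc)
  qed
  have gE': "peval g A * E' = 0"
  proof -
    have "peval g A * E' = peval (g * (v * b)) A * e" unfolding E'_def peval_mult by (simp add: mult.assoc)
    also have "g * (v * b) = v * a" using gb(1) by simp
    finally show ?thesis using aA by (simp add: peval_mult mult.assoc)
  qed
  have E'E: "E' * E = 0"
  proof -
    have "E' * E = peval v A * (peval b A * E)"
      unfolding E'_def peval_mult using eE by (simp add: mult.assoc)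
    then show ?thesis using bE by simp
  qed
  have EE: "E * E = E" using EE' E'E eE by (metis add.right_neutral distrib_right)
  have trE: "tr E * tr A = tr A * tr E" "tr E * e = tr E" "e * tr E = tr E" "tr E * tr E = tr E"
    using arg_cong[OF EA, of tr] arg_cong[OF eE(1), of tr] arg_cong[OF eE(2), of tr]
      arg_cong[OF EE, of tr] ee by simp_all
  \<comment> \<open>The Lyapunov equation \<open>A * Y + Y * tr A = - (E * S * tr E)\<close> is read
    as a Sylvester equation with right coefficient \<open>- tr A\<close>, for which
    \<open>bn\<close> annihilates the right-hand side.\<close>
  have "peval b A * - (E * S * tr E) = 0" using bE by (simp add: mult.assoc[symmetric])
  moreover have "- (E * S * tr E) * peval bn (- tr A) = 0"
  proof -
    have "tr E * peval bn (- tr A) = tr (peval b A * E)"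
      unfolding bn_def peval_neg by simp
    then show ?thesis using bE by (simp add: mult.assoc)
  qed
  ultimately obtain Y0 where Y0: "A * Y0 - Y0 * - tr A = - (E * S * tr E)"
    and "\<And>F. F * A = A * F \<Longrightarrow> F * - (E * S * tr E) = - (E * S * tr E) \<Longrightarrow> F * Y0 = Y0"
    "\<And>F. F * - tr A = - tr A * F \<Longrightarrow> - (E * S * tr E) * F = - (E * S * tr E) \<Longrightarrow> Y0 * F = Y0"
    using sylvester_solvable[OF _ _ b_bn] by metis
  then have EY0: "E * Y0 = Y0" "Y0 * tr E = Y0"
    using EA EE trE by (simp_all add: mult.assoc, simp add: mult.assoc[symmetric])
  \<comment> \<open>The transpose of a solution is again a solution, so averaging gives a symmetric
    one without an appeal to uniqueness.\<close>
  define Y where "Y = (1/2) *\<^sub>R (Y0 + tr Y0)"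
  have trY: "tr Y = Y" by (simp add: Y_def add.commute)
  have "tr Y0 * tr E = tr Y0" "E * tr Y0 = tr Y0"
    by (metis EY0(1) tr_mult, metis EY0(2) tr_mult tr_simps(6))
  then have EY: "E * Y = Y" "Y * tr E = Y"
    using EY0 by (simp_all add: Y_def distrib_left distrib_right)
  have lyap: "A * Y + Y * tr A + E * S * tr E = 0"
  proof -
    have 1: "A * Y0 + Y0 * tr A = - (E * S * tr E)" using Y0 by simp
    have 2: "A * tr Y0 + tr Y0 * tr A = - (E * S * tr E)"
      using arg_cong[OF 1, of tr] trS by (simp add: mult.assoc add.commute)
    have "A * Y + Y * tr A = (1/2) *\<^sub>R ((A * Y0 + Y0 * tr A) + (A * tr Y0 + tr Y0 * tr A))"
      by (simp add: Y_def algebra_simps)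
    also have "\<dots> = - (E * S * tr E)" unfolding 1 2 by (simp only: scaleR_2[symmetric]) simp
    finally show ?thesis by simp
  qed
  \<comment> \<open>On the kernel of \<open>Y\<close> the Lyapunov equation and the definiteness of
    \<open>Wi\<close> force \<open>tr B * tr E\<close> to vanish, and then the kernel is invariant
    under \<open>tr A\<close>. Controllability excludes this unless
    \<open>tr E * y = 0\<close>.\<close>
  have ker: "tr E * y = 0" if "Y * y = 0" for y
  proof -
    define yk where "yk k = tr A ^ k * y" for k
    have step: "tr B * tr E * z = 0 \<and> Y * (tr A * z) = 0" if z: "Y * z = 0" for z
    proof -
      have zY: "tr z * Y = 0" using arg_cong[OF z, of tr] trY by simp
      have "tr z * (A * Y + Y * tr A + E * S * tr E) * z =
          tr z * A * (Y * z) + tr z * Y * tr A * z + tr z * E * S * tr E * z"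
        by (simp add: algebra_simps)
      then have "tr z * E * S * tr E * z = 0" using lyap z zY by simp
      then have "tr (tr B * tr E * z) * Wi * (tr B * tr E * z) = 0"
        unfolding S_def by (simp add: mult.assoc)
      then have "em * (tr B * tr E * z) = 0" by (rule pos)
      moreover have "em * tr B = tr B" using arg_cong[OF eB(2), of tr] trem by simp
      ultimately have Bz: "tr B * tr E * z = 0" by (simp flip: mult.assoc)
      have "(A * Y + Y * tr A + E * S * tr E) * z = A * (Y * z) + Y * (tr A * z) + E * B * Wi * (tr B * tr E * z)"
        unfolding S_def by (simp add: algebra_simps)
      then have "Y * (tr A * z) = 0" unfolding lyap z Bz by simp
      with Bz show ?thesis by simp
    qed
    have yk: "Y * yk k = 0" for k
      by (induction k) (use that step in \<open>auto simp: yk_def mult.assoc\<close>)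
    have AkE: "A ^ k * E = E * A ^ k" for k
      by (metis EA power_commuting_commutes)
    have "tr y * E * A ^ k * B = 0" for k
    proof -
      have "tr (tr B * tr E * yk k) = 0" using step[OF yk] by simp
      then show ?thesis unfolding yk_def using AkE by (simp add: mult.assoc)
    qed
    then have "tr y * E * e = 0" by (rule ctrl)
    then have "tr y * E = 0" using eE by (simp add: mult.assoc)
    from arg_cong[OF this, of tr] show ?thesis by simp
  qed
  have "e * Y = Y" "Y * e = Y"
    using EY eE trE by (metis mult.assoc)+
  then obtain Z where Z: "Z * Y = tr E"
    using left_quotient_if_kernel[of n Y "tr E"] ker trE unfolding e_def by blast
  \<comment> \<open>Compressed to the spectral part, the left quotient becomes a two-sided inverse
    of \<open>Y\<close> there; it is symmetric because \<open>Y\<close> is.\<close>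
  define \<Delta> where "\<Delta> = tr E * Z * E"
  have dY: "\<Delta> * Y = tr E"
    unfolding \<Delta>_def using EY Z trE by (simp add: mult.assoc)
  have dE: "\<Delta> * E = \<Delta>" "tr E * \<Delta> = \<Delta>"
    unfolding \<Delta>_def using EE trE by (simp add: mult.assoc, simp flip: mult.assoc)
  have Ytd: "Y * tr \<Delta> = E" using arg_cong[OF dY, of tr] trY by simp
  have trd: "tr \<Delta> = \<Delta>"
  proof -
    have "tr E * tr \<Delta> = tr \<Delta>" using arg_cong[OF dE(1), of tr] by simp
    then have "tr \<Delta> = \<Delta> * Y * tr \<Delta>" unfolding dY by simp
    also have "\<dots> = \<Delta>" using Ytd dE by (simp add: mult.assoc)
    finally show ?thesis .
  qed
  have Yd: "Y * \<Delta> = E" using Ytd trd by simp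
  \<comment> \<open>The Lyapunov equation multiplied by \<open>\<Delta>\<close> from both sides is
    the homogeneous Riccati equation.\<close>
  have res: "tr A * \<Delta> + \<Delta> * A + \<Delta> * S * \<Delta> = 0"
  proof -
    have "\<Delta> * (A * Y + Y * tr A + E * S * tr E) * \<Delta> =
        \<Delta> * A * (Y * \<Delta>) + \<Delta> * Y * tr A * \<Delta> + (\<Delta> * E) * S * (tr E * \<Delta>)"
      by (simp add: algebra_simps)
    also have "\<dots> = \<Delta> * E * A + tr A * (tr E * \<Delta>) + \<Delta> * S * \<Delta>"
      unfolding Yd dY using EA trE dE by (metis mult.assoc)
    finally show ?thesis using lyap dE by (simp add: add.commute)
  qed
  define A' where "A' = A + S * \<Delta>"
  have EA': "E * A' = - (Y * tr A * \<Delta>)"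
  proof -
    have "E * A' = E * A + E * S * tr E * \<Delta>" unfolding A'_def using dE by (simp add: distrib_left mult.assoc)
    also have "E * S * tr E = - (A * Y + Y * tr A)"
      by (rule eq_neg_iff_add_eq_0[THEN iffD2]) (use lyap in \<open>simp add: add.commute\<close>)
    also have "E * A + - (A * Y + Y * tr A) * \<Delta> = E * A - A * (Y * \<Delta>) - Y * tr A * \<Delta>"
      by (simp add: algebra_simps)
    finally show ?thesis using Yd EA by simp
  qed
  \<comment> \<open>This is the reflection: on the spectral part the new closed-loop matrix is
    similar to \<open>- tr A\<close>.\<close>
  have "\<Delta> * A' = (- tr A) * \<Delta>"
  proof -
    have "\<Delta> * A' = \<Delta> * A + \<Delta> * S * \<Delta>" unfolding A'_def by (simp add: algebra_simps)
    also have "\<dots> = - (tr A * \<Delta>)"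
      by (rule eq_neg_iff_add_eq_0[THEN iffD2]) (use res in \<open>simp add: algebra_simps\<close>)
    finally show ?thesis by simp
  qed
  then have "peval bn (- tr A) * \<Delta> = \<Delta> * peval bn A'" by (intro peval_intertwine) simp
  moreover have "peval bn (- tr A) * \<Delta> = 0"
  proof -
    have "peval b (tr A) * tr E = tr (peval b A * E)"
      by (simp add: peval_intertwine trE(1)[symmetric])
    then show ?thesis unfolding bn_def peval_neg using bE dE
      by (metis add.inverse_inverse mult.assoc mult_zero_left tr_simps(1))
  qed
  ultimately have db: "\<Delta> * peval bn A' = 0" by simp
  then have Eb: "E * peval bn A' = 0" using Yd by (metis mult.assoc mult_zero_right)
  have eA': "e * A' = A'" "A' * e = A'"
    unfolding A'_def S_def using eA eB trd dE eE arg_cong[OF eB(1), of tr] ee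
    by (simp_all add: distrib_left distrib_right mult.assoc)
      (metis mult.assoc, metis mult.assoc)
  \<comment> \<open>\<open>\<Delta>\<close> vanishes on the complementary part, so the eigenvalues
    belonging to \<open>g\<close> stay in place.\<close>
  have "A' * E' = A * E'"
  proof -
    have "\<Delta> * E' = 0"
      using dE eE EE' E'E by (metis EE add_diff_cancel_left' diff_self mult.assoc right_diff_distrib)
    then show ?thesis unfolding A'_def by (simp add: distrib_right mult.assoc)
  qed
  moreover have "A * E' = E' * A" using EE' EA eA by (metis add_diff_cancel_left' left_diff_distrib right_diff_distrib)
  ultimately have "A' * E' = E' * A" by simp
  then have gA'E': "peval g A' * E' = 0"
    using gE' peval_intertwine[of A' E' A g] peval_intertwine[of A E' A g] \<open>A * E' = E' * A\<close> by simp
  have "peval (g * bn) A' * e = peval g A' * (e * peval bn A')"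
    unfolding peval_mult using peval_intertwine[of A' e A' bn] eA' by (simp add: mult.assoc)
  also have "e * peval bn A' = E' * peval bn A'" unfolding EE'[symmetric] distrib_right using Eb by simp
  also have "peval g A' * (E' * peval bn A') = 0" using gA'E' by (simp flip: mult.assoc)
  finally have "peval (g * bn) (A + S * \<Delta>) * e = 0" unfolding A'_def .
  moreover have "coprime (g * bn) c" using gb(2) bn_c by (simp add: coprime_mult_left_iff)
  moreover have "e * \<Delta> = \<Delta>" using dE trE by (metis mult.assoc)
  ultimately show ?thesis using trd res by blast
qed

text \<open>The supply rate with weights \<open>Q\<close>, \<open>L\<close>, \<open>W\<close> minus the derivative of \<open>x\<^sup>T K x\<close> along
  \<open>x' = A x + B u\<close>.\<close>

definition lmi :: "rcmat \<Rightarrow> rcmat \<Rightarrow> rcmat \<Rightarrow> rcmat \<Rightarrow> rcmat \<Rightarrow> rcmat \<Rightarrow> rcmat \<Rightarrow> rcmat \<Rightarrow> rcmat" where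
  "lmi A B Q L W K x u = tr u * W * u + tr u * L * x + tr x * tr L * u + tr x * Q * x
     - tr x * K * (A * x + B * u) - tr (A * x + B * u) * K * x"

text \<open>For positive \<open>W\<close>, the input \<open>Wi * G * x\<close> minimizes the form
  over \<open>u\<close>, and the minimum is the quadratic form of the Riccati residual.
  \<open>L\<close> carries columns for the whole state; the factor \<open>e\<close> cuts it down to
  the states in question, so that the same identity serves for the controllable part and for the
  full system.\<close>

lemma lmi_complete_square:
  assumes K: "tr K = K" and W: "Wi * W = em" "W * Wi = em" "tr Wi = Wi" "Wi * em = Wi"
    and em: "tr em = em" "em * u = u" and x: "e * x = x" "tr e = e"
    and G: "G = tr B * K - L * e" "em * G = G"
  shows "lmi A B Q L W K x u = tr (u - Wi * G * x) * W * (u - Wi * G * x)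
    + tr x * (Q - K * A - tr A * K - tr G * Wi * G) * x"
proof -
  have Wx: "W * (Wi * z) = em * z" for z using W(2) by (simp flip: mult.assoc)
  have Wx': "Wi * (W * z) = em * z" for z using W(1) by (simp flip: mult.assoc)
  have emx: "em * (G * z) = G * z" for z using G(2) by (simp flip: mult.assoc)
  have Wiem: "Wi * (em * z) = Wi * z" for z using W(4) by (simp flip: mult.assoc)
  have uem: "tr u * (em * z) = tr u * z" for z
    using arg_cong[OF em(2), of tr] em(1) by (simp flip: mult.assoc)
  have Gx: "G * x = tr B * K * x - L * x" unfolding G(1) using x by (simp add: left_diff_distrib mult.assoc)
  have xG: "tr x * (tr G * z) = tr x * (K * (B * z)) - tr x * (tr L * z)" for z
    using arg_cong[OF Gx, of tr] K by (simp add: left_diff_distrib mult.assoc flip: mult.assoc)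
  have "tr (u - Wi * G * x) * W * (u - Wi * G * x) =
      tr u * W * u - tr u * (G * x) - tr x * (tr G * u) + tr x * (tr G * (Wi * (G * x)))"
    using W(3) em(2) by (simp add: algebra_simps Wx Wx' Wiem uem emx)
  then show ?thesis unfolding lmi_def
    by (simp add: algebra_simps Gx xG K)
qed

text \<open>The inequality for \<open>K0\<close> says that its residual is positive semidefinite.
  \<open>K\<close> is assembled so that the residual of the full system is the residual of
  \<open>K0\<close> in the first block and zero elsewhere; completing the square again gives the
  claim.\<close>

lemma lmi_extension:
  fixes n1 n m :: nat
  defines "e1 \<equiv> proj {..<n1}" and "e2 \<equiv> proj {n1..<n}" and "em \<equiv> proj {..<m}"
  assumes A: "e1 * A1 = A1" "A1 * e1 = A1" "e1 * A12 = A12" "A12 * e2 = A12" "e2 * A2 = A2" "A2 * e2 = A2"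
    and B: "e1 * B = B" "B * em = B" and Q: "tr Q = Q" and L: "em * L = L"
    and W: "tr W = W" "em * W = W"
    and posW: "\<And>z. tr z * W * z = 0 \<Longrightarrow> em * z = 0"
    and psdW: "\<And>z. 0 \<le> ent (tr z * W * z) 0 0"
    and K0: "tr K0 = K0" "e1 * K0 = K0"
    and lmi0: "\<And>x u. e1 * x = x \<Longrightarrow> em * u = u \<Longrightarrow> 0 \<le> ent (lmi A1 B Q L W K0 x u) 0 0"
    and ctrl: "\<And>y. (\<And>k. y * A1 ^ k * B = 0) \<Longrightarrow> y * e1 = 0"
    and p: "peval p A2 * e2 = 0" "coprime p (pcompose p [:0, -1:])"
  shows "\<exists>K. tr K = K \<and> (e1 + e2) * K = K \<and>
    (\<forall>x u. (e1 + e2) * x = x \<longrightarrow> em * u = u \<longrightarrow> 0 \<le> ent (lmi (A1 + A12 + A2) B Q L W K x u) 0 0)"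
proof -
  have e: "tr e1 = e1" "tr e2 = e2" "tr em = em" "e1 * e1 = e1" "e2 * e2 = e2" "e1 * e2 = 0" "e2 * e1 = 0"
    "em * em = em"
  proof -
    have "{..<n1} \<inter> {n1..<n} = {}" "{n1..<n} \<inter> {..<n1} = {}" by auto
    then show "tr e1 = e1" "tr e2 = e2" "tr em = em" "e1 * e1 = e1" "e2 * e2 = e2" "e1 * e2 = 0"
      "e2 * e1 = 0" "em * em = em"
      unfolding e1_def e2_def em_def by simp_all
  qed
  have Wem: "W * em = W" using tr_mult_eq[OF W(2)] W e by simp
  have "\<exists>Z. Z * W = em"
    using left_quotient_if_kernel[of m W em] W(2) Wem e posW unfolding em_def
    by (metis mult.assoc mult_zero_right)
  then obtain Z where Z: "Z * W = em" by blast
  define Wi where "Wi = em * Z * em"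
  have WiW: "Wi * W = em" unfolding Wi_def using W Z e by (simp add: mult.assoc)
  have Wiem: "Wi * em = Wi" "em * Wi = Wi" unfolding Wi_def using e by (simp add: mult.assoc, simp flip: mult.assoc)
  have trWi: "tr Wi = Wi"
  proof -
    have "W * tr Wi = em" using tr_mult_eq[OF WiW] W e by simp
    then have "Wi * W * tr Wi = Wi" using Wiem by (simp add: mult.assoc)
    moreover have "em * tr Wi = tr Wi" using tr_mult_eq[OF Wiem(1)] e by simp
    ultimately show ?thesis using WiW by simp
  qed
  have WWi: "W * Wi = em" using tr_mult_eq[OF WiW] W e trWi by simp
  have posWi: "em * z = 0" if "tr z * Wi * z = 0" for z
  proof -
    have "tr (Wi * z) * W * (Wi * z) = tr z * (Wi * W * Wi) * z" by (simp add: trWi mult.assoc)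
    also have "\<dots> = 0" using that Wiem WiW by simp
    finally have "em * (Wi * z) = 0" by (rule posW)
    then have "Wi * z = 0" using Wiem by (simp flip: mult.assoc)
    then have "W * Wi * z = 0" by (simp add: mult.assoc)
    then show ?thesis using WWi by simp
  qed
  have emB: "em * tr B = tr B" using tr_mult_eq[OF B(2)] e by simp
  have Be1: "tr B * e1 = tr B" using tr_mult_eq[OF B(1)] e by simp
  define res where "res K = e1 * Q * e1 - K * A1 - tr A1 * K -
    tr (tr B * K - L * e1) * Wi * (tr B * K - L * e1)" for K
  define G0 where "G0 = tr B * K0 - L * e1"
  \<comment> \<open>The closed loop under the minimizing input for \<open>K0\<close>.\<close>
  define A0 where "A0 = A1 + B * Wi * G0"
  define S where "S = B * Wi * tr B"
  have K0e: "K0 * e1 = K0" using tr_mult_eq[OF K0(2)] K0 e by simp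
  have G0e: "G0 * e1 = G0" "em * G0 = G0"
    unfolding G0_def using K0e e emB L
    by (simp add: left_diff_distrib mult.assoc, simp add: right_diff_distrib flip: mult.assoc)
  have eA0: "e1 * A0 = A0" "A0 * e1 = A0"
    unfolding A0_def using A B G0e by (simp_all add: algebra_simps) (simp flip: mult.assoc)
  have psd: "0 \<le> ent (tr x * res K0 * x) 0 0" for x
  proof -
    define y where "y = e1 * x"
    \<comment> \<open>At this input the square vanishes and only the residual is left.\<close>
    define u where "u = Wi * G0 * y"
    have "tr (u - Wi * G0 * y) * W * (u - Wi * G0 * y) = 0" by (simp add: u_def)
    moreover have "lmi A1 B Q L W K0 y u = tr (u - Wi * G0 * y) * W * (u - Wi * G0 * y)
        + tr y * (Q - K0 * A1 - tr A1 * K0 - tr G0 * Wi * G0) * y"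
      by (rule lmi_complete_square[where em = em and e = e1])
        (use K0 WiW WWi trWi Wiem e G0e in \<open>simp_all add: u_def y_def G0_def flip: mult.assoc\<close>)
    ultimately have "0 \<le> ent (tr y * (Q - K0 * A1 - tr A1 * K0 - tr G0 * Wi * G0) * y) 0 0"
      using lmi0[of y u] e Wiem by (simp add: y_def u_def flip: mult.assoc)
    also have "tr y * (Q - K0 * A1 - tr A1 * K0 - tr G0 * Wi * G0) * y = tr x * res K0 * x"
    proof -
      have "tr y * (Q - K0 * A1 - tr A1 * K0 - tr G0 * Wi * G0) * y =
        tr x * (e1 * Q * e1 - (e1 * K0) * (A1 * e1) - tr (A1 * e1) * (K0 * e1) - tr (G0 * e1) * Wi * (G0 * e1)) * x"
        unfolding y_def by (simp add: algebra_simps e)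
      then show ?thesis unfolding res_def G0_def[symmetric] using A K0 K0e G0e by simp
    qed
    finally show ?thesis .
  qed
  \<comment> \<open>State feedback preserves controllability: a left vector that annihilates all
    \<open>A0 ^ k * B\<close> does not see the feedback term.\<close>
  have ctrl0: "y * e1 = 0" if y: "\<And>k. y * A0 ^ k * B = 0" for y
  proof (rule ctrl)
    have "y * A0 ^ k = y * A1 ^ k" for k
    proof (induction k)
      case (Suc k)
      have "y * A0 ^ Suc k = y * A0 ^ k * A1 + y * A0 ^ k * B * Wi * G0"
        unfolding A0_def power_Suc2 by (simp add: algebra_simps)
      also have "y * A0 ^ k * B * Wi * G0 = 0" using y[of k] by simp
      finally show ?case using Suc by (simp add: power_Suc2 mult.assoc del: power_Suc)
    qed simp
    then show "y * A1 ^ k * B = 0" for k using y by metis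
  qed
  obtain a where a: "a \<noteq> 0" "peval a A0 * e1 = 0"
    using annihilating_poly_exists[of "{..<n1}" A0] eA0 unfolding e1_def by auto
  \<comment> \<open>The eigenvalues of \<open>A2\<close> are roots of \<open>p\<close>, so
    \<open>a'\<close> coprime to \<open>c\<close> will exclude a closed-loop eigenvalue that is the
    negative of one of \<open>A2\<close>.\<close>
  define c where "c = pcompose p [:0, -1:]"
  have pc: "pcompose c [:0, -1:] = p"
    unfolding c_def pcompose_assoc[symmetric] by (simp add: pcompose_pCons)
  have "coprime c (pcompose c [:0, -1:])" unfolding pc using p(2) by (simp add: c_def coprime_commute)
  then obtain \<Delta> a' where \<Delta>: "tr \<Delta> = \<Delta>" "e1 * \<Delta> = \<Delta>" "tr A0 * \<Delta> + \<Delta> * A0 + \<Delta> * S * \<Delta> = 0"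
    "coprime a' c" "peval a' (A0 + S * \<Delta>) * e1 = 0"
    using riccati_flip[of n1 A0 B em Wi a c] eA0 B e trWi posWi ctrl0 a
    unfolding e1_def S_def by metis
  define K1 where "K1 = K0 + \<Delta>"
  define G1 where "G1 = tr B * K1 - L * e1"
  define Ac where "Ac = A1 + B * Wi * G1"
  have \<Delta>e: "\<Delta> * e1 = \<Delta>" using tr_mult_eq[OF \<Delta>(2)] \<Delta> e by simp
  have K1: "tr K1 = K1" "e1 * K1 = K1" "K1 * e1 = K1"
    unfolding K1_def using K0 K0e \<Delta> \<Delta>e by (simp_all add: algebra_simps)
  have G1: "G1 = G0 + tr B * \<Delta>" unfolding G1_def G0_def K1_def by (simp add: algebra_simps)
  have G1e: "G1 * e1 = G1" "em * G1 = G1"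
    unfolding G1 using G0e \<Delta>e emB by (simp_all add: algebra_simps) (simp flip: mult.assoc)
  have Ac: "Ac = A0 + S * \<Delta>" unfolding Ac_def A0_def S_def G1 by (simp add: algebra_simps)
  have eAc: "e1 * Ac = Ac" "Ac * e1 = Ac"
    unfolding Ac_def using A B G1e by (simp_all add: algebra_simps) (simp flip: mult.assoc)
  \<comment> \<open>Adding \<open>\<Delta>\<close> to \<open>K0\<close> changes the residual by
    precisely the Riccati expression that \<open>riccati_flip\<close> makes zero.\<close>
  have res1: "res K1 = res K0"
  proof -
    have "res K1 = res K0 - (tr A0 * \<Delta> + \<Delta> * A0 + \<Delta> * S * \<Delta>)"
      unfolding res_def G1_def[symmetric] G0_def[symmetric] unfolding G1 A0_def S_def K1_def
      by (simp add: algebra_simps trWi \<Delta>)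
    then show ?thesis using \<Delta> by simp
  qed
  \<comment> \<open>The terms of the off-diagonal residual block that are free of
    \<open>K12\<close>. Those with \<open>K12\<close> combine to
    \<open>tr Ac * K12 + K12 * A2\<close>, since \<open>G2\<close> contains
    \<open>tr B * K12\<close> and feeds it back through \<open>Ac\<close>.\<close>
  define C12 where "C12 = e1 * Q * e2 - K1 * A12 + tr G1 * Wi * L * e2"
  have C12e: "e1 * C12 = C12" "C12 * e2 = C12"
    using K1 A e tr_mult_eq[OF G1e(1)] unfolding C12_def
    by (simp_all add: algebra_simps) (simp flip: mult.assoc)
  have e2A2: "peval p A2 * e2 = e2 * peval p A2" by (rule peval_intertwine) (simp add: A)
  have C12a: "peval a' (tr Ac) * C12 = 0" and C12c: "C12 * peval c (- A2) = 0"
  proof -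
    have "e1 * peval a' (tr Ac) = 0"
      using arg_cong[OF \<Delta>(5), of tr] e by (simp flip: Ac)
    moreover have "e1 * peval a' (tr Ac) = peval a' (tr Ac) * e1"
      by (rule peval_intertwine[symmetric]) (use tr_mult_eq[OF eAc(1)] tr_mult_eq[OF eAc(2)] e in simp)
    ultimately show "peval a' (tr Ac) * C12 = 0" using C12e by (metis mult.assoc mult_zero_left)
    show "C12 * peval c (- A2) = 0"
      unfolding c_def peval_neg using C12e(2) p(1) e2A2 by (metis add.inverse_inverse mult.assoc mult_zero_right)
  qed
  obtain K12 where K12: "tr Ac * K12 - K12 * (- A2) = C12"
    and K12c: "\<And>E. E * tr Ac = tr Ac * E \<Longrightarrow> E * C12 = C12 \<Longrightarrow> E * K12 = K12"
    "\<And>E. E * (- A2) = (- A2) * E \<Longrightarrow> C12 * E = C12 \<Longrightarrow> K12 * E = K12"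
    using sylvester_solvable[OF C12a C12c \<Delta>(4)] by metis
  have K12e: "e1 * K12 = K12" "K12 * e2 = K12"
    using K12c(1)[of e1] K12c(2)[of e2] C12e A tr_mult_eq[OF eAc(1)] tr_mult_eq[OF eAc(2)] e by simp_all
  define G2 where "G2 = tr B * K12 - L * e2"
  have G2e: "G2 * e2 = G2" "em * G2 = G2"
    unfolding G2_def using K12e e emB L
    by (simp add: left_diff_distrib mult.assoc, simp add: right_diff_distrib flip: mult.assoc)
  \<comment> \<open>The inputs do not act on the second block of states, so the quadratic term
    involves \<open>K12\<close> but not the lower diagonal block of \<open>K\<close>: the last
    equation is linear too. Coprimality of \<open>p\<close> with its reflection makes it
    solvable.\<close>
  define C22 where "C22 = e2 * Q * e2 - tr K12 * A12 - tr A12 * K12 - tr G2 * Wi * G2"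
  have trs: "e2 * tr K12 = tr K12" "e2 * tr A12 = tr A12" "e2 * tr G2 = tr G2" "tr A12 * e1 = tr A12"
    "tr K12 * e1 = tr K12" "e1 * tr A1 = tr A1" "tr A1 * e1 = tr A1" "e2 * tr A2 = tr A2" "tr A2 * e2 = tr A2"
    using tr_mult_eq[OF K12e(2)] tr_mult_eq[OF A(4)] tr_mult_eq[OF G2e(1)]
      tr_mult_eq[OF A(3)] tr_mult_eq[OF K12e(1)] tr_mult_eq[OF A(1)] tr_mult_eq[OF A(2)]
      tr_mult_eq[OF A(5)] tr_mult_eq[OF A(6)] e by simp_all
  have C22e: "e2 * C22 = C22" "C22 * e2 = C22"
    using trs A K12e G2e e unfolding C22_def
    by (simp_all add: algebra_simps) (simp flip: mult.assoc)
  have trC22: "tr C22 = C22" unfolding C22_def using Q e trWi by (simp add: algebra_simps)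
  have e2A2': "e2 * peval p (tr A2) = peval p (tr A2) * e2"
    using tr_mult_eq[OF e2A2] e by simp
  have C22p: "peval p (tr A2) * C22 = 0" and C22c: "C22 * peval c (- A2) = 0"
  proof -
    have "e2 * peval p (tr A2) = 0" using tr_mult_eq[OF p(1)] e by simp
    then show "peval p (tr A2) * C22 = 0" using C22e e2A2' by (metis mult.assoc mult_zero_left)
    show "C22 * peval c (- A2) = 0"
      unfolding c_def peval_neg using C22e(2) p(1) e2A2 by (metis add.inverse_inverse mult.assoc mult_zero_right)
  qed
  obtain K20 where K20: "tr A2 * K20 - K20 * (- A2) = C22"
    and K20c: "\<And>E. E * tr A2 = tr A2 * E \<Longrightarrow> E * C22 = C22 \<Longrightarrow> E * K20 = K20"
    "\<And>E. E * (- A2) = (- A2) * E \<Longrightarrow> C22 * E = C22 \<Longrightarrow> K20 * E = K20"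
    using sylvester_solvable[OF C22p C22c p(2)[folded c_def]] by metis
  have K20e: "e2 * K20 = K20" "K20 * e2 = K20"
    using K20c(1)[of e2] K20c(2)[of e2] C22e A trs by simp_all
  define K2 where "K2 = (1/2) *\<^sub>R (K20 + tr K20)"
  have trK2: "tr K2 = K2" by (simp add: K2_def add.commute)
  have "tr K20 * e2 = tr K20" "e2 * tr K20 = tr K20"
    using tr_mult_eq[OF K20e(1)] tr_mult_eq[OF K20e(2)] e by simp_all
  then have K2e: "e2 * K2 = K2" "K2 * e2 = K2"
    unfolding K2_def using K20e by (simp_all add: distrib_left distrib_right)
  have K2: "tr A2 * K2 + K2 * A2 = C22"
  proof -
    have 1: "tr A2 * K20 + K20 * A2 = C22" using K20 by simp
    have 2: "tr A2 * tr K20 + tr K20 * A2 = C22" using arg_cong[OF 1, of tr] trC22 by (simp add: add.commute)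
    have "tr A2 * K2 + K2 * A2 = (1/2) *\<^sub>R ((tr A2 * K20 + K20 * A2) + (tr A2 * tr K20 + tr K20 * A2))"
      by (simp add: K2_def algebra_simps)
    also have "\<dots> = C22" unfolding 1 2 by (simp only: scaleR_2[symmetric]) simp
    finally show ?thesis .
  qed
  define e where "e = e1 + e2"
  define AA where "AA = A1 + A12 + A2"
  define K where "K = K1 + K12 + tr K12 + K2"
  define G where "G = tr B * K - L * e"
  have te: "tr e = e" unfolding e_def by (simp add: \<open>tr e1 = e1\<close> \<open>tr e2 = e2\<close>)
  have trK: "tr K = K" unfolding K_def by (simp add: K1 trK2 add.commute add.left_commute)
  have zero: "a * b = 0" if "a * f = a" "g * b = b" "f * g = 0" for a b f g :: rcmat
    using that by (metis mult.assoc mult_zero_left mult_zero_right)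
  note z12 = zero[OF _ _ \<open>e1 * e2 = 0\<close>] and z21 = zero[OF _ _ \<open>e2 * e1 = 0\<close>]
  have eK: "e * K = K" unfolding e_def K_def
    using K1 K12e K2e trs z12[OF \<open>e1 * e1 = e1\<close> trs(1)] z12[OF \<open>e1 * e1 = e1\<close> K2e(1)]
      z21[OF \<open>e2 * e2 = e2\<close> K1(2)] z21[OF \<open>e2 * e2 = e2\<close> K12e(1)]
    by (simp add: algebra_simps)
  have KA: "K * AA = K1 * A1 + K1 * A12 + K12 * A2 + tr K12 * A1 + tr K12 * A12 + K2 * A2"
    unfolding K_def AA_def
    using z12[OF K1(3) A(5)] z21[OF K12e(2) A(1)] z21[OF K12e(2) A(3)] z12[OF trs(5) A(5)]
      z21[OF K2e(2) A(1)] z21[OF K2e(2) A(3)]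
    by (simp add: algebra_simps)
  have AK: "tr AA * K = tr A1 * K1 + tr A12 * K1 + tr A2 * tr K12 + tr A1 * K12 + tr A12 * K12 + tr A2 * K2"
    using arg_cong[OF KA, of tr] trK K1 trK2 by simp
  have G12: "G = G1 + G2"
    unfolding G_def G1_def G2_def K_def e_def using z12[OF Be1 trs(1)] z12[OF Be1 K2e(1)]
    by (simp add: algebra_simps)
  have emG: "em * G = G" unfolding G12 using G1e G2e by (simp add: distrib_left)
  have E12: "e1 * Q * e2 - K1 * A12 - K12 * A2 - tr A1 * K12 - tr G1 * Wi * G2 = 0"
  proof -
    have "tr Ac * K12 + K12 * A2 = C12" using K12 by simp
    then show ?thesis unfolding C12_def Ac_def G2_def by (simp add: algebra_simps trWi)
  qed
  have E21: "e2 * Q * e1 - tr A12 * K1 - tr A2 * tr K12 - tr K12 * A1 - tr G2 * Wi * G1 = 0"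
    using arg_cong[OF E12, of tr] by (simp add: Q K1 trWi \<open>tr e1 = e1\<close> \<open>tr e2 = e2\<close> mult.assoc)
  have "e * Q * e - K * AA - tr AA * K - tr G * Wi * G =
      res K1 + (e1 * Q * e2 - K1 * A12 - K12 * A2 - tr A1 * K12 - tr G1 * Wi * G2)
      + (e2 * Q * e1 - tr A12 * K1 - tr A2 * tr K12 - tr K12 * A1 - tr G2 * Wi * G1)
      + (C22 - (tr A2 * K2 + K2 * A2))"
    unfolding KA AK G12 res_def G1_def[symmetric] C22_def e_def by (simp add: algebra_simps)
  then have total: "e * Q * e - K * AA - tr AA * K - tr G * Wi * G = res K0"
    unfolding E12 E21 K2 res1 by simp
  have "0 \<le> ent (lmi AA B Q L W K x u) 0 0" if x: "e * x = x" and u: "em * u = u" for x u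
  proof -
    have "lmi AA B Q L W K x u = tr (u - Wi * G * x) * W * (u - Wi * G * x)
        + tr x * (Q - K * AA - tr AA * K - tr G * Wi * G) * x"
      by (rule lmi_complete_square[where em = em and e = e])
        (use trK WiW WWi trWi Wiem \<open>tr em = em\<close> u x te emG in \<open>simp_all add: G_def\<close>)
    also have "tr x * (Q - K * AA - tr AA * K - tr G * Wi * G) * x =
        tr x * (e * Q * e - K * AA - tr AA * K - tr G * Wi * G) * x"
    proof -
      have "tr x * (e * Q * e) * x = tr (e * x) * Q * (e * x)" by (simp add: mult.assoc te)
      then show ?thesis unfolding x by (simp add: algebra_simps)
    qed
    finally have eq: "lmi AA B Q L W K x u = tr (u - Wi * G * x) * W * (u - Wi * G * x)
        + tr x * res K0 * x" unfolding total .
    show ?thesis unfolding eq ent_simps(2) by (intro add_nonneg_nonneg psdW psd)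
  qed
  then show ?thesis using trK eK unfolding e_def AA_def by blast
qed

section \<open>Differential operators on smooth functions\<close>

lemma smooth_has_derivative:
  assumes "smooth f"
  shows "((deriv ^^ k) f has_real_derivative (deriv ^^ Suc k) f t) (at t)"
  using assms unfolding smooth_def
  by (simp add: DERIV_deriv_iff_real_differentiable differentiable_on_def)

text \<open>A whole sequence of candidate derivatives identifies all iterates of
  \<open>deriv\<close> at once; smoothness is proved below by exhibiting such a sequence.\<close>

lemma smooth_derivative_sequence:
  fixes g :: "nat \<Rightarrow> real \<Rightarrow> real"
  assumes "\<And>k t. (g k has_real_derivative g (Suc k) t) (at t)"
  shows "smooth (g 0)" and "(deriv ^^ k) (g 0) = g k"
proof -
  show eq: "(deriv ^^ k) (g 0) = g k" for k
  proof (induction k)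
    case (Suc k)
    moreover have "deriv (g k) = g (Suc k)"
      by (rule ext, rule DERIV_imp_deriv[OF assms])
    ultimately show ?case by simp
  qed simp
  show "smooth (g 0)"
    unfolding smooth_def eq using assms
    by (metis differentiable_at_withinI differentiable_on_def real_differentiable_def)
qed

lemma smooth_deriv: "smooth f \<Longrightarrow> smooth (deriv f)"
  unfolding smooth_def by (metis comp_apply funpow_Suc_right)

lemma smooth_sum: "smooth (\<lambda>t. \<Sum>x\<in>X. c x * f x t)"
  and derivs_sum: "(deriv ^^ k) (\<lambda>t. \<Sum>x\<in>X. c x * f x t) = (\<lambda>t. \<Sum>x\<in>X. c x * (deriv ^^ k) (f x) t)"
  if "\<And>x. x \<in> X \<Longrightarrow> smooth (f x)" for c :: "'x \<Rightarrow> real"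
proof -
  define g where "g k t = (\<Sum>x\<in>X. c x * (deriv ^^ k) (f x) t)" for k t
  have "(g k has_real_derivative g (Suc k) t) (at t)" for k t
    unfolding g_def
    by (intro DERIV_sum DERIV_cmult smooth_has_derivative that)
  from smooth_derivative_sequence[of g, OF this]
  show "smooth (\<lambda>t. \<Sum>x\<in>X. c x * f x t)"
    "(deriv ^^ k) (\<lambda>t. \<Sum>x\<in>X. c x * f x t) = (\<lambda>t. \<Sum>x\<in>X. c x * (deriv ^^ k) (f x) t)"
    unfolding g_def by simp_all
qed

lemma smooth_zero [simp]: "smooth (\<lambda>_. 0)"
  using smooth_derivative_sequence(1)[of "\<lambda>_ _. 0"] by simp

lemma smooth_sum': "(\<And>x. x \<in> X \<Longrightarrow> smooth (f x)) \<Longrightarrow> smooth (\<lambda>t. \<Sum>x\<in>X. f x t)"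
  using smooth_sum[of X f "\<lambda>_. 1"] by simp

lemma derivs_zero [simp]: "(deriv ^^ k) (\<lambda>_. 0) = (\<lambda>_. 0 :: real)"
  by (rule smooth_derivative_sequence(2)[of "\<lambda>_ _. 0"]) simp

lemma diff_op_altdef:
  assumes "degree p \<le> N"
  shows "diff_op p f t = (\<Sum>k\<le>N. coeff p k * (deriv ^^ k) f t)"
  unfolding diff_op_def
  by (rule sum.mono_neutral_left) (use assms in \<open>auto simp: coeff_eq_0\<close>)

lemma diff_op_0 [simp]: "diff_op 0 f t = 0"
  by (simp add: diff_op_def)

lemma diff_op_zero_fun [simp]: "diff_op p (\<lambda>_. 0) t = 0"
  by (simp add: diff_op_def)

lemma diff_op_pCons: "diff_op (pCons c p) f t = c * f t + diff_op p (deriv f) t"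
proof -
  have "diff_op (pCons c p) f t = (\<Sum>k\<le>Suc (degree p). coeff (pCons c p) k * (deriv ^^ k) f t)"
    by (rule diff_op_altdef) (simp add: degree_pCons_le)
  also have "\<dots> = c * f t + diff_op p (deriv f) t"
    unfolding sum.atMost_Suc_shift by (simp add: diff_op_def funpow_Suc_right del: funpow.simps)
  finally show ?thesis .
qed

lemma diff_op_const [simp]: "diff_op [:c:] f t = c * f t"
  by (simp add: diff_op_pCons)

lemma diff_op_1 [simp]: "diff_op 1 f t = f t"
  unfolding one_pCons by (simp add: diff_op_pCons)

lemma diff_op_add: "diff_op (p + q) f t = diff_op p f t + diff_op q f t"
  by (induction p q arbitrary: f rule: poly_induct2) (auto simp: diff_op_pCons algebra_simps)

lemma diff_op_smult: "diff_op (Polynomial.smult c p) f t = c * diff_op p f t"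
  by (induction p arbitrary: f) (auto simp: diff_op_pCons algebra_simps)

lemma diff_op_minus: "diff_op (- p) f t = - diff_op p f t"
  using diff_op_smult[of "-1" p] by simp

lemma diff_op_diff: "diff_op (p - q) f t = diff_op p f t - diff_op q f t"
  using diff_op_add[of p "- q" f t] by (simp add: diff_op_minus)

lemma diff_op_sum_poly: "diff_op (\<Sum>x\<in>X. p x) f t = (\<Sum>x\<in>X. diff_op (p x) f t)"
  by (induction X rule: infinite_finite_induct) (auto simp: diff_op_add)

lemma diff_op_monom: "diff_op (monom c k) f t = c * (deriv ^^ k) f t"
  by (induction k arbitrary: f)
    (auto simp: monom_0 monom_Suc diff_op_pCons funpow_Suc_right simp del: funpow.simps)

lemma diff_op_sum_fun:
  assumes "\<And>x. x \<in> X \<Longrightarrow> smooth (f x)"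
  shows "diff_op p (\<lambda>t. \<Sum>x\<in>X. c x * f x t) t = (\<Sum>x\<in>X. c x * diff_op p (f x) t)"
  unfolding diff_op_def
  by (simp add: derivs_sum[OF assms] sum_distrib_left sum.swap[of _ X] algebra_simps)

lemma diff_op_sum_fun':
  assumes "\<And>x. x \<in> X \<Longrightarrow> smooth (f x)"
  shows "diff_op p (\<lambda>t. \<Sum>x\<in>X. f x t) t = (\<Sum>x\<in>X. diff_op p (f x) t)"
  using diff_op_sum_fun[where X = X and c = "\<lambda>_. 1", OF assms] by simp

lemma smooth_diff_op: "smooth f \<Longrightarrow> smooth (diff_op p f)"
  and deriv_diff_op: "smooth f \<Longrightarrow> deriv (diff_op p f) = diff_op p (deriv f)"
proof -
  assume f: "smooth f"
  define g where "g k = diff_op p ((deriv ^^ k) f)" for k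
  have "(g k has_real_derivative g (Suc k) t) (at t)" for k t
  proof -
    have "((deriv ^^ j) ((deriv ^^ k) f) has_real_derivative (deriv ^^ j) ((deriv ^^ Suc k) f) t) (at t)" for j
      using smooth_has_derivative[OF f, of "j + k" t]
      by (metis add_Suc_right comp_apply funpow_add add_Suc)
    then show ?thesis unfolding g_def diff_op_def by (intro DERIV_sum DERIV_cmult)
  qed
  from smooth_derivative_sequence(1)[of g, OF this] smooth_derivative_sequence(2)[of g 1, OF this]
  show "smooth (diff_op p f)" "deriv (diff_op p f) = diff_op p (deriv f)"
    unfolding g_def by simp_all
qed

lemma diff_op_mult:
  assumes "smooth f"
  shows "diff_op (p * q) f t = diff_op p (diff_op q f) t"
  using assms
proof (induction p arbitrary: f)
  case (pCons c p)
  have "diff_op (pCons c p * q) f t = c * diff_op q f t + diff_op (p * q) (deriv f) t"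
    by (simp add: diff_op_add diff_op_smult diff_op_pCons)
  also have "\<dots> = c * diff_op q f t + diff_op p (deriv (diff_op q f)) t"
    using pCons.IH[OF smooth_deriv[OF pCons.prems]] by (simp add: deriv_diff_op[OF pCons.prems])
  finally show ?case by (simp add: diff_op_pCons)
qed simp

definition xi :: "real poly" where "xi = [:0, 1:]"

lemma diff_op_xi: "diff_op xi f t = deriv f t"
  by (simp add: xi_def diff_op_pCons)

lemma xi_mult: "xi * p = pCons 0 p"
  by (simp add: xi_def)

lemma deriv_diff_op_eq:
  assumes "smooth f"
  shows "deriv (diff_op p f) t = diff_op (xi * p) f t"
  using diff_op_mult[OF assms] by (simp add: diff_op_xi)

lemma smooth_poly: "smooth (poly p)" and derivs_poly: "(deriv ^^ k) (poly p) = poly ((pderiv ^^ k) p)" for p :: "real poly"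
proof -
  have "(poly ((pderiv ^^ k) p) has_real_derivative poly ((pderiv ^^ Suc k) p) t) (at t)" for k t
    by (simp add: poly_DERIV)
  from smooth_derivative_sequence[of "\<lambda>k. poly ((pderiv ^^ k) p)", OF this]
  show "smooth (poly p)" "(deriv ^^ k) (poly p) = poly ((pderiv ^^ k) p)" by simp_all
qed

lemma coeff_pderiv_funpow: "poly ((pderiv ^^ k) p) 0 = fact k * coeff p k" for p :: "real poly"
proof (induction k arbitrary: p)
  case (Suc k)
  then show ?case by (simp add: funpow_Suc_right coeff_pderiv algebra_simps del: funpow.simps)
qed (simp add: poly_0_coeff_0)

lemma prescribed_jets: "\<exists>f. smooth f \<and> (\<forall>k\<le>N. (deriv ^^ k) f 0 = x k)"
proof (intro exI conjI allI impI)
  let ?p = "\<Sum>k\<le>N. monom (x k / fact k) k"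
  show "smooth (poly ?p)" by (rule smooth_poly)
  fix k assume "k \<le> N"
  then show "(deriv ^^ k) (poly ?p) 0 = x k"
    by (simp only: derivs_poly coeff_pderiv_funpow coeff_sum coeff_monom) simp
qed

lemma diff_op_eq_zero_imp:
  assumes "\<And>f t. smooth f \<Longrightarrow> diff_op p f t = 0"
  shows "p = 0"
proof (rule poly_eqI)
  fix d
  obtain f where f: "smooth f" "\<And>k. k \<le> max d (degree p) \<Longrightarrow> (deriv ^^ k) f 0 = (if k = d then 1 else 0)"
    using prescribed_jets[of "max d (degree p)" "\<lambda>k. if k = d then 1 else 0"] by metis
  have "diff_op p f 0 = (\<Sum>k\<le>max d (degree p). if k = d then coeff p k else 0)"
    unfolding diff_op_altdef[of p "max d (degree p)", OF max.cobounded2]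
    by (rule sum.cong) (use f(2) in auto)
  also have "\<dots> = coeff p d" by simp
  finally show "coeff p d = coeff 0 d" using assms[OF f(1)] by simp
qed

text \<open>Real trajectories that probe a complex frequency: \<open>p(d/dt)\<close> acts on the
  exponential as multiplication by \<open>p(l)\<close>. Keeping the amplitude \<open>c\<close>
  inside \<open>Re\<close> leaves the phase free.\<close>

lemma smooth_Re_exp: "smooth (\<lambda>t. Re (c * exp (l * of_real t)))"
  and diff_op_Re_exp: "diff_op p (\<lambda>t. Re (c * exp (l * of_real t))) t
    = Re (poly (map_poly of_real p) l * c * exp (l * of_real t))"
proof -
  define g where "g k t = Re (l ^ k * c * exp (l * of_real t))" for k and t :: real
  have "(g k has_real_derivative g (Suc k) t) (at t)" for k t
  proof -
    have "((\<lambda>t. l ^ k * c * exp (l * of_real t)) has_vector_derivative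
        (l ^ Suc k * c * exp (l * of_real t))) (at t)"
      by (auto intro!: derivative_eq_intros has_vector_derivative_real_field simp: algebra_simps)
    from has_derivative_Re[OF this[unfolded has_vector_derivative_def]]
    show ?thesis unfolding g_def has_field_derivative_def
      by (rule has_derivative_eq_rhs) (auto simp: fun_eq_iff mult.commute)
  qed
  note * = smooth_derivative_sequence[of g, OF this]
  from *(1) show "smooth (\<lambda>t. Re (c * exp (l * of_real t)))" unfolding g_def by simp
  have "diff_op p (g 0) t = Re (\<Sum>k\<le>degree p. of_real (coeff p k) * (l ^ k * c * exp (l * of_real t)))"
    unfolding diff_op_def *(2) by (simp add: g_def)
  also have "\<dots> = Re (poly (map_poly of_real p) l * c * exp (l * of_real t))"
    by (simp add: poly_altdef coeff_map_poly sum_distrib_right mult.assoc degree_map_poly)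
  finally show "diff_op p (\<lambda>t. Re (c * exp (l * of_real t))) t
    = Re (poly (map_poly of_real p) l * c * exp (l * of_real t))" unfolding g_def by simp
qed

section \<open>Rows of differential operators\<close>

definition rowop :: "nat \<Rightarrow> (nat \<Rightarrow> real poly) \<Rightarrow> (nat \<Rightarrow> real \<Rightarrow> real) \<Rightarrow> real \<Rightarrow> real" where
  "rowop N r f t = (\<Sum>j<N. diff_op (r j) (f j) t)"

lemma rowop_add: "rowop N (\<lambda>j. r j + s j) f t = rowop N r f t + rowop N s f t"
  by (simp add: rowop_def diff_op_add sum.distrib)

lemma rowop_diff: "rowop N (\<lambda>j. r j - s j) f t = rowop N r f t - rowop N s f t"
  by (simp add: rowop_def diff_op_diff sum_subtractf)

lemma rowop_smult: "rowop N (\<lambda>j. Polynomial.smult c (r j)) f t = c * rowop N r f t"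
  by (simp add: rowop_def diff_op_smult sum_distrib_left)

lemma rowop_sum: "rowop N (\<lambda>j. \<Sum>x\<in>X. r x j) f t = (\<Sum>x\<in>X. rowop N (r x) f t)"
  unfolding rowop_def by (simp add: diff_op_sum_poly sum.swap[of _ X])

lemma rowop_zero [simp]: "rowop N (\<lambda>_. 0) f t = 0"
  by (simp add: rowop_def)

lemma rowop_unit: "j0 < N \<Longrightarrow> rowop N (\<lambda>j. if j = j0 then p else 0) f t = diff_op p (f j0) t"
  unfolding rowop_def
  by (subst sum.cong[OF refl, of _ _ "\<lambda>j. if j = j0 then diff_op p (f j) t else 0"]) auto

lemma rowop_mult:
  assumes "\<And>j. j < N \<Longrightarrow> smooth (f j)"
  shows "rowop N (\<lambda>j. p * r j) f t = diff_op p (rowop N r f) t"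
proof -
  have "diff_op p (\<lambda>t. \<Sum>j<N. diff_op (r j) (f j) t) t = (\<Sum>j<N. diff_op p (diff_op (r j) (f j)) t)"
    by (rule diff_op_sum_fun') (use assms smooth_diff_op in auto)
  then show ?thesis using assms unfolding rowop_def by (simp add: diff_op_mult)
qed

lemma smooth_rowop: "(\<And>j. j < N \<Longrightarrow> smooth (f j)) \<Longrightarrow> smooth (rowop N r f)"
  unfolding rowop_def by (rule smooth_sum') (auto intro: smooth_diff_op)

lemma deriv_rowop:
  assumes "\<And>j. j < N \<Longrightarrow> smooth (f j)"
  shows "deriv (rowop N r f) t = rowop N (\<lambda>j. xi * r j) f t"
  using rowop_mult[where p = xi and r = r and t = t, OF assms] by (simp add: diff_op_xi)

lemma rowop_cong: "(\<And>j. j < N \<Longrightarrow> r j = s j) \<Longrightarrow> (\<And>j. j < N \<Longrightarrow> f j = g j) \<Longrightarrow> rowop N r f t = rowop N s g t"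
  unfolding rowop_def by (rule sum.cong) auto

lemma rowop_rowop:
  assumes "\<And>j. j < m \<Longrightarrow> smooth (l j)"
  shows "rowop N r (\<lambda>i. rowop m (M i) l) t = rowop m (\<lambda>i. \<Sum>j<N. r j * M j i) l t"
proof -
  have "rowop m (\<lambda>i. \<Sum>j<N. r j * M j i) l t = (\<Sum>j<N. rowop m (\<lambda>i. r j * M j i) l t)"
    by (rule rowop_sum)
  also have "\<dots> = (\<Sum>j<N. diff_op (r j) (rowop m (M j) l) t)"
    by (rule sum.cong[OF refl], rule rowop_mult) (use assms in auto)
  finally show ?thesis by (simp add: rowop_def[of N])
qed

lemma rowop_eq_zero_imp:
  assumes "\<And>l t. (\<And>j. j < m \<Longrightarrow> smooth (l j)) \<Longrightarrow> rowop m r l t = 0" and i: "i < m"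
  shows "r i = 0"
proof (rule diff_op_eq_zero_imp)
  fix f t assume f: "smooth f"
  define l where "l j = (if j = i then f else (\<lambda>_. 0))" for j
  have "rowop m r l t = 0" by (rule assms(1)) (use f in \<open>auto simp: l_def\<close>)
  moreover have "rowop m r l t = (\<Sum>j<m. if j = i then diff_op (r j) f t else 0)"
    unfolding rowop_def l_def by (rule sum.cong) auto
  ultimately show "diff_op (r i) f t = 0" using i by simp
qed

section \<open>State maps\<close>

lemma smult_sum_right: "Polynomial.smult c (\<Sum>x\<in>X. f x) = (\<Sum>x\<in>X. Polynomial.smult c (f x))"
  by (induction X rule: infinite_finite_induct) (auto simp: smult_add_right)

section \<open>Real subspaces of polynomial rows and bases of their quotients\<close>

definition lincomb_rows :: "(nat \<Rightarrow> real) \<Rightarrow> (nat \<Rightarrow> nat \<Rightarrow> real poly) \<Rightarrow> nat \<Rightarrow> nat \<Rightarrow> real poly" where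
  "lincomb_rows c b n j = (\<Sum>i<n. Polynomial.smult (c i) (b i j))"

definition row_subspace :: "(nat \<Rightarrow> real poly) set \<Rightarrow> bool" where
  "row_subspace V \<longleftrightarrow> (\<lambda>_. 0) \<in> V \<and>
    (\<forall>x\<in>V. \<forall>y\<in>V. \<forall>c. (\<lambda>j. x j + Polynomial.smult c (y j)) \<in> V)"

lemma row_subspaceD:
  assumes "row_subspace V"
  shows "(\<lambda>_. 0) \<in> V"
    and "x \<in> V \<Longrightarrow> y \<in> V \<Longrightarrow> (\<lambda>j. x j + Polynomial.smult c (y j)) \<in> V"
    and "x \<in> V \<Longrightarrow> y \<in> V \<Longrightarrow> (\<lambda>j. x j + y j) \<in> V"
    and "x \<in> V \<Longrightarrow> y \<in> V \<Longrightarrow> (\<lambda>j. x j - y j) \<in> V"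
    and "x \<in> V \<Longrightarrow> (\<lambda>j. Polynomial.smult c (x j)) \<in> V"
proof -
  show z: "(\<lambda>_. 0) \<in> V" using assms unfolding row_subspace_def by blast
  show *: "(\<lambda>j. x j + Polynomial.smult c (y j)) \<in> V" if "x \<in> V" "y \<in> V" for x y c
    using assms that unfolding row_subspace_def by blast
  show "(\<lambda>j. x j + y j) \<in> V" if "x \<in> V" "y \<in> V" using *[OF that, of 1] by simp
  show "(\<lambda>j. x j - y j) \<in> V" if "x \<in> V" "y \<in> V" using *[OF that, of "-1"] by simp
  show "(\<lambda>j. Polynomial.smult c (x j)) \<in> V" if "x \<in> V" using *[OF z that, of c] by simp
qed

lemma row_subspace_lincomb:
  assumes "row_subspace V" "\<And>i. i < n \<Longrightarrow> b i \<in> V"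
  shows "lincomb_rows c b n \<in> V"
  using assms(2)
proof (induction n)
  case 0
  then show ?case using row_subspaceD(1)[OF assms(1)] by (simp add: lincomb_rows_def[abs_def])
next
  case (Suc n)
  then have "(\<lambda>j. lincomb_rows c b n j + Polynomial.smult (c n) (b n j)) \<in> V"
    by (intro row_subspaceD(2)[OF assms(1)]) auto
  then show ?case by (simp add: lincomb_rows_def[abs_def])
qed

text \<open>A basis of \<open>V\<close> modulo \<open>U\<close>. The generators \<open>F i\<close>
  may lie outside \<open>V\<close>, so they cannot simply be thinned out. Instead, dropping one
  generator \<open>a\<close> shrinks \<open>V\<close> to a subspace \<open>V'\<close>, and a single
  vector with non-zero coefficient at \<open>a\<close> makes up for the difference.\<close>

lemma basis_modulo:
  assumes "finite I" "row_subspace U" "row_subspace V" "U \<subseteq> V"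
    and "\<And>v. v \<in> V \<Longrightarrow> \<exists>c. (\<lambda>j. v j - (\<Sum>i\<in>I. Polynomial.smult (c i) (F i j))) \<in> U"
  shows "\<exists>n b. (\<forall>i<n. b i \<in> V) \<and> (\<forall>v\<in>V. \<exists>c. (\<lambda>j. v j - lincomb_rows c b n j) \<in> U) \<and>
    (\<forall>c. lincomb_rows c b n \<in> U \<longrightarrow> (\<forall>i<n. c i = 0))"
  using assms
proof (induction I arbitrary: V rule: finite_induct)
  case empty
  then show ?case
    by (intro exI[of _ 0] exI[of _ "\<lambda>_ _. 0"]) (auto simp: lincomb_rows_def)
next
  case (insert a I)
  define rep where "rep v c = (\<lambda>j. v j - (\<Sum>i\<in>I. Polynomial.smult (c i) (F i j)))" for v c
  define V' where "V' = {v \<in> V. \<exists>c. rep v c \<in> U}"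
  note U = row_subspaceD[OF insert.prems(1)] and V = row_subspaceD[OF insert.prems(2)]
  have V': "row_subspace V'"
    unfolding row_subspace_def
  proof (intro conjI ballI allI)
    have "rep (\<lambda>_. 0) (\<lambda>_. 0) \<in> U" using U(1) by (simp add: rep_def)
    then show "(\<lambda>_. 0) \<in> V'" unfolding V'_def using V(1) by blast
    fix x y d assume "x \<in> V'" "y \<in> V'"
    then obtain c1 c2 where c: "x \<in> V" "y \<in> V" "rep x c1 \<in> U" "rep y c2 \<in> U"
      unfolding V'_def by blast
    have "rep (\<lambda>j. x j + Polynomial.smult d (y j)) (\<lambda>i. c1 i + d * c2 i) \<in> U"
      using U(2)[OF c(3,4), of d] unfolding rep_def
      by (simp add: smult_add_left sum.distrib smult_sum_right smult_diff_right algebra_simps)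
    then show "(\<lambda>j. x j + Polynomial.smult d (y j)) \<in> V'"
      unfolding V'_def using V(2)[OF c(1,2)] by blast
  qed
  have "U \<subseteq> V'"
  proof
    fix x assume "x \<in> U"
    moreover have "rep x (\<lambda>_. 0) = x" by (simp add: rep_def)
    ultimately show "x \<in> V'" unfolding V'_def using insert.prems(3) by (metis (mono_tags) mem_Collect_eq subsetD)
  qed
  moreover have "\<exists>c. (\<lambda>j. v j - (\<Sum>i\<in>I. Polynomial.smult (c i) (F i j))) \<in> U" if "v \<in> V'" for v
    using that unfolding V'_def rep_def by blast
  ultimately obtain n b where b: "\<And>i. i < n \<Longrightarrow> b i \<in> V'"
    "\<And>v. v \<in> V' \<Longrightarrow> \<exists>c. (\<lambda>j. v j - lincomb_rows c b n j) \<in> U"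
    "\<And>c. lincomb_rows c b n \<in> U \<Longrightarrow> \<forall>i<n. c i = 0"
    using insert.IH[OF insert.prems(1) V'] by blast
  show ?case
  proof (cases "V \<subseteq> V'")
    case True
    then have "\<forall>v\<in>V. \<exists>c. (\<lambda>j. v j - lincomb_rows c b n j) \<in> U" using b(2) by auto
    moreover have "\<forall>i<n. b i \<in> V" using b(1) unfolding V'_def by blast
    moreover have "\<forall>c. lincomb_rows c b n \<in> U \<longrightarrow> (\<forall>i<n. c i = 0)" using b(3) by simp
    ultimately show ?thesis by (intro exI[of _ n] exI[of _ b] conjI)
  next
    case False
    then obtain v where v: "v \<in> V" "v \<notin> V'" by blast
    obtain c where c: "(\<lambda>j. v j - (\<Sum>i\<in>insert a I. Polynomial.smult (c i) (F i j))) \<in> U"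
      using insert.prems(4)[OF v(1)] by blast
    have ca: "c a \<noteq> 0"
    proof
      assume "c a = 0"
      then have "rep v c \<in> U" using c insert.hyps by (simp add: rep_def)
      then show False using v unfolding V'_def by blast
    qed
    define b' where "b' = b(n := v)"
    have split: "lincomb_rows d b' (Suc n) j = lincomb_rows d b n j + Polynomial.smult (d n) (v j)" for d j
      unfolding lincomb_rows_def b'_def by simp
    have 1: "\<forall>z\<in>V. \<exists>d. (\<lambda>j. z j - lincomb_rows d b' (Suc n) j) \<in> U"
    proof
      fix z assume z: "z \<in> V"
      obtain e where e: "(\<lambda>j. z j - (\<Sum>i\<in>insert a I. Polynomial.smult (e i) (F i j))) \<in> U"
        using insert.prems(4)[OF z] by blast
      \<comment> \<open>This multiple of \<open>v\<close> cancels the coefficient at the generator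
        \<open>a\<close>.\<close>
      define s where "s = e a / c a"
      have "(\<lambda>j. (z j - (\<Sum>i\<in>insert a I. Polynomial.smult (e i) (F i j)))
          + Polynomial.smult (- s) (v j - (\<Sum>i\<in>insert a I. Polynomial.smult (c i) (F i j)))) \<in> U"
        by (rule U(2)[OF e c])
      also have "(\<lambda>j. (z j - (\<Sum>i\<in>insert a I. Polynomial.smult (e i) (F i j)))
          + Polynomial.smult (- s) (v j - (\<Sum>i\<in>insert a I. Polynomial.smult (c i) (F i j))))
          = rep (\<lambda>j. z j - Polynomial.smult s (v j)) (\<lambda>i. e i - s * c i)"
        using insert.hyps ca unfolding rep_def
        by (simp add: s_def smult_diff_left smult_diff_right sum_subtractf smult_add_right smult_sum_right
          sum_negf algebra_simps fun_eq_iff)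
      finally have "(\<lambda>j. z j - Polynomial.smult s (v j)) \<in> V'"
        unfolding V'_def using V(2)[OF z v(1), of "- s"] by auto
      from b(2)[OF this] obtain d where d: "(\<lambda>j. z j - Polynomial.smult s (v j) - lincomb_rows d b n j) \<in> U" by blast
      have "lincomb_rows (d(n := s)) b n = lincomb_rows d b n"
        unfolding lincomb_rows_def by (intro ext sum.cong) auto
      then show "\<exists>d. (\<lambda>j. z j - lincomb_rows d b' (Suc n) j) \<in> U"
        using d by (intro exI[of _ "d(n := s)"]) (simp add: split algebra_simps)
    qed
    have 2: "\<forall>d. lincomb_rows d b' (Suc n) \<in> U \<longrightarrow> (\<forall>i<Suc n. d i = 0)"
    proof (intro allI impI)
      fix d i assume d: "lincomb_rows d b' (Suc n) \<in> U" and i: "i < Suc n"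
      have dn: "d n = 0"
      proof (rule ccontr)
        assume nz: "d n \<noteq> 0"
        have "lincomb_rows d b' (Suc n) \<in> V'" using d \<open>U \<subseteq> V'\<close> by blast
        moreover have "lincomb_rows d b n \<in> V'" using row_subspace_lincomb[OF V'] b(1) by blast
        ultimately have "(\<lambda>j. lincomb_rows d b' (Suc n) j - lincomb_rows d b n j) \<in> V'"
          using row_subspaceD(4)[OF V'] by blast
        then have "(\<lambda>j. Polynomial.smult (d n) (v j)) \<in> V'" by (simp add: split)
        then have "(\<lambda>j. Polynomial.smult (1 / d n) (Polynomial.smult (d n) (v j))) \<in> V'"
          by (rule row_subspaceD(5)[OF V'])
        then show False using nz v(2) by simp
      qed
      then have "lincomb_rows d b n \<in> U" using d unfolding split[abs_def] by (simp add: split[abs_def] fun_eq_iff cong: if_cong)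
      then show "d i = 0" using b(3)[of d] dn i by (auto simp: less_Suc_eq)
    qed
    have 3: "\<forall>i<Suc n. b' i \<in> V" using b(1) v(1) unfolding b'_def V'_def by (auto simp: less_Suc_eq)
    show ?thesis by (intro exI[of _ "Suc n"] exI[of _ b'] conjI 1 2 3)
  qed
qed

text \<open>\<open>M\<close> is an image representation of the controllable part with the \<open>m\<close> inputs first, \<open>Nt\<close> is the
  adjugate of its upper square block and \<open>\<delta>\<close> the determinant of that block.\<close>

locale io_system =
  fixes m P k :: nat
    and B :: "(nat \<Rightarrow> real \<Rightarrow> real) set"
    and R M Nt :: "nat \<Rightarrow> nat \<Rightarrow> real poly"
    and \<delta> :: "real poly"
    and \<Lambda> :: "complex set"
  assumes B_def: "B = {f. (\<forall>j<m + P. smooth (f j)) \<and> (\<forall>i<k. \<forall>t. rowop (m + P) (R i) f t = 0)}"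
    and image_sub: "\<And>l. (\<And>j. j < m \<Longrightarrow> smooth (l j)) \<Longrightarrow> (\<lambda>i. rowop m (M i) l) \<in> B"
    and delta_nz: "\<delta> \<noteq> 0"
    and MN: "\<And>i l. i < m \<Longrightarrow> l < m \<Longrightarrow> (\<Sum>j<m. M i j * Nt j l) = (if i = l then \<delta> else 0)"
    and NM: "\<And>i l. i < m \<Longrightarrow> l < m \<Longrightarrow> (\<Sum>j<m. Nt i j * M j l) = (if i = l then \<delta> else 0)"
    and proper_degree: "\<And>i l. i < P \<Longrightarrow> l < m \<Longrightarrow> degree (\<Sum>j<m. M (m + i) j * Nt j l) \<le> degree \<delta>"
    and outputs: "\<And>i. i < P \<Longrightarrow> \<exists>c d. d \<noteq> 0 \<and>
      (\<forall>j<P. (\<Sum>l<k. c l * R l (m + j)) = (if i = j then d else 0))"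
    and exact: "\<And>s x. s \<notin> \<Lambda> \<Longrightarrow> (\<And>l. l < k \<Longrightarrow> (\<Sum>j<m + P. poly (map_poly of_real (R l j)) s * x j) = 0) \<Longrightarrow>
      \<exists>c. \<forall>j<m + P. x j = (\<Sum>i<m. poly (map_poly of_real (M j i)) s * c i)"
    and unmixed: "s \<in> \<Lambda> \<Longrightarrow> - s \<notin> \<Lambda>"
begin

definition Ann :: "(nat \<Rightarrow> real poly) set" where
  "Ann = {r. \<forall>f\<in>B. \<forall>t. rowop (m + P) r f t = 0}"

definition rM :: "(nat \<Rightarrow> real poly) \<Rightarrow> nat \<Rightarrow> real poly" where
  "rM r i = (\<Sum>j<m + P. r j * M j i)"

text \<open>The torsion rows modulo \<open>Ann\<close>: those that some non-zero polynomial
  multiplies into \<open>Ann\<close>. One direction holds because \<open>rM\<close> is linear over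
  the polynomials and \<open>Ann\<close> lies in \<open>Tors\<close>; the other follows from
  \<open>annihilates_A2_iff\<close>.\<close>

definition Tors :: "(nat \<Rightarrow> real poly) set" where
  "Tors = {r. \<forall>i<m. rM r i = 0}"

text \<open>\<open>T r l / \<delta>\<close> is the transfer function of \<open>r\<close> from the \<open>l\<close>-th input.\<close>

definition T :: "(nat \<Rightarrow> real poly) \<Rightarrow> nat \<Rightarrow> real poly" where
  "T r l = (\<Sum>i<m. rM r i * Nt i l)"

text \<open>Modulo \<open>Ann\<close>, the rows in \<open>Strict\<close> are the components of state maps, and those in \<open>Tors\<close> are the
  components that vanish on the controllable part.\<close>

definition Strict :: "(nat \<Rightarrow> real poly) set" where
  "Strict = {r. \<forall>l<m. \<forall>d\<ge>degree \<delta>. coeff (T r l) d = 0}"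

lemma B_smooth: "f \<in> B \<Longrightarrow> j < m + P \<Longrightarrow> smooth (f j)"
  unfolding B_def by blast

lemma rM_add: "rM (\<lambda>j. r j + s j) i = rM r i + rM s i"
  by (simp add: rM_def algebra_simps sum.distrib)

lemma rM_diff: "rM (\<lambda>j. r j - s j) i = rM r i - rM s i"
  by (simp add: rM_def algebra_simps sum_subtractf)

lemma rM_mult: "rM (\<lambda>j. p * r j) i = p * rM r i"
  by (simp add: rM_def algebra_simps sum_distrib_left)

lemma rM_smult: "rM (\<lambda>j. Polynomial.smult c (r j)) i = Polynomial.smult c (rM r i)"
  using rM_mult[of "[:c:]"] by simp

lemma rM_zero [simp]: "rM (\<lambda>_. 0) i = 0"
  by (simp add: rM_def)

lemma T_add: "T (\<lambda>j. r j + s j) l = T r l + T s l"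
  by (simp add: T_def rM_add algebra_simps sum.distrib)

lemma T_diff: "T (\<lambda>j. r j - s j) l = T r l - T s l"
  by (simp add: T_def rM_diff algebra_simps sum_subtractf)

lemma T_mult: "T (\<lambda>j. p * r j) l = p * T r l"
  by (simp add: T_def rM_mult algebra_simps sum_distrib_left)

lemma T_smult: "T (\<lambda>j. Polynomial.smult c (r j)) l = Polynomial.smult c (T r l)"
  using T_mult[of "[:c:]"] by simp

lemma T_zero [simp]: "T (\<lambda>_. 0) l = 0"
  by (simp add: T_def)

lemma T_Tors: "r \<in> Tors \<Longrightarrow> T r l = 0"
  by (simp add: T_def Tors_def)

text \<open>Multiplication by the upper block of \<open>M\<close> undoes \<open>Nt\<close> up to the
  non-zero factor \<open>\<delta>\<close>.\<close>

lemma Tors_if_T: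
  assumes "\<And>l. l < m \<Longrightarrow> T r l = 0"
  shows "r \<in> Tors"
proof -
  have "rM r i * \<delta> = 0" if i: "i < m" for i
  proof -
    have "(\<Sum>l<m. T r l * M l i) = (\<Sum>j<m. rM r j * (\<Sum>l<m. Nt j l * M l i))"
      unfolding T_def sum_distrib_right by (subst sum.swap) (simp add: sum_distrib_left mult.assoc)
    also have "\<dots> = (\<Sum>j<m. if j = i then rM r j * \<delta> else 0)"
      by (rule sum.cong) (use NM i in auto)
    finally show ?thesis using assms i by simp
  qed
  then show ?thesis unfolding Tors_def using delta_nz by auto
qed

lemma subspace_Ann: "row_subspace Ann"
  unfolding row_subspace_def Ann_def by (auto simp: rowop_add rowop_smult)

lemma subspace_Tors: "row_subspace Tors"
  unfolding row_subspace_def Tors_def by (auto simp: rM_add rM_smult)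

lemma subspace_Strict: "row_subspace Strict"
  unfolding row_subspace_def Strict_def by (auto simp: T_add T_smult)

lemma Ann_mult: "r \<in> Ann \<Longrightarrow> (\<lambda>j. p * r j) \<in> Ann"
proof -
  assume r: "r \<in> Ann"
  have "rowop (m + P) (\<lambda>j. p * r j) f t = 0" if f: "f \<in> B" for f t
  proof -
    have "rowop (m + P) r f = (\<lambda>_. 0)" using r f unfolding Ann_def by auto
    then show ?thesis using B_smooth[OF f] by (simp add: rowop_mult)
  qed
  then show ?thesis unfolding Ann_def by blast
qed

lemma Tors_mult: "r \<in> Tors \<Longrightarrow> (\<lambda>j. p * r j) \<in> Tors"
  unfolding Tors_def by (simp add: rM_mult)

lemma R_in_Ann: "l < k \<Longrightarrow> R l \<in> Ann"
  using B_def unfolding Ann_def by auto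

lemma Ann_cong:
  assumes "r \<in> Ann" "\<And>j. j < m + P \<Longrightarrow> r j = s j"
  shows "s \<in> Ann"
proof -
  have "rowop (m + P) s = rowop (m + P) r" unfolding rowop_def[abs_def] using assms(2) by simp
  then show ?thesis using assms(1) unfolding Ann_def by simp
qed

lemma Ann_outside: "(\<And>j. j < m + P \<Longrightarrow> r j = 0) \<Longrightarrow> r \<in> Ann"
  by (rule Ann_cong[OF row_subspaceD(1)[OF subspace_Ann]]) simp

lemma Ann_sum: "(\<And>x. x \<in> X \<Longrightarrow> r x \<in> Ann) \<Longrightarrow> (\<lambda>j. \<Sum>x\<in>X. r x j) \<in> Ann"
  unfolding Ann_def by (auto simp: rowop_sum)

lemma rowop_image:
  assumes "\<And>j. j < m \<Longrightarrow> smooth (l j)"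
  shows "rowop (m + P) r (\<lambda>i. rowop m (M i) l) t = rowop m (rM r) l t"
  unfolding rM_def[abs_def] by (rule rowop_rowop[OF assms])

lemma Ann_sub_Tors: "Ann \<subseteq> Tors"
proof
  fix r assume r: "r \<in> Ann"
  have "rM r i = 0" if i: "i < m" for i
  proof (rule rowop_eq_zero_imp[OF _ i])
    fix l t assume l: "\<And>j. j < m \<Longrightarrow> smooth (l j :: real \<Rightarrow> real)"
    show "rowop m (rM r) l t = 0"
      using r image_sub[of l, OF l] rowop_image[of l, OF l] unfolding Ann_def by auto
  qed
  then show "r \<in> Tors" unfolding Tors_def by blast
qed

lemma Tors_sub_Strict: "Tors \<subseteq> Strict"
  unfolding Strict_def using T_Tors by auto

lemma T_unit_input:
  assumes "l < m"
  shows "T (\<lambda>j. if j < m then a j else 0) l = a l * \<delta>"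
proof -
  have rM: "rM (\<lambda>j. if j < m then a j else 0) i = (\<Sum>j<m. a j * M j i)" for i
    unfolding rM_def by (rule sum.mono_neutral_cong_right) auto
  have "T (\<lambda>j. if j < m then a j else 0) l = (\<Sum>j<m. a j * (\<Sum>i<m. M j i * Nt i l))"
    unfolding T_def rM sum_distrib_right by (subst sum.swap) (simp add: sum_distrib_left mult.assoc)
  also have "\<dots> = (\<Sum>j<m. if j = l then a j * \<delta> else 0)"
    by (rule sum.cong) (use MN assms in auto)
  finally show ?thesis using assms by simp
qed

lemma T_alt: "T r l = (\<Sum>j<m + P. r j * (\<Sum>i<m. M j i * Nt i l))"
  unfolding T_def rM_def sum_distrib_right by (subst sum.swap) (simp add: sum_distrib_left mult.assoc)

lemma T_split:
  assumes "l < m"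
  shows "T r l = r l * \<delta> + (\<Sum>i<P. r (m + i) * (\<Sum>j<m. M (m + i) j * Nt j l))"
proof -
  have eq: "{..<m + P} = {..<m} \<union> {m..<m + P}" "{..<m} \<inter> {m..<m + P} = {}" by auto
  have "T r l = (\<Sum>j<m. r j * (\<Sum>i<m. M j i * Nt i l)) + (\<Sum>j=m..<m+P. r j * (\<Sum>i<m. M j i * Nt i l))"
    unfolding T_alt eq(1) by (rule sum.union_disjoint) auto
  also have "(\<Sum>j<m. r j * (\<Sum>i<m. M j i * Nt i l)) = (\<Sum>j<m. if j = l then r j * \<delta> else 0)"
    by (rule sum.cong) (use MN assms in auto)
  also have "(\<Sum>j=m..<m+P. r j * (\<Sum>i<m. M j i * Nt i l)) = (\<Sum>i<P. r (m + i) * (\<Sum>j<m. M (m + i) j * Nt j l))"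
    using sum.shift_bounds_nat_ivl[of "\<lambda>j. r j * (\<Sum>i<m. M j i * Nt i l)" 0 m P]
    by (simp add: lessThan_atLeast0 add.commute)
  finally show ?thesis using assms by simp
qed

text \<open>Some rows of \<open>Ann\<close> have output part \<open>d i\<close> times a unit vector,
  so output entries can be reduced modulo \<open>d i\<close>. Then strict properness bounds the
  input entries as well: an input entry times \<open>\<delta>\<close> is the transfer function minus
  the contributions of the outputs, which are proper.\<close>

lemma Strict_finite_codim:
  "\<exists>D. \<forall>r\<in>Strict. \<exists>c. (\<lambda>j. r j - (\<Sum>i\<in>{..<m + P} \<times> {..D}. Polynomial.smult (c i)
      (if j = fst i then monom 1 (snd i) else 0))) \<in> Ann"
proof -
  have "\<forall>i\<in>{..<P}. \<exists>cd. snd cd \<noteq> 0 \<and>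
      (\<forall>j<P. (\<Sum>l<k. fst cd l * R l (m + j)) = (if i = j then snd cd else 0))"
  proof
    fix i assume "i \<in> {..<P}"
    then obtain c d where "d \<noteq> 0" "\<forall>j<P. (\<Sum>l<k. c l * R l (m + j)) = (if i = j then d else 0)"
      using outputs by blast
    then show "\<exists>cd. snd cd \<noteq> 0 \<and>
        (\<forall>j<P. (\<Sum>l<k. fst cd l * R l (m + j)) = (if i = j then snd cd else 0))"
      by (intro exI[of _ "(c, d)"]) simp
  qed
  from bchoice[OF this] obtain cd where
    cd: "\<And>i. i < P \<Longrightarrow> snd (cd i) \<noteq> 0" "\<And>i j. i < P \<Longrightarrow> j < P \<Longrightarrow>
      (\<Sum>l<k. fst (cd i) l * R l (m + j)) = (if i = j then snd (cd i) else 0)" by auto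
  define d where "d i = snd (cd i)" for i
  define row where "row i j = (\<Sum>l<k. fst (cd i) l * R l j)" for i j
  have row: "row i \<in> Ann" for i
    unfolding row_def[abs_def] by (intro Ann_sum Ann_mult R_in_Ann) auto
  have row_out: "row i (m + j) = (if i = j then d i else 0)" if "i < P" "j < P" for i j
    using cd(2)[OF that] unfolding row_def d_def .
  define D where "D = (\<Sum>i<P. degree (d i))"
  have "\<exists>c. (\<lambda>j. r j - (\<Sum>i\<in>{..<m + P} \<times> {..D}. Polynomial.smult (c i)
      (if j = fst i then monom 1 (snd i) else 0))) \<in> Ann" if r: "r \<in> Strict" for r
  proof -
    define q where "q i = r (m + i) div d i" for i
    define s where "s j = (\<Sum>i<P. q i * row i j)" for j
    have sA: "s \<in> Ann" unfolding s_def[abs_def] by (intro Ann_sum Ann_mult row)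
    define r' where "r' j = r j - s j" for j
    have s_out: "s (m + j) = q j * d j" if "j < P" for j
    proof -
      have "s (m + j) = (\<Sum>i<P. if i = j then q i * d i else 0)"
        unfolding s_def by (rule sum.cong) (use row_out that in auto)
      then show ?thesis using that by simp
    qed
    have out: "degree (r' (m + i)) \<le> D" if i: "i < P" for i
    proof -
      have "r' (m + i) = r (m + i) mod d i"
        unfolding r'_def s_out[OF i] q_def by (simp add: minus_div_mult_eq_mod)
      then have "degree (r' (m + i)) \<le> degree (d i)"
        using degree_mod_less[of "d i" "r (m + i)"] cd(1)[OF i] unfolding d_def by auto
      also have "\<dots> \<le> D" unfolding D_def by (rule member_le_sum) (use i in auto)
      finally show ?thesis .
    qed
    have inp: "degree (r' l) \<le> D" if l: "l < m" for l
    proof (cases "r' l = 0")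
      case False
      have "T s l = 0" using sA Ann_sub_Tors T_Tors by blast
      then have Tr: "T r' l = T r l" unfolding r'_def[abs_def] T_diff by simp
      have dT: "degree (T r l) \<le> degree \<delta>"
        using r l unfolding Strict_def by (intro degree_le) auto
      have "r' l * \<delta> = T r l - (\<Sum>i<P. r' (m + i) * (\<Sum>j<m. M (m + i) j * Nt j l))"
        using T_split[OF l, of r'] Tr by simp
      also have "degree \<dots> \<le> D + degree \<delta>"
      proof (intro degree_diff_le degree_sum_le)
        fix i assume "i \<in> {..<P}"
        then have i: "i < P" by simp
        show "degree (r' (m + i) * (\<Sum>j<m. M (m + i) j * Nt j l)) \<le> D + degree \<delta>"
          using out[OF i] proper_degree[OF i l] degree_mult_le add_mono le_trans by blast
      qed (use dT in auto)
      finally show ?thesis using False delta_nz by (simp add: degree_mult_eq)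
    qed simp
    have deg: "degree (r' j) \<le> D" if "j < m + P" for j
      using inp[of j] out[of "j - m"] that by (cases "j < m") auto
    define c where "c i = coeff (r' (fst i)) (snd i)" for i
    have eq: "(\<Sum>i\<in>{..<m + P} \<times> {..D}. Polynomial.smult (c i) (if j = fst i then monom 1 (snd i) else 0)) = r' j"
      if j: "j < m + P" for j
    proof -
      have "(\<Sum>i\<in>{..<m + P} \<times> {..D}. Polynomial.smult (c i) (if j = fst i then monom 1 (snd i) else 0))
        = (\<Sum>i<m + P. \<Sum>d\<le>D. if i = j then monom (coeff (r' j) d) d else 0)"
        unfolding sum.cartesian_product
        by (rule sum.cong) (auto simp: c_def smult_monom)
      also have "\<dots> = (\<Sum>i<m + P. if i = j then (\<Sum>d\<le>D. monom (coeff (r' j) d) d) else 0)"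
        by (rule sum.cong) auto
      also have "\<dots> = (\<Sum>d\<le>D. monom (coeff (r' j) d) d)" using j by simp
      also have "\<dots> = r' j"
        using poly_as_sum_of_monoms'[OF deg[OF j]] .
      finally show ?thesis .
    qed
    show ?thesis
      by (intro exI[of _ c] Ann_cong[OF sA]) (simp add: eq, simp add: r'_def)
  qed
  then show ?thesis by blast
qed

end

lemma sum_lessThan_add: "(\<Sum>i<a + b. f i) = (\<Sum>i<a. f i) + (\<Sum>i<b. f (a + i :: nat))"
  for f :: "nat \<Rightarrow> 'a::comm_monoid_add"
  by (induction b) (simp_all add: algebra_simps)

lemma lincomb_rows_cong: "(\<And>i. i < n \<Longrightarrow> c i = d i) \<Longrightarrow> (\<And>i. i < n \<Longrightarrow> a i = b i) \<Longrightarrow>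
    lincomb_rows c a n = lincomb_rows d b n"
  unfolding lincomb_rows_def by (intro ext sum.cong) auto

lemma lincomb_rows_add: "lincomb_rows (\<lambda>i. c i + d i) b n j = lincomb_rows c b n j + lincomb_rows d b n j"
  by (simp add: lincomb_rows_def smult_add_left sum.distrib)

lemma lincomb_rows_smult: "lincomb_rows (\<lambda>i. s * c i) b n j = Polynomial.smult s (lincomb_rows c b n j)"
  by (simp add: lincomb_rows_def smult_sum_right)

lemma lincomb_rows_zero [simp]: "lincomb_rows (\<lambda>_. 0) b n j = 0"
  by (simp add: lincomb_rows_def)

lemma lincomb_rows_unit: "i0 < n \<Longrightarrow> lincomb_rows (\<lambda>i. if i = i0 then 1 else 0) b n j = b i0 j"
  unfolding lincomb_rows_def
  by (subst sum.cong[OF refl, of _ _ "\<lambda>i. if i = i0 then b i j else 0"]) auto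

lemma lincomb_rows_lincomb:
  "(\<Sum>i<N. Polynomial.smult (c i) (lincomb_rows (A i) b n j)) = lincomb_rows (\<lambda>i'. \<Sum>i<N. c i * A i i') b n j"
  unfolding lincomb_rows_def
  by (simp add: smult_sum smult_sum_right sum.swap[of _ "{..<N}"])

lemma rowop_lincomb: "rowop N (lincomb_rows c b n) f t = (\<Sum>i<n. c i * rowop N (b i) f t)"
  unfolding lincomb_rows_def[abs_def] by (simp add: rowop_sum rowop_smult)

lemma sum_const_poly: "(\<Sum>x\<in>X. [:f x:]) = [:\<Sum>x\<in>X. f x:]"
  by (induction X rule: infinite_finite_induct) auto

definition input_row :: "nat \<Rightarrow> (nat \<Rightarrow> real poly) \<Rightarrow> nat \<Rightarrow> real poly" where
  "input_row m a j = (if j < m then a j else 0)"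

lemma rowop_input_row: "rowop (m + P) (input_row m a) f t = (\<Sum>l<m. diff_op (a l) (f l) t)"
  unfolding rowop_def input_row_def by (rule sum.mono_neutral_cong_right) auto

text \<open>The rows \<open>X i\<close> with \<open>i < n1\<close> are a basis of
  \<open>Strict\<close> modulo \<open>Tors\<close>, those with \<open>n1 \<le> i < n\<close> one of
  \<open>Tors\<close> modulo \<open>Ann\<close>. They are the components of the two parts of the
  state.\<close>

locale state_basis = io_system +
  fixes n1 n :: nat and X :: "nat \<Rightarrow> nat \<Rightarrow> real poly"
  assumes n1_le_n: "n1 \<le> n"
    and X_Strict: "\<And>i. i < n \<Longrightarrow> X i \<in> Strict"
    and X_Tors: "\<And>i. n1 \<le> i \<Longrightarrow> i < n \<Longrightarrow> X i \<in> Tors"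
    and X_span: "\<And>r. r \<in> Strict \<Longrightarrow> \<exists>c. (\<lambda>j. r j - lincomb_rows c X n j) \<in> Ann"
    and X_span_Tors: "\<And>r. r \<in> Tors \<Longrightarrow>
      \<exists>c. (\<forall>i<n1. c i = 0) \<and> (\<lambda>j. r j - lincomb_rows c X n j) \<in> Ann"
    and X_ind_Tors: "\<And>c. lincomb_rows c X n \<in> Tors \<Longrightarrow> \<forall>i<n1. c i = 0"
    and X_ind: "\<And>c. lincomb_rows c X n \<in> Ann \<Longrightarrow> \<forall>i<n. c i = 0"

lemma (in io_system) state_basis_exists: "\<exists>n1 n X. state_basis m P k B R M Nt \<delta> \<Lambda> n1 n X"
proof -
  obtain D where D: "\<And>r. r \<in> Strict \<Longrightarrow> \<exists>c. (\<lambda>j. r j - (\<Sum>i\<in>{..<m + P} \<times> {..D}. Polynomial.smult (c i)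
      (if j = fst i then monom 1 (snd i) else 0))) \<in> Ann"
    using Strict_finite_codim by blast
  define F where "F i j = (if j = fst i then monom 1 (snd i) else 0 :: real poly)" for i :: "nat \<times> nat" and j
  have fin: "finite ({..<m + P} \<times> {..D})" by simp
  have "\<exists>c. (\<lambda>j. r j - (\<Sum>i\<in>{..<m + P} \<times> {..D}. Polynomial.smult (c i) (F i j))) \<in> Ann"
    if "r \<in> Tors" for r
    unfolding F_def using D Tors_sub_Strict that by blast
  from basis_modulo[OF fin subspace_Ann subspace_Tors Ann_sub_Tors this]
  obtain n2 b2 where b2: "\<And>i. i < n2 \<Longrightarrow> b2 i \<in> Tors"
    "\<And>v. v \<in> Tors \<Longrightarrow> \<exists>c. (\<lambda>j. v j - lincomb_rows c b2 n2 j) \<in> Ann"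
    "\<And>c. lincomb_rows c b2 n2 \<in> Ann \<Longrightarrow> \<forall>i<n2. c i = 0" by blast
  have "\<exists>c. (\<lambda>j. r j - (\<Sum>i\<in>{..<m + P} \<times> {..D}. Polynomial.smult (c i) (F i j))) \<in> Tors"
    if "r \<in> Strict" for r
    unfolding F_def using D[OF that] Ann_sub_Tors by blast
  from basis_modulo[OF fin subspace_Tors subspace_Strict Tors_sub_Strict this]
  obtain n1 b1 where b1: "\<And>i. i < n1 \<Longrightarrow> b1 i \<in> Strict"
    "\<And>v. v \<in> Strict \<Longrightarrow> \<exists>c. (\<lambda>j. v j - lincomb_rows c b1 n1 j) \<in> Tors"
    "\<And>c. lincomb_rows c b1 n1 \<in> Tors \<Longrightarrow> \<forall>i<n1. c i = 0" by blast
  define X where "X i = (if i < n1 then b1 i else b2 (i - n1))" for i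
  have split: "lincomb_rows c X (n1 + n2) j = lincomb_rows c b1 n1 j + lincomb_rows (\<lambda>i. c (n1 + i)) b2 n2 j" for c j
  proof -
    have "lincomb_rows c X (n1 + n2) j = (\<Sum>i<n1. Polynomial.smult (c i) (X i j))
        + (\<Sum>i<n2. Polynomial.smult (c (n1 + i)) (X (n1 + i) j))"
      unfolding lincomb_rows_def by (rule sum_lessThan_add)
    then show ?thesis by (simp add: lincomb_rows_def X_def)
  qed
  have T2: "lincomb_rows c b2 n2 \<in> Tors" for c
    by (rule row_subspace_lincomb[OF subspace_Tors]) (rule b2(1))
  have indT: "\<forall>i<n1. c i = 0" if "lincomb_rows c X (n1 + n2) \<in> Tors" for c
  proof -
    have "(\<lambda>j. lincomb_rows c X (n1 + n2) j - lincomb_rows (\<lambda>i. c (n1 + i)) b2 n2 j) \<in> Tors"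
      by (rule row_subspaceD(4)[OF subspace_Tors that T2])
    then have "lincomb_rows c b1 n1 \<in> Tors" by (simp add: split)
    then show ?thesis by (rule b1(3))
  qed
  have "state_basis m P k B R M Nt \<delta> \<Lambda> n1 (n1 + n2) X"
  proof
    show "n1 \<le> n1 + n2" by simp
    show "X i \<in> Tors" if "n1 \<le> i" "i < n1 + n2" for i using b2(1)[of "i - n1"] that by (simp add: X_def)
    then show "X i \<in> Strict" if "i < n1 + n2" for i
      using b1(1)[of i] Tors_sub_Strict that by (cases "i < n1") (auto simp: X_def)
    show "\<forall>i<n1. c i = 0" if "lincomb_rows c X (n1 + n2) \<in> Tors" for c using indT[OF that] .
    show spanT: "\<exists>c. (\<forall>i<n1. c i = 0) \<and> (\<lambda>j. r j - lincomb_rows c X (n1 + n2) j) \<in> Ann" if r: "r \<in> Tors" for r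
    proof -
      obtain c where c: "(\<lambda>j. r j - lincomb_rows c b2 n2 j) \<in> Ann" using b2(2)[OF r] by blast
      have "lincomb_rows (\<lambda>i. if i < n1 then 0 else c (i - n1)) X (n1 + n2) j = lincomb_rows c b2 n2 j" for j
        unfolding split by (simp add: lincomb_rows_def)
      with c show ?thesis by (intro exI[of _ "\<lambda>i. if i < n1 then 0 else c (i - n1)"]) simp
    qed
    show "\<exists>c. (\<lambda>j. r j - lincomb_rows c X (n1 + n2) j) \<in> Ann" if r: "r \<in> Strict" for r
    proof -
      obtain c where c: "(\<lambda>j. r j - lincomb_rows c b1 n1 j) \<in> Tors" using b1(2)[OF r] by blast
      obtain d where d: "(\<lambda>j. r j - lincomb_rows c b1 n1 j - lincomb_rows d b2 n2 j) \<in> Ann" using b2(2)[OF c] by blast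
      define e where "e i = (if i < n1 then c i else d (i - n1))" for i
      have "lincomb_rows e b1 n1 = lincomb_rows c b1 n1"
        by (rule lincomb_rows_cong) (auto simp: e_def)
      then have "lincomb_rows e X (n1 + n2) j = lincomb_rows c b1 n1 j + lincomb_rows d b2 n2 j" for j
        unfolding split by (simp add: e_def)
      with d show ?thesis by (intro exI[of _ e]) (simp add: algebra_simps)
    qed
    show "\<forall>i<n1 + n2. c i = 0" if c: "lincomb_rows c X (n1 + n2) \<in> Ann" for c
    proof -
      have 1: "\<forall>i<n1. c i = 0" using indT Ann_sub_Tors c by blast
      then have "lincomb_rows c b1 n1 j = 0" for j by (simp add: lincomb_rows_def)
      then have "lincomb_rows (\<lambda>i. c (n1 + i)) b2 n2 \<in> Ann" using c by (simp add: split[abs_def])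
      then have "\<forall>i<n2. c (n1 + i) = 0" by (rule b2(3))
      show ?thesis
      proof (intro allI impI)
        fix i assume i: "i < n1 + n2"
        show "c i = 0"
        proof (cases "i < n1")
          case False
          then have "i = n1 + (i - n1)" "i - n1 < n2" using i by auto
          with \<open>\<forall>i<n2. c (n1 + i) = 0\<close> show ?thesis by metis
        qed (use 1 in simp)
      qed
    qed
  qed
  then show ?thesis by blast
qed

context state_basis
begin

lemma T_input_row: "l < m \<Longrightarrow> T (input_row m a) l = a l * \<delta>"
  using T_unit_input[of l a] by (simp add: input_row_def[abs_def])

text \<open>Division of the transfer function by \<open>\<delta>\<close>: the polynomial quotient is
  an operator on the inputs, the strictly proper remainder a combination of states. A torsion row
  has transfer function zero and needs only the second group of states.\<close>

lemma decomp:
  "\<exists>c. (\<lambda>j. r j - lincomb_rows c X n j - input_row m (\<lambda>l. T r l div \<delta>) j) \<in> Ann \<and>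
    (r \<in> Tors \<longrightarrow> (\<forall>i<n1. c i = 0))"
proof (cases "r \<in> Tors")
  case True
  obtain c where "\<forall>i<n1. c i = 0" "(\<lambda>j. r j - lincomb_rows c X n j) \<in> Ann"
    using X_span_Tors[OF True] by blast
  moreover have "input_row m (\<lambda>l. T r l div \<delta>) j = 0" for j
    using T_Tors[OF True] by (simp add: input_row_def)
  ultimately show ?thesis by (intro exI[of _ c]) simp
next
  case False
  define s where "s j = r j - input_row m (\<lambda>l. T r l div \<delta>) j" for j
  have Ts: "T s l = T r l mod \<delta>" if "l < m" for l
    using T_diff[of r "input_row m (\<lambda>l. T r l div \<delta>)" l] T_input_row[OF that, of "\<lambda>l. T r l div \<delta>"]
    by (simp add: s_def[abs_def] minus_div_mult_eq_mod)
  have "s \<in> Strict"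
    unfolding Strict_def
  proof (intro CollectI allI impI)
    fix l d assume "l < m" and d: "degree \<delta> \<le> d"
    show "coeff (T s l) d = 0"
      unfolding Ts[OF \<open>l < m\<close>] using degree_mod_less[OF delta_nz, of "T r l"] d by (auto intro: coeff_eq_0)
  qed
  then obtain c where "(\<lambda>j. s j - lincomb_rows c X n j) \<in> Ann" using X_span by blast
  then show ?thesis using False by (intro exI[of _ c]) (simp add: s_def algebra_simps)
qed

text \<open>Strictly proper and polynomial parts are independent: a non-zero multiple of
  \<open>\<delta>\<close> has degree at least \<open>degree \<delta>\<close>.\<close>

lemma unique_Tors:
  assumes "(\<lambda>j. lincomb_rows c X n j + input_row m a j) \<in> Tors"
  shows "\<forall>i<n1. c i = 0" and "l < m \<Longrightarrow> a l = 0"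
proof -
  have S: "lincomb_rows c X n \<in> Strict"
    by (rule row_subspace_lincomb[OF subspace_Strict X_Strict])
  have a0: "a l = 0" if l: "l < m" for l
  proof (rule ccontr)
    assume nz: "a l \<noteq> 0"
    have "T (lincomb_rows c X n) l + a l * \<delta> = 0"
      using T_Tors[OF assms, of l] T_add[of "lincomb_rows c X n" "input_row m a" l] T_input_row[OF l] by simp
    then have "a l * \<delta> = - T (lincomb_rows c X n) l" by (simp add: eq_neg_iff_add_eq_0 add.commute)
    then have "coeff (a l * \<delta>) d = 0" if "d \<ge> degree \<delta>" for d
      using S l that unfolding Strict_def by simp
    moreover have "degree (a l * \<delta>) \<ge> degree \<delta>" using nz delta_nz by (simp add: degree_mult_eq)
    ultimately have "a l * \<delta> = 0" by (metis leading_coeff_0_iff)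
    then show False using nz delta_nz by simp
  qed
  then show "l < m \<Longrightarrow> a l = 0" by blast
  have "input_row m a j = 0" for j using a0 by (simp add: input_row_def)
  then show "\<forall>i<n1. c i = 0" using assms X_ind_Tors by simp
qed

lemma unique_Ann:
  assumes "(\<lambda>j. lincomb_rows c X n j + input_row m a j) \<in> Ann"
  shows "\<forall>i<n. c i = 0" and "l < m \<Longrightarrow> a l = 0"
proof -
  have a0: "l < m \<Longrightarrow> a l = 0" for l using unique_Tors assms Ann_sub_Tors by blast
  then show "l < m \<Longrightarrow> a l = 0" by blast
  have "input_row m a j = 0" for j using a0 by (simp add: input_row_def)
  then show "\<forall>i<n. c i = 0" using assms X_ind by simp
qed

text \<open>The polynomial part of a proper fraction is its value at infinity.\<close>

lemma div_delta_const:
  assumes "degree p \<le> degree \<delta>"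
  shows "p div \<delta> = [:coeff p (degree \<delta>) / lead_coeff \<delta>:]"
proof -
  define c where "c = coeff p (degree \<delta>) / lead_coeff \<delta>"
  define r where "r = p - [:c:] * \<delta>"
  have "coeff r (degree \<delta>) = 0" using delta_nz by (simp add: r_def c_def)
  moreover have "degree r \<le> degree \<delta>" unfolding r_def using assms by (intro degree_diff_le) auto
  ultimately have "r = 0 \<or> degree r < degree \<delta>"
    by (metis eq_zero_or_degree_less)
  then have "r div \<delta> = 0" by (auto intro: div_poly_less)
  moreover have "p = r + [:c:] * \<delta>" by (simp add: r_def)
  ultimately have "p div \<delta> = [:c:]" using delta_nz by (metis add.right_neutral div_mult_self1)
  then show ?thesis unfolding c_def .
qed

text \<open>One differentiation turns strictly proper into proper, so the inputs enter with constant
  coefficients. \<open>Tors\<close> is closed under differentiation, which gives the zero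
  blocks.\<close>

lemma state_equations:
  "\<exists>A Bm. \<forall>i<n. (\<lambda>j. xi * X i j - lincomb_rows (A i) X n j - input_row m (\<lambda>l. [:Bm i l:]) j) \<in> Ann \<and>
     (n1 \<le> i \<longrightarrow> (\<forall>j<n1. A i j = 0) \<and> (\<forall>l<m. Bm i l = 0))"
proof -
  define r where "r i = (\<lambda>j. xi * X i j)" for i
  have "\<forall>i. \<exists>c. (\<lambda>j. r i j - lincomb_rows c X n j - input_row m (\<lambda>l. T (r i) l div \<delta>) j) \<in> Ann \<and>
    (r i \<in> Tors \<longrightarrow> (\<forall>i<n1. c i = 0))" using decomp by blast
  from choice[OF this] obtain A where
    A: "\<And>i. (\<lambda>j. r i j - lincomb_rows (A i) X n j - input_row m (\<lambda>l. T (r i) l div \<delta>) j) \<in> Ann"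
      "\<And>i j. r i \<in> Tors \<Longrightarrow> j < n1 \<Longrightarrow> A i j = 0" by blast
  define Bm where "Bm i l = coeff (T (r i) l) (degree \<delta>) / lead_coeff \<delta>" for i l
  have Tr: "T (r i) l = xi * T (X i) l" for i l unfolding r_def by (rule T_mult)
  have const: "T (r i) l div \<delta> = [:Bm i l:]" if i: "i < n" and l: "l < m" for i l
    unfolding Bm_def
  proof (rule div_delta_const)
    have "coeff (T (X i) l) d = 0" if "d \<ge> degree \<delta>" for d
      using X_Strict[OF i] l that unfolding Strict_def by blast
    then show "degree (T (r i) l) \<le> degree \<delta>"
      unfolding Tr by (intro degree_le) (auto simp: xi_mult coeff_pCons split: nat.split)
  qed
  show ?thesis
  proof (rule exI[of _ A], rule exI[of _ Bm], intro allI impI conjI)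
    fix i assume i: "i < n"
    have "input_row m (\<lambda>l. T (r i) l div \<delta>) = input_row m (\<lambda>l. [:Bm i l:])"
      using const[OF i] by (auto simp: input_row_def)
    then show "(\<lambda>j. xi * X i j - lincomb_rows (A i) X n j - input_row m (\<lambda>l. [:Bm i l:]) j) \<in> Ann"
      using A(1)[of i] by (simp add: r_def)
    assume "n1 \<le> i"
    then have "r i \<in> Tors" unfolding r_def by (intro Tors_mult X_Tors i)
    then show "\<And>j. j < n1 \<Longrightarrow> A i j = 0" "\<And>l. Bm i l = 0" using A(2) T_Tors by (simp_all add: Bm_def)
  qed
qed

lemma output_equations:
  "\<exists>C. \<forall>i<P. (\<lambda>j. (if j = m + i then 1 else 0) - lincomb_rows (C i) X n j -
      input_row m (\<lambda>l. [:coeff (\<Sum>j<m. M (m + i) j * Nt j l) (degree \<delta>) / lead_coeff \<delta>:]) j) \<in> Ann"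
proof -
  define r where "r i = (\<lambda>j. if j = m + i then 1 else 0 :: real poly)" for i
  have "\<forall>i. \<exists>c. (\<lambda>j. r i j - lincomb_rows c X n j - input_row m (\<lambda>l. T (r i) l div \<delta>) j) \<in> Ann"
    using decomp by blast
  from choice[OF this] obtain C where
    C: "\<And>i. (\<lambda>j. r i j - lincomb_rows (C i) X n j - input_row m (\<lambda>l. T (r i) l div \<delta>) j) \<in> Ann" by blast
  have Tr: "T (r i) l = (\<Sum>j<m. M (m + i) j * Nt j l)" if "i < P" "l < m" for i l
  proof -
    have "T (r i) l = (\<Sum>i'<P. r i (m + i') * (\<Sum>j<m. M (m + i') j * Nt j l))"
      unfolding T_split[OF \<open>l < m\<close>] using \<open>l < m\<close> by (simp add: r_def)
    also have "\<dots> = (\<Sum>i'<P. if i' = i then (\<Sum>j<m. M (m + i') j * Nt j l) else 0)"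
      by (rule sum.cong) (auto simp: r_def)
    finally have "T (r i) l = (\<Sum>i'<P. if i' = i then (\<Sum>j<m. M (m + i') j * Nt j l) else 0)" .
    then show ?thesis using that by simp
  qed
  show ?thesis
  proof (intro exI[of _ C] allI impI)
    fix i assume i: "i < P"
    have "input_row m (\<lambda>l. T (r i) l div \<delta>) =
        input_row m (\<lambda>l. [:coeff (\<Sum>j<m. M (m + i) j * Nt j l) (degree \<delta>) / lead_coeff \<delta>:])"
      using div_delta_const[OF proper_degree[OF i]] Tr[OF i] by (auto simp: input_row_def)
    then show "(\<lambda>j. (if j = m + i then 1 else 0) - lincomb_rows (C i) X n j -
      input_row m (\<lambda>l. [:coeff (\<Sum>j<m. M (m + i) j * Nt j l) (degree \<delta>) / lead_coeff \<delta>:]) j) \<in> Ann"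
      using C[of i] by (simp add: r_def)
  qed
qed

end

locale state_space = state_basis +
  fixes A Bm C D :: "nat \<Rightarrow> nat \<Rightarrow> real"
  assumes state_eq: "\<And>i. i < n \<Longrightarrow>
      (\<lambda>j. xi * X i j - lincomb_rows (A i) X n j - input_row m (\<lambda>l. [:Bm i l:]) j) \<in> Ann"
    and A_low: "\<And>i j. n1 \<le> i \<Longrightarrow> i < n \<Longrightarrow> j < n1 \<Longrightarrow> A i j = 0"
    and B_low: "\<And>i l. n1 \<le> i \<Longrightarrow> i < n \<Longrightarrow> l < m \<Longrightarrow> Bm i l = 0"
    and output_eq: "\<And>i. i < P \<Longrightarrow>
      (\<lambda>j. (if j = m + i then 1 else 0) - lincomb_rows (C i) X n j - input_row m (\<lambda>l. [:D i l:]) j) \<in> Ann"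
begin

definition solution :: "(nat \<Rightarrow> real \<Rightarrow> real) \<Rightarrow> (nat \<Rightarrow> real \<Rightarrow> real) \<Rightarrow> bool" where
  "solution w x \<longleftrightarrow> (\<forall>j<m + P. smooth (w j)) \<and> (\<forall>i<n. smooth (x i)) \<and>
    (\<forall>i<n. \<forall>t. deriv (x i) t = (\<Sum>j<n. A i j * x j t) + (\<Sum>l<m. Bm i l * w l t)) \<and>
    (\<forall>i<P. \<forall>t. w (m + i) t = (\<Sum>j<n. C i j * x j t) + (\<Sum>l<m. D i l * w l t))"

lemma state_map_solution:
  assumes w: "w \<in> B"
  shows "solution w (\<lambda>i. rowop (m + P) (X i) w)"
  unfolding solution_def
proof (intro conjI allI impI)
  show "smooth (w j)" if "j < m + P" for j using B_smooth[OF w that] .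
  then show "smooth (rowop (m + P) (X i) w)" for i by (rule smooth_rowop)
  have smooth: "\<And>j. j < m + P \<Longrightarrow> smooth (w j)" using B_smooth[OF w] .
  have rowX: "rowop (m + P) (\<lambda>j. xi * X i j - lincomb_rows (A i) X n j - input_row m (\<lambda>l. [:Bm i l:]) j) w t = 0"
    if "i < n" for i t using state_eq[OF that] w unfolding Ann_def by blast
  show "deriv (rowop (m + P) (X i) w) t = (\<Sum>j<n. A i j * rowop (m + P) (X j) w t) + (\<Sum>l<m. Bm i l * w l t)"
    if "i < n" for i t
  proof -
    have "deriv (rowop (m + P) (X i) w) t = rowop (m + P) (\<lambda>j. xi * X i j) w t"
      by (rule deriv_rowop[OF smooth])
    then show ?thesis
      using rowX[OF that, of t] unfolding rowop_diff rowop_lincomb rowop_input_row by simp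
  qed
  have out: "rowop (m + P) (\<lambda>j. (if j = m + i then 1 else 0) - lincomb_rows (C i) X n j - input_row m (\<lambda>l. [:D i l:]) j) w t = 0"
    if "i < P" for i t using output_eq[OF that] w unfolding Ann_def by blast
  show "w (m + i) t = (\<Sum>j<n. C i j * rowop (m + P) (X j) w t) + (\<Sum>l<m. D i l * w l t)"
    if "i < P" for i t
    using out[OF that, of t] rowop_unit[of "m + i" "m + P" 1 w t] that
    unfolding rowop_diff rowop_lincomb rowop_input_row by simp
qed

text \<open>Rows are reduced by induction from the state equations alone, which shows that a solution of these
  determines the values of all operators on it, and hence lies in \<open>B\<close>.\<close>

definition reduces_to :: "(nat \<Rightarrow> real poly) \<Rightarrow> (nat \<Rightarrow> real) \<Rightarrow> (nat \<Rightarrow> real poly) \<Rightarrow> bool" where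
  "reduces_to r c a \<longleftrightarrow> (\<lambda>j. r j - lincomb_rows c X n j - input_row m a j) \<in> Ann \<and>
    (\<forall>w x t. solution w x \<longrightarrow>
      rowop (m + P) r w t = (\<Sum>i<n. c i * x i t) + (\<Sum>l<m. diff_op (a l) (w l) t))"

definition normal_form :: "(nat \<Rightarrow> real poly) \<Rightarrow> bool" where
  "normal_form r \<longleftrightarrow> (\<exists>c a. reduces_to r c a)"

lemma reduces_toD:
  assumes "reduces_to r c a"
  shows "(\<lambda>j. r j - lincomb_rows c X n j - input_row m a j) \<in> Ann"
    and "solution w x \<Longrightarrow>
      rowop (m + P) r w t = (\<Sum>i<n. c i * x i t) + (\<Sum>l<m. diff_op (a l) (w l) t)"
  using assms unfolding reduces_to_def by blast+

lemma normal_formI: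
  assumes "(\<lambda>j. r j - lincomb_rows c X n j - input_row m a j) \<in> Ann"
    and "\<And>w x t. solution w x \<Longrightarrow>
      rowop (m + P) r w t = (\<Sum>i<n. c i * x i t) + (\<Sum>l<m. diff_op (a l) (w l) t)"
  shows "normal_form r"
  using assms unfolding normal_form_def reduces_to_def by blast

lemma normal_form_add_smult:
  assumes "normal_form r" "normal_form s"
  shows "normal_form (\<lambda>j. r j + Polynomial.smult e (s j))"
proof -
  obtain c a where "reduces_to r c a" using assms(1) unfolding normal_form_def by blast
  note r = reduces_toD[OF this]
  obtain d b where "reduces_to s d b" using assms(2) unfolding normal_form_def by blast
  note s = reduces_toD[OF this]
  define c' where "c' i = c i + e * d i" for i
  define a' where "a' l = a l + Polynomial.smult e (b l)" for l
  have "(\<lambda>j. (r j - lincomb_rows c X n j - input_row m a j)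
      + Polynomial.smult e (s j - lincomb_rows d X n j - input_row m b j)) \<in> Ann"
    by (rule row_subspaceD(2)[OF subspace_Ann r(1) s(1)])
  also have "(\<lambda>j. (r j - lincomb_rows c X n j - input_row m a j)
      + Polynomial.smult e (s j - lincomb_rows d X n j - input_row m b j)) =
      (\<lambda>j. r j + Polynomial.smult e (s j) - lincomb_rows c' X n j - input_row m a' j)"
    unfolding c'_def a'_def lincomb_rows_add lincomb_rows_smult input_row_def
    by (auto simp: fun_eq_iff smult_diff_right smult_add_right algebra_simps)
  finally have "(\<lambda>j. r j + Polynomial.smult e (s j) - lincomb_rows c' X n j - input_row m a' j) \<in> Ann" .
  moreover have "rowop (m + P) (\<lambda>j. r j + Polynomial.smult e (s j)) w t
      = (\<Sum>i<n. c' i * x i t) + (\<Sum>l<m. diff_op (a' l) (w l) t)" if "solution w x" for w x t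
    unfolding rowop_add rowop_smult r(2)[OF that] s(2)[OF that] c'_def a'_def
    by (simp add: diff_op_add diff_op_smult sum.distrib sum_distrib_left algebra_simps)
  ultimately show ?thesis by (rule normal_formI)
qed

lemma normal_form_shift:
  assumes "normal_form r"
  shows "normal_form (\<lambda>j. xi * r j)"
proof -
  obtain c a where "reduces_to r c a" using assms unfolding normal_form_def by blast
  note r = reduces_toD[OF this]
  define c' where "c' i' = (\<Sum>i<n. c i * A i i')" for i'
  define a' where "a' l = [:\<Sum>i<n. c i * Bm i l:] + xi * a l" for l
  define e where "e i = (\<lambda>j. xi * X i j - lincomb_rows (A i) X n j - input_row m (\<lambda>l. [:Bm i l:]) j)" for i
  have "(\<lambda>j. \<Sum>i<n. Polynomial.smult (c i) (e i j)) \<in> Ann"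
    by (intro Ann_sum row_subspaceD(5)[OF subspace_Ann]) (use state_eq in \<open>auto simp: e_def\<close>)
  from row_subspaceD(3)[OF subspace_Ann Ann_mult[OF r(1), of "xi"] this]
  have "(\<lambda>j. xi * (r j - lincomb_rows c X n j - input_row m a j) + (\<Sum>i<n. Polynomial.smult (c i) (e i j))) \<in> Ann" .
  also have "(\<lambda>j. xi * (r j - lincomb_rows c X n j - input_row m a j) + (\<Sum>i<n. Polynomial.smult (c i) (e i j)))
      = (\<lambda>j. xi * r j - lincomb_rows c' X n j - input_row m a' j)"
  proof
    fix j
    have "(\<Sum>i<n. Polynomial.smult (c i) (e i j)) = xi * lincomb_rows c X n j - lincomb_rows c' X n j
        - (\<Sum>i<n. Polynomial.smult (c i) (input_row m (\<lambda>l. [:Bm i l:]) j))"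
      unfolding e_def c'_def lincomb_rows_lincomb[symmetric]
      by (simp add: lincomb_rows_def[of c] smult_diff_right sum_subtractf sum_distrib_left)
    moreover have "input_row m a' j = (\<Sum>i<n. Polynomial.smult (c i) (input_row m (\<lambda>l. [:Bm i l:]) j)) + xi * input_row m a j"
      unfolding a'_def input_row_def by (simp add: sum_const_poly)
    ultimately show "xi * (r j - lincomb_rows c X n j - input_row m a j) + (\<Sum>i<n. Polynomial.smult (c i) (e i j))
        = xi * r j - lincomb_rows c' X n j - input_row m a' j"
      by (simp add: algebra_simps)
  qed
  finally have ann: "(\<lambda>j. xi * r j - lincomb_rows c' X n j - input_row m a' j) \<in> Ann" .
  have "rowop (m + P) (\<lambda>j. xi * r j) w t = (\<Sum>i<n. c' i * x i t) + (\<Sum>l<m. diff_op (a' l) (w l) t)"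
    if sol: "solution w x" for w x t
  proof -
    have sw: "\<And>j. j < m + P \<Longrightarrow> smooth (w j)" and sx: "\<And>i. i < n \<Longrightarrow> smooth (x i)"
      and dx: "\<And>i t. i < n \<Longrightarrow> deriv (x i) t = (\<Sum>j<n. A i j * x j t) + (\<Sum>l<m. Bm i l * w l t)"
      using sol unfolding solution_def by auto
    have eq: "rowop (m + P) r w = (\<lambda>t. (\<Sum>i<n. c i * x i t) + (\<Sum>l<m. diff_op (a l) (w l) t))"
      using r(2)[OF sol] by auto
    have "((\<lambda>t. (\<Sum>i<n. c i * x i t) + (\<Sum>l<m. diff_op (a l) (w l) t)) has_real_derivative
        (\<Sum>i<n. c i * deriv (x i) t) + (\<Sum>l<m. deriv (diff_op (a l) (w l)) t)) (at t)"
      using smooth_has_derivative[OF sx, of _ 0] smooth_has_derivative[OF smooth_diff_op[OF sw], of _ 0]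
      by (intro DERIV_add DERIV_sum DERIV_cmult) auto
    from DERIV_imp_deriv[OF this]
    have "rowop (m + P) (\<lambda>j. xi * r j) w t =
        (\<Sum>i<n. c i * deriv (x i) t) + (\<Sum>l<m. deriv (diff_op (a l) (w l)) t)"
      using deriv_rowop[where f = w and N = "m + P" and r = r and t = t, OF sw] unfolding eq by simp
    also have "(\<Sum>i<n. c i * deriv (x i) t) = (\<Sum>i<n. c i * (\<Sum>j<n. A i j * x j t)) + (\<Sum>i<n. c i * (\<Sum>l<m. Bm i l * w l t))"
      by (simp add: dx distrib_left sum.distrib)
    also have "(\<Sum>i<n. c i * (\<Sum>j<n. A i j * x j t)) = (\<Sum>i<n. c' i * x i t)"
      unfolding c'_def sum_distrib_left sum_distrib_right by (subst sum.swap) (simp add: mult.assoc)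
    also have "(\<Sum>i<n. c i * (\<Sum>l<m. Bm i l * w l t)) = (\<Sum>l<m. (\<Sum>i<n. c i * Bm i l) * w l t)"
      unfolding sum_distrib_left sum_distrib_right by (subst sum.swap) (simp add: mult.assoc)
    also have "(\<Sum>l<m. deriv (diff_op (a l) (w l)) t) = (\<Sum>l<m. diff_op (xi * a l) (w l) t)"
      by (rule sum.cong[OF refl], rule deriv_diff_op_eq) (use sw in auto)
    finally show ?thesis unfolding a'_def by (simp only: diff_op_add diff_op_const sum.distrib add.assoc)
  qed
  with ann show ?thesis by (rule normal_formI)
qed

lemma normal_form_zero: "normal_form (\<lambda>_. 0)"
  by (rule normal_formI[of _ "\<lambda>_. 0" "\<lambda>_. 0"]) (auto intro: Ann_outside simp: input_row_def)

lemma normal_form_unit: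
  assumes "j0 < m + P"
  shows "normal_form (\<lambda>j. if j = j0 then 1 else 0)"
proof (cases "j0 < m")
  case True
  have "(\<lambda>j. (if j = j0 then 1 else 0) - lincomb_rows (\<lambda>_. 0) X n j - input_row m (\<lambda>l. if l = j0 then 1 else 0) j) \<in> Ann"
    by (rule Ann_outside) (use True in \<open>auto simp: input_row_def\<close>)
  moreover have "rowop (m + P) (\<lambda>j. if j = j0 then 1 else 0) w t
      = (\<Sum>i<n. 0 * x i t) + (\<Sum>l<m. diff_op (if l = j0 then 1 else 0) (w l) t)" for w x t
  proof -
    have "(\<Sum>l<m. diff_op (if l = j0 then 1 else 0) (w l) t) = (\<Sum>l<m. if l = j0 then w l t else 0)"
      by (rule sum.cong) auto
    then show ?thesis using rowop_unit[OF assms, of 1 w t] True by simp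
  qed
  then show ?thesis by (rule normal_formI[OF calculation])
next
  case False
  define i where "i = j0 - m"
  have i: "i < P" "j0 = m + i" using False assms by (auto simp: i_def)
  have "rowop (m + P) (\<lambda>j. if j = m + i then 1 else 0) w t
      = (\<Sum>j<n. C i j * x j t) + (\<Sum>l<m. diff_op [:D i l:] (w l) t)" if "solution w x" for w x t
    using that i unfolding solution_def by (simp add: rowop_unit)
  with output_eq[OF i(1)] show ?thesis unfolding i(2) by (rule normal_formI)
qed

lemma normal_form_cong:
  assumes "normal_form r" "\<And>j. j < m + P \<Longrightarrow> r j = s j"
  shows "normal_form s"
proof -
  obtain c a where "reduces_to r c a" using assms(1) unfolding normal_form_def by blast
  note r = reduces_toD[OF this]
  have "(\<lambda>j. s j - lincomb_rows c X n j - input_row m a j) \<in> Ann"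
    by (rule Ann_cong[OF r(1)]) (use assms(2) in simp)
  moreover have "rowop (m + P) s = rowop (m + P) r" using assms(2) by (intro ext) (simp add: rowop_def)
  ultimately show ?thesis using r(2) by (intro normal_formI[of s c a]) simp_all
qed

lemma normal_form_all: "normal_form r"
proof -
  have unit: "normal_form (\<lambda>j. if j = j0 then p else 0)" if j0: "j0 < m + P" for j0 p
  proof (induction p)
    case 0
    then show ?case using normal_form_zero by (rule normal_form_cong) auto
  next
    case (pCons c p)
    have "normal_form (\<lambda>j. xi * (if j = j0 then p else 0) + Polynomial.smult c (if j = j0 then 1 else 0))"
      by (rule normal_form_add_smult[OF normal_form_shift[OF pCons.IH] normal_form_unit[OF j0]])
    then show ?case by (rule normal_form_cong) (auto simp: xi_mult)
  qed
  have "normal_form (\<lambda>j. if j < N then r j else 0)" if "N \<le> m + P" for N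
    using that
  proof (induction N)
    case 0
    then show ?case using normal_form_zero by simp
  next
    case (Suc N)
    then have "normal_form (\<lambda>j. (if j < N then r j else 0) + Polynomial.smult 1 (if j = N then r N else 0))"
      by (intro normal_form_add_smult unit) auto
    then show ?case by (rule normal_form_cong) (auto simp: less_Suc_eq)
  qed
  from this[OF le_refl] show ?thesis by (rule normal_form_cong) auto
qed


text \<open>On solutions every row takes its normal form, whose coefficients
  \<open>unique_Ann\<close> determines: all zero for a row of \<open>R\<close>, a unit vector for
  \<open>X i\<close>. Hence solutions satisfy the equations of \<open>B\<close>, and their states
  are values of the state map, so the state is observable.\<close>

lemma solution_iff: "solution w x \<longleftrightarrow> w \<in> B \<and> (\<forall>i<n. x i = rowop (m + P) (X i) w)"
proof
  assume sol: "solution w x"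
  have "rowop (m + P) (R l) w t = 0" if l: "l < k" for l t
  proof -
    obtain c a where "reduces_to (R l) c a" using normal_form_all[of "R l"] unfolding normal_form_def by blast
    note ann = reduces_toD(1)[OF this] and eq = reduces_toD(2)[OF this sol]
    have "(\<lambda>j. R l j - (R l j - lincomb_rows c X n j - input_row m a j)) \<in> Ann"
      by (rule row_subspaceD(4)[OF subspace_Ann R_in_Ann[OF l] ann])
    then have "(\<lambda>j. lincomb_rows c X n j + input_row m a j) \<in> Ann" by simp
    from unique_Ann[OF this] show ?thesis unfolding eq by simp
  qed
  moreover have "\<forall>j<m + P. smooth (w j)" using sol unfolding solution_def by blast
  ultimately have "w \<in> B" by (subst B_def) simp
  moreover have "x i t = rowop (m + P) (X i) w t" if i: "i < n" for i t
  proof -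
    obtain c a where "reduces_to (X i) c a" using normal_form_all[of "X i"] unfolding normal_form_def by blast
    note ann = reduces_toD(1)[OF this] and eq = reduces_toD(2)[OF this sol]
    define u where "u i' = (if i' = i then 1 else 0 :: real)" for i'
    have "lincomb_rows (\<lambda>i'. u i' + (-1) * c i') X n j + input_row m (\<lambda>l. - a l) j
        = X i j - lincomb_rows c X n j - input_row m a j" for j
      unfolding lincomb_rows_add lincomb_rows_smult unfolding u_def lincomb_rows_unit[OF i]
      by (simp add: input_row_def)
    then have "(\<lambda>j. lincomb_rows (\<lambda>i'. u i' + (-1) * c i') X n j + input_row m (\<lambda>l. - a l) j) \<in> Ann"
      using ann by simp
    from unique_Ann[OF this] have "\<And>i'. i' < n \<Longrightarrow> c i' = u i'" "\<And>l. l < m \<Longrightarrow> a l = 0" by auto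
    then have "rowop (m + P) (X i) w t = (\<Sum>i'<n. u i' * x i' t)" unfolding eq by simp
    also have "\<dots> = (\<Sum>i'<n. if i' = i then x i' t else 0)"
      by (rule sum.cong) (auto simp: u_def)
    finally show ?thesis using i by simp
  qed
  ultimately show "w \<in> B \<and> (\<forall>i<n. x i = rowop (m + P) (X i) w)" by auto
next
  assume *: "w \<in> B \<and> (\<forall>i<n. x i = rowop (m + P) (X i) w)"
  then have "solution w (\<lambda>i. rowop (m + P) (X i) w)" using state_map_solution by blast
  then show "solution w x" using * unfolding solution_def by simp
qed

end

section \<open>Controllability and the uncontrollable modes\<close>

definition cev :: "real poly \<Rightarrow> complex \<Rightarrow> complex" where
  "cev p s = poly (map_poly of_real p) s"

lemma cev_0 [simp]: "cev 0 s = 0" by (simp add: cev_def)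

lemma cev_pCons [simp]: "cev (pCons a p) s = of_real a + s * cev p s"
  by (simp add: cev_def map_poly_pCons)

lemma cev_add: "cev (p + q) s = cev p s + cev q s"
  by (induction p q rule: poly_induct2) (auto simp: algebra_simps)

lemma cev_smult: "cev (Polynomial.smult c p) s = of_real c * cev p s"
  by (induction p) (auto simp: algebra_simps)

lemma cev_mult: "cev (p * q) s = cev p s * cev q s"
  by (induction p) (auto simp: algebra_simps cev_add cev_smult)

lemma cev_diff: "cev (p - q) s = cev p s - cev q s"
  using cev_add[of "p - q" q s] by simp

lemma cev_sum: "cev (\<Sum>x\<in>X. f x) s = (\<Sum>x\<in>X. cev (f x) s)"
  by (induction X rule: infinite_finite_induct) (auto simp: cev_add)

lemma cev_of_real: "cev p (of_real x) = of_real (poly p x)"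
  by (induction p) auto

lemma cev_pcompose_neg: "cev (pcompose p [:0, -1:]) s = cev p (- s)"
  by (induction p) (simp_all add: pcompose_pCons cev_add cev_mult del: mult_pCons_left)

lemma cev_root_exists:
  assumes "p \<noteq> 0" "\<not> is_unit p"
  shows "\<exists>s. cev p s = 0"
proof -
  have "degree (map_poly complex_of_real p) = degree p" by (rule degree_map_poly) simp
  then have "\<not> constant (poly (map_poly complex_of_real p))"
    using assms by (simp add: constant_degree is_unit_iff_degree)
  then show ?thesis unfolding cev_def by (rule fundamental_theorem_of_algebra)
qed

text \<open>At a non-real \<open>s\<close> every complex number is the value of a real polynomial of
  degree at most 1; at a real \<open>s\<close> the real parts of the coefficients suffice.\<close>

lemma real_combination_at:
  assumes "\<And>j. j < N \<Longrightarrow> cev (r j) s = (\<Sum>l<k. c l * cev (R l j) s)"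
  shows "\<exists>g. \<forall>j<N. cev (r j - (\<Sum>l<k. g l * R l j)) s = 0"
proof (cases "Im s = 0")
  case True
  then obtain x where x: "s = of_real x" by (metis complex_is_Real_iff Reals_cases)
  have "cev (r j - (\<Sum>l<k. [:Re (c l):] * R l j)) s = 0" if "j < N" for j
  proof -
    have "poly (r j) x = Re (\<Sum>l<k. c l * cev (R l j) s)"
      using assms[OF that] unfolding x cev_of_real by (metis Re_complex_of_real)
    also have "\<dots> = (\<Sum>l<k. Re (c l) * poly (R l j) x)" by (simp add: x cev_of_real)
    finally show ?thesis unfolding x cev_of_real by (simp add: poly_sum)
  qed
  then show ?thesis by (intro exI[of _ "\<lambda>l. [:Re (c l):]"]) simp
next
  case False
  define g where "g l = [:Re (c l) - Im (c l) / Im s * Re s, Im (c l) / Im s:]" for l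
  have g: "cev (g l) s = c l" for l
    using False unfolding g_def by (simp add: complex_eq_iff)
  have "cev (r j - (\<Sum>l<k. g l * R l j)) s = 0" if "j < N" for j
    using assms[OF that] by (simp add: cev_diff cev_sum cev_mult g)
  then show ?thesis by (intro exI[of _ g]) simp
qed

text \<open>Turns vanishing at a complex point into divisibility over the reals.\<close>

lemma real_minimal_poly:
  assumes "p \<noteq> 0" "cev p s = 0"
  obtains q where "q \<noteq> 0" "cev q s = 0" "\<And>f. cev f s = 0 \<Longrightarrow> q dvd f"
proof -
  define Pr where "Pr q \<longleftrightarrow> q \<noteq> 0 \<and> cev q s = 0" for q
  have "Pr p" using assms by (simp add: Pr_def)
  then obtain q where q: "Pr q" "\<And>f. Pr f \<Longrightarrow> degree q \<le> degree f"
    using ex_has_least_nat[of Pr p degree] by blast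
  show ?thesis
  proof (rule that[of q])
    show "q \<noteq> 0" "cev q s = 0" using q(1) by (auto simp: Pr_def)
    fix f assume "cev f s = 0"
    moreover have "f = f div q * q + f mod q" by simp
    ultimately have "cev (f mod q) s = 0"
      using \<open>cev q s = 0\<close> by (metis add.left_neutral cev_add cev_mult mult_zero_right)
    show "q dvd f"
    proof (rule ccontr)
      assume "\<not> q dvd f"
      then have "f mod q \<noteq> 0" by (simp add: mod_eq_0_iff_dvd)
      then have "degree q \<le> degree (f mod q)" using q(2) \<open>cev (f mod q) s = 0\<close> by (simp add: Pr_def)
      moreover have "degree (f mod q) < degree q"
        using degree_mod_less[OF \<open>q \<noteq> 0\<close>, of f] \<open>f mod q \<noteq> 0\<close> by blast
      ultimately show False by simp
    qed
  qed
qed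

context state_space
begin

lemma lincomb_Tors: "(\<And>i. i < n1 \<Longrightarrow> c i = 0) \<Longrightarrow> lincomb_rows c X n \<in> Tors"
proof -
  assume c: "\<And>i. i < n1 \<Longrightarrow> c i = 0"
  define X' where "X' i = (if i < n1 then (\<lambda>_. 0) else X i)" for i
  have "lincomb_rows c X' n \<in> Tors"
    by (rule row_subspace_lincomb[OF subspace_Tors])
      (auto simp: X'_def X_Tors row_subspaceD(1)[OF subspace_Tors])
  moreover have "lincomb_rows c X' n = lincomb_rows c X n"
    unfolding lincomb_rows_def by (intro ext sum.cong) (auto simp: X'_def c)
  ultimately show ?thesis by simp
qed

lemma shift_mod_Ann:
  "(\<lambda>j. xi * lincomb_rows c X n j - lincomb_rows (\<lambda>i'. \<Sum>i<n. c i * A i i') X n j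
    - input_row m (\<lambda>l. [:\<Sum>i<n. c i * Bm i l:]) j) \<in> Ann"
proof -
  define e where "e i = (\<lambda>j. xi * X i j - lincomb_rows (A i) X n j - input_row m (\<lambda>l. [:Bm i l:]) j)" for i
  have "(\<lambda>j. \<Sum>i<n. Polynomial.smult (c i) (e i j)) \<in> Ann"
    by (intro Ann_sum row_subspaceD(5)[OF subspace_Ann]) (use state_eq in \<open>auto simp: e_def\<close>)
  also have "(\<lambda>j. \<Sum>i<n. Polynomial.smult (c i) (e i j)) =
      (\<lambda>j. xi * lincomb_rows c X n j - lincomb_rows (\<lambda>i'. \<Sum>i<n. c i * A i i') X n j
        - input_row m (\<lambda>l. [:\<Sum>i<n. c i * Bm i l:]) j)"
  proof
    fix j
    have "(\<Sum>i<n. Polynomial.smult (c i) (input_row m (\<lambda>l. [:Bm i l:]) j)) = input_row m (\<lambda>l. [:\<Sum>i<n. c i * Bm i l:]) j"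
      unfolding input_row_def by (simp add: sum_const_poly)
    then show "(\<Sum>i<n. Polynomial.smult (c i) (e i j)) =
      xi * lincomb_rows c X n j - lincomb_rows (\<lambda>i'. \<Sum>i<n. c i * A i i') X n j
        - input_row m (\<lambda>l. [:\<Sum>i<n. c i * Bm i l:]) j"
      unfolding e_def lincomb_rows_lincomb[symmetric]
      by (simp add: lincomb_rows_def[of c] smult_diff_right sum_subtractf sum_distrib_left)
  qed
  finally show ?thesis .
qed

text \<open>An uncontrollable direction would be a strictly proper transfer function all of whose
  products with powers of \<open>\<xi>\<close> are strictly proper too.\<close>

lemma controllable_part:
  fixes y :: rcmat
  assumes y: "\<And>k. y * block {..<n1} {..<n1} A ^ k * block {..<n1} {..<m} Bm = 0"
  shows "y * proj {..<n1} = 0"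
proof -
  define A1 where "A1 = block {..<n1} {..<n1} A"
  have "ent y i j = 0" if j: "j < n1" for i j
  proof -
    define \<alpha> where "\<alpha> k j = (if j < n1 then ent (y * A1 ^ k) i j else 0)" for k j
    define r where "r k = lincomb_rows (\<alpha> k) X n" for k
    have split: "(\<Sum>l<n. \<alpha> k l * f l) = (\<Sum>l<n1. ent (y * A1 ^ k) i l * f l)" for k f
      by (rule sum.mono_neutral_cong_right) (use n1_le_n in \<open>auto simp: \<alpha>_def\<close>)
    have \<alpha>Suc: "(\<Sum>l<n. \<alpha> k l * A l j) = \<alpha> (Suc k) j" if "j < n1" for k j
    proof -
      have "ent (y * A1 ^ k * A1) i j = (\<Sum>l<n1. ent (y * A1 ^ k) i l * ent A1 l j)"
        by (rule ent_times) (auto simp: A1_def ent_block)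
      also have "\<dots> = (\<Sum>l<n1. ent (y * A1 ^ k) i l * A l j)"
        by (rule sum.cong) (use that in \<open>auto simp: A1_def ent_block\<close>)
      finally show ?thesis unfolding split using that
        by (simp add: \<alpha>_def power_Suc2 mult.assoc del: power_Suc)
    qed
    have B0: "(\<Sum>l<n. \<alpha> k l * Bm l t) = 0" if "t < m" for k t
    proof -
      have "ent (y * A1 ^ k * block {..<n1} {..<m} Bm) i t
          = (\<Sum>l<n1. ent (y * A1 ^ k) i l * ent (block {..<n1} {..<m} Bm) l t)"
        by (rule ent_times) (auto simp: ent_block)
      also have "\<dots> = (\<Sum>l<n1. ent (y * A1 ^ k) i l * Bm l t)"
        by (rule sum.cong) (use that in \<open>auto simp: ent_block\<close>)
      finally show ?thesis unfolding split using y[of k] by (simp add: A1_def)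
    qed
    \<comment> \<open>The shift also produces coefficients at the torsion rows of \<open>X\<close>;
      they do not contribute to \<open>T\<close>.\<close>
    have step: "T (r (Suc k)) l = xi * T (r k) l" for k l
    proof -
      have inp: "input_row m (\<lambda>l. [:\<Sum>i<n. \<alpha> k i * Bm i l:]) j = 0" for j
        using B0 by (simp add: input_row_def)
      have 1: "(\<lambda>j. xi * r k j - lincomb_rows (\<lambda>i'. \<Sum>i<n. \<alpha> k i * A i i') X n j) \<in> Tors"
        using shift_mod_Ann[of "\<alpha> k"] Ann_sub_Tors unfolding inp r_def by auto
      have 2: "lincomb_rows (\<lambda>i'. (\<Sum>i<n. \<alpha> k i * A i i') + (-1) * \<alpha> (Suc k) i') X n \<in> Tors"
        by (rule lincomb_Tors) (simp add: \<alpha>Suc)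
      from row_subspaceD(3)[OF subspace_Tors 1 2]
      have "(\<lambda>j. xi * r k j - r (Suc k) j) \<in> Tors"
        unfolding lincomb_rows_add lincomb_rows_smult r_def by simp
      from T_Tors[OF this, of l] show ?thesis by (simp add: T_diff T_mult)
    qed
    have rS: "r k \<in> Strict" for k
      unfolding r_def by (rule row_subspace_lincomb[OF subspace_Strict X_Strict])
    have Tk: "T (r k) l = monom 1 k * T (r 0) l" for k l
      by (induction k) (simp_all add: step xi_mult monom_Suc)
    \<comment> \<open>Multiplication by this power of the indeterminate shifts all coefficients of
      \<open>T (r 0) l\<close> into the range where a strictly proper row has none.\<close>
    have "T (r 0) l = 0" if l: "l < m" for l
    proof (rule poly_eqI)
      fix d
      have "coeff (T (r (degree \<delta>)) l) (d + degree \<delta>) = 0" using rS l unfolding Strict_def by auto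
      then show "coeff (T (r 0) l) d = coeff 0 d"
        by (simp add: Tk[of "degree \<delta>"] coeff_monom_mult)
    qed
    then have "r 0 \<in> Tors" by (rule Tors_if_T)
    then have "\<forall>i<n1. \<alpha> 0 i = 0" unfolding r_def by (rule X_ind_Tors)
    then show ?thesis using j by (simp add: \<alpha>_def)
  qed
  then show ?thesis by (intro rcmat_eqI) (simp add: ent_mult_proj)
qed

definition A2 :: rcmat where "A2 = block {n1..<n} {n1..<n} A"

abbreviation e2 :: rcmat where "e2 \<equiv> proj {n1..<n}"

lemma A2_corner: "e2 * A2 = A2" "A2 * e2 = A2"
  unfolding A2_def by (simp_all add: proj_block block_proj)

lemma peval_A2_corner: "peval p A2 * e2 = e2 * peval p A2"
  by (rule peval_intertwine) (simp add: A2_corner)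

text \<open>\<open>A2\<close> represents multiplication by the indeterminate on \<open>Tors\<close>
  modulo \<open>Ann\<close>, in the basis of the rows \<open>X i\<close> with
  \<open>n1 \<le> i\<close>.\<close>

lemma peval_A2_row:
  assumes i: "n1 \<le> i" "i < n"
  shows "(\<lambda>j. p * X i j - lincomb_rows (ent (peval p A2 * e2) i) X n j) \<in> Ann"
proof (induction p)
  case 0
  show ?case using row_subspaceD(1)[OF subspace_Ann] by (simp add: lincomb_rows_def)
next
  case (pCons c p)
  define q where "q = ent (peval p A2 * e2) i"
  have q0: "q l = 0" if "\<not> (n1 \<le> l \<and> l < n)" for l using that by (auto simp: q_def ent_mult_proj)
  have inp: "input_row m (\<lambda>l. [:\<Sum>i<n. q i * Bm i l:]) j = 0" for j
    unfolding input_row_def using B_low q0 by (auto intro!: sum.neutral) (metis not_le)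
  have qA: "ent (peval p A2 * e2 * A2) i j = (\<Sum>l<n. q l * A l j)" if j: "j < n" for j
  proof -
    have "ent (peval p A2 * e2 * A2) i j = (\<Sum>l<n. q l * ent A2 l j)"
      unfolding q_def by (rule ent_times) (auto simp: ent_mult_proj)
    also have "\<dots> = (\<Sum>l<n. q l * A l j)"
    proof (rule sum.cong[OF refl])
      fix l assume "l \<in> {..<n}"
      then show "q l * ent A2 l j = q l * A l j"
        using q0[of l] A_low[of l j] j unfolding A2_def by (cases "n1 \<le> l") (auto simp: ent_block)
    qed
    finally show ?thesis .
  qed
  have "peval (pCons c p) A2 * e2 = c *\<^sub>R e2 + peval p A2 * e2 * A2"
  proof -
    have "peval p A2 * A2 = A2 * peval p A2" by (rule peval_intertwine) simp
    then have "A2 * peval p A2 * e2 = peval p A2 * (e2 * A2)" using A2_corner by (metis mult.assoc)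
    then show ?thesis by (simp add: algebra_simps)
  qed
  then have ent: "ent (peval (pCons c p) A2 * e2) i j = c * (if j = i then 1 else 0) + (\<Sum>l<n. q l * A l j)"
    if "j < n" for j using i that by (auto simp: qA ent_proj)
  have lin: "lincomb_rows (ent (peval (pCons c p) A2 * e2) i) X n j =
      Polynomial.smult c (X i j) + lincomb_rows (\<lambda>i'. \<Sum>l<n. q l * A l i') X n j" for j
  proof -
    have "lincomb_rows (ent (peval (pCons c p) A2 * e2) i) X n =
        lincomb_rows (\<lambda>j. c * (if j = i then 1 else 0) + (\<Sum>l<n. q l * A l j)) X n"
      by (rule lincomb_rows_cong) (use ent in auto)
    then show ?thesis by (simp only: lincomb_rows_add lincomb_rows_smult lincomb_rows_unit[OF i(2)])
  qed
  have "(\<lambda>j. xi * (p * X i j - lincomb_rows q X n j)) \<in> Ann"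
    using pCons.IH Ann_mult unfolding q_def by blast
  from row_subspaceD(3)[OF subspace_Ann this shift_mod_Ann[of q]]
  show ?case unfolding lin inp by (simp add: algebra_simps xi_mult)
qed

lemma annihilates_A2_iff: "peval p A2 * e2 = 0 \<longleftrightarrow> (\<forall>r\<in>Tors. (\<lambda>j. p * r j) \<in> Ann)"
proof
  assume p: "peval p A2 * e2 = 0"
  show "\<forall>r\<in>Tors. (\<lambda>j. p * r j) \<in> Ann"
  proof
    fix r assume "r \<in> Tors"
    then obtain c where c: "\<forall>i<n1. c i = 0" "(\<lambda>j. r j - lincomb_rows c X n j) \<in> Ann" using X_span_Tors by blast
    have "(\<lambda>j. p * X i j) \<in> Ann" if "n1 \<le> i" "i < n" for i
      using peval_A2_row[OF that, of p] p by (simp add: lincomb_rows_def)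
    then have "(\<lambda>j. \<Sum>i\<in>{n1..<n}. Polynomial.smult (c i) (p * X i j)) \<in> Ann"
      by (intro Ann_sum row_subspaceD(5)[OF subspace_Ann]) auto
    moreover have "(\<Sum>i\<in>{n1..<n}. Polynomial.smult (c i) (p * X i j)) = p * lincomb_rows c X n j" for j
    proof -
      have "(\<Sum>i\<in>{n1..<n}. Polynomial.smult (c i) (p * X i j)) = (\<Sum>i<n. Polynomial.smult (c i) (p * X i j))"
        by (rule sum.mono_neutral_left) (use c(1) in auto)
      then show ?thesis by (simp add: lincomb_rows_def sum_distrib_left)
    qed
    ultimately have "(\<lambda>j. p * lincomb_rows c X n j) \<in> Ann" by simp
    from row_subspaceD(3)[OF subspace_Ann Ann_mult[OF c(2), of p] this]
    show "(\<lambda>j. p * r j) \<in> Ann" by (simp add: algebra_simps)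
  qed
next
  assume p: "\<forall>r\<in>Tors. (\<lambda>j. p * r j) \<in> Ann"
  show "peval p A2 * e2 = 0"
  proof (rule rcmat_eqI)
    fix i i'
    show "ent (peval p A2 * e2) i i' = ent 0 i i'"
    proof (cases "n1 \<le> i \<and> i < n")
      case True
      then have "(\<lambda>j. p * X i j) \<in> Ann" using p X_Tors by blast
      from row_subspaceD(4)[OF subspace_Ann this peval_A2_row[of i p]] True
      have "lincomb_rows (ent (peval p A2 * e2) i) X n \<in> Ann" by simp
      from X_ind[OF this] show ?thesis by (cases "i' < n") (auto simp: ent_mult_proj)
    next
      case False
      then show ?thesis unfolding peval_A2_corner by (auto simp: ent_proj_mult)
    qed
  qed
qed

text \<open>All roots of an annihilator \<open>p\<close> of least degree lie in
  \<open>\<Lambda>\<close>. Suppose \<open>s\<close> is another root, \<open>q\<close> its real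
  minimal polynomial and \<open>p = q * p'\<close>. Exactness at \<open>s\<close> makes every
  torsion row divisible by \<open>q\<close> modulo the row module of \<open>R\<close>, with a
  torsion quotient, and so \<open>p'\<close> annihilates as well. A common root of \<open>p\<close>
  and its reflection would thus give \<open>s\<close> and \<open>- s\<close> in
  \<open>\<Lambda>\<close>.\<close>

lemma unmixed_annihilator: "\<exists>p. peval p A2 * e2 = 0 \<and> coprime p (pcompose p [:0, -1:])"
proof -
  define Pr where "Pr p \<longleftrightarrow> p \<noteq> 0 \<and> peval p A2 * e2 = 0" for p
  obtain a where "Pr a" using annihilating_poly_exists[of "{n1..<n}" A2] A2_corner by (auto simp: Pr_def)
  then obtain p where "Pr p" and min: "\<And>f. Pr f \<Longrightarrow> degree p \<le> degree f"
    using ex_has_least_nat[of Pr a degree] by blast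
  then have p: "p \<noteq> 0" "peval p A2 * e2 = 0" by (auto simp: Pr_def)
  have root: "s \<in> \<Lambda>" if s: "cev p s = 0" for s
  proof (rule ccontr)
    assume nl: "s \<notin> \<Lambda>"
    obtain q where q: "q \<noteq> 0" "cev q s = 0" "\<And>f. cev f s = 0 \<Longrightarrow> q dvd f"
      using real_minimal_poly[OF p(1) s] by blast
    obtain p' where p': "p = q * p'" using q(3)[OF s] by blast
    have "(\<lambda>j. p' * r j) \<in> Ann" if r: "r \<in> Tors" for r
    proof -
      \<comment> \<open>Outside \<open>\<Lambda>\<close> the kernel of \<open>R\<close> at
        \<open>s\<close> is the image of \<open>M\<close> at \<open>s\<close>, where torsion rows
        vanish; so the row \<open>r\<close> at \<open>s\<close> is a combination of the rows of
        \<open>R\<close> at \<open>s\<close>.\<close>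
      have "\<exists>c. \<forall>j\<in>{..<m + P}. cev (r j) s = (\<Sum>l<k. c l * cev (R l j) s)"
      proof (rule row_space_if_kernel)
        fix x assume "\<forall>l<k. (\<Sum>j<m + P. cev (R l j) s * x j) = 0"
        then obtain c where c: "\<And>j. j < m + P \<Longrightarrow> x j = (\<Sum>i<m. cev (M j i) s * c i)"
          using exact[OF nl, of x] unfolding cev_def by blast
        have "(\<Sum>j<m + P. cev (r j) s * x j) = (\<Sum>j<m + P. \<Sum>i<m. cev (r j) s * cev (M j i) s * c i)"
          by (rule sum.cong) (use c in \<open>auto simp: sum_distrib_left mult.assoc\<close>)
        also have "\<dots> = (\<Sum>i<m. cev (rM r i) s * c i)"
          unfolding rM_def cev_sum cev_mult sum_distrib_right by (rule sum.swap)
        also have "\<dots> = 0" using r unfolding Tors_def by simp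
        finally show "(\<Sum>j<m + P. cev (r j) s * x j) = 0" .
      qed simp
      then obtain c where "\<And>j. j < m + P \<Longrightarrow> cev (r j) s = (\<Sum>l<k. c l * cev (R l j) s)" by auto
      from real_combination_at[where N = "m + P" and r = r and s = s and c = c, OF this] obtain g where
        g: "\<And>j. j < m + P \<Longrightarrow> cev (r j - (\<Sum>l<k. g l * R l j)) s = 0" by auto
      then have "\<forall>j\<in>{..<m + P}. \<exists>h. r j - (\<Sum>l<k. g l * R l j) = q * h"
        using q(3) unfolding dvd_def by simp
      from bchoice[OF this] obtain r' where
        r': "\<And>j. j < m + P \<Longrightarrow> r j - (\<Sum>l<k. g l * R l j) = q * r' j" by auto
      have gR: "(\<lambda>j. \<Sum>l<k. g l * R l j) \<in> Ann" by (intro Ann_sum Ann_mult R_in_Ann) auto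
      have "rM (\<lambda>j. q * r' j) i = rM (\<lambda>j. r j - (\<Sum>l<k. g l * R l j)) i" for i
        unfolding rM_def by (rule sum.cong) (use r' in auto)
      moreover have "(\<lambda>j. r j - (\<Sum>l<k. g l * R l j)) \<in> Tors"
        using row_subspaceD(4)[OF subspace_Tors r] gR Ann_sub_Tors by blast
      ultimately have "q * rM r' i = 0" if "i < m" for i
        using that unfolding Tors_def rM_mult by simp
      then have "r' \<in> Tors" using q(1) unfolding Tors_def by simp
      then have "(\<lambda>j. p * r' j) \<in> Ann" using p(2) unfolding annihilates_A2_iff by blast
      from row_subspaceD(3)[OF subspace_Ann this Ann_mult[OF gR, of p']]
      show ?thesis
      proof (rule Ann_cong)
        fix j assume "j < m + P"
        then have "p' * r j = p' * (q * r' j + (\<Sum>l<k. g l * R l j))" using r'[of j] by (simp add: algebra_simps)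
        then show "p * r' j + p' * (\<Sum>l<k. g l * R l j) = p' * r j" by (simp add: p' algebra_simps)
      qed
    qed
    then have "Pr p'" using p p' unfolding Pr_def annihilates_A2_iff by auto
    then have "degree p \<le> degree p'" by (rule min)
    moreover have "degree q \<noteq> 0"
    proof
      assume "degree q = 0"
      then obtain c where "q = [:c:]" by (rule degree_eq_zeroE)
      then show False using q by simp
    qed
    moreover have "degree p = degree q + degree p'" unfolding p' using p p' by (intro degree_mult_eq) auto
    ultimately show False by simp
  qed
  have "coprime p (pcompose p [:0, -1:])"
  proof (rule ccontr)
    assume "\<not> coprime p (pcompose p [:0, -1:])"
    then obtain d where d: "d dvd p" "d dvd pcompose p [:0, -1:]" "\<not> is_unit d" unfolding coprime_def by blast
    then have "d \<noteq> 0" using p(1) by auto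
    then obtain s where s: "cev d s = 0" using cev_root_exists d(3) by blast
    have "cev p s = 0" "cev (pcompose p [:0, -1:]) s = 0"
      using d(1,2) s by (auto elim!: dvdE simp: cev_mult)
    then have "s \<in> \<Lambda>" "- s \<in> \<Lambda>" using root cev_pcompose_neg by auto
    then show False using unmixed by blast
  qed
  with p(2) show ?thesis by blast
qed

end

section \<open>Storage functions on the controllable part\<close>

lemma affine_bounded_imp_const:
  fixes a b c :: real
  assumes "\<And>t. a + b * t \<le> c"
  shows "b = 0"
proof (rule ccontr)
  assume "b \<noteq> 0"
  then have "a + b * ((c - a + 1) / b) = c + 1" by simp
  with assms[of "(c - a + 1) / b"] show False by simp
qed

context state_space
begin

lemma rM_lincomb: "rM (lincomb_rows c b N) i = (\<Sum>x<N. Polynomial.smult (c x) (rM (b x) i))"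
  unfolding rM_def lincomb_rows_def sum_distrib_right
  by (subst sum.swap) (simp add: smult_sum_right)

definition smooth_latent :: "(nat \<Rightarrow> real \<Rightarrow> real) \<Rightarrow> bool" where
  "smooth_latent v \<longleftrightarrow> (\<forall>j<m. smooth (v j))"

text \<open>By \<open>rowop_image\<close>, the operator \<open>r\<close> on the controllable
  trajectory generated by the latent variable \<open>v\<close>. It depends on \<open>r\<close> only
  modulo \<open>Tors\<close>.\<close>

definition img :: "(nat \<Rightarrow> real poly) \<Rightarrow> (nat \<Rightarrow> real \<Rightarrow> real) \<Rightarrow> real \<Rightarrow> real" where
  "img r v = rowop m (rM r) v"

lemma img_lincomb: "img (lincomb_rows c b N) v t = (\<Sum>i<N. c i * img (b i) v t)"
proof -
  have "rM (lincomb_rows c b N) = lincomb_rows c (\<lambda>i. rM (b i)) N"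
    by (rule ext, unfold rM_lincomb) (simp only: lincomb_rows_def)
  then show ?thesis by (simp add: img_def rowop_lincomb)
qed

lemma img_Tors: "r \<in> Tors \<Longrightarrow> img r v t = 0"
  by (simp add: img_def rowop_def Tors_def)

lemma img_diff: "img (\<lambda>j. r j - s j) v t = img r v t - img s v t"
  by (simp add: img_def rM_diff[abs_def] rowop_diff)

lemma img_mod_Tors: "(\<lambda>j. r j - s j) \<in> Tors \<Longrightarrow> img r v t = img s v t"
  using img_Tors[of "\<lambda>j. r j - s j"] by (simp add: img_diff)

text \<open>The coordinates of a controllable trajectory: the states, followed by the \<open>m\<close> inputs,
  their first derivatives, and so on.\<close>

definition zrow :: "nat \<Rightarrow> nat \<Rightarrow> real poly" where
  "zrow i j = (if i < n1 then X i j else if j = (i - n1) mod m then monom 1 ((i - n1) div m) else 0)"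

lemma zrow_plus: "zrow (n1 + i) j = (if j = i mod m then monom 1 (i div m) else 0)"
  by (auto simp: zrow_def)

text \<open>The \<open>m * N\<close> coordinates after the states are the input derivatives of order
  below \<open>N\<close>. Equality modulo \<open>Tors\<close> is equality on the controllable
  part.\<close>

definition representable :: "(nat \<Rightarrow> real poly) \<Rightarrow> bool" where
  "representable r \<longleftrightarrow> (\<exists>N c. (\<lambda>j. r j - lincomb_rows c zrow (n1 + m * N) j) \<in> Tors)"

lemma representable_pad:
  assumes "(\<lambda>j. r j - lincomb_rows c zrow (n1 + m * N) j) \<in> Tors" "N \<le> N'"
  obtains c' where "(\<lambda>j. r j - lincomb_rows c' zrow (n1 + m * N') j) \<in> Tors"
proof (rule that)
  define c' where "c' i = (if i < n1 + m * N then c i else 0)" for i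
  have "m * N \<le> m * N'" using assms(2) by simp
  then have "lincomb_rows c zrow (n1 + m * N) j = lincomb_rows c' zrow (n1 + m * N') j" for j
    unfolding lincomb_rows_def by (intro sum.mono_neutral_cong_left) (auto simp: c'_def)
  with assms(1) show "(\<lambda>j. r j - lincomb_rows c' zrow (n1 + m * N') j) \<in> Tors" by simp
qed

lemma representable_add_smult:
  assumes "representable r" "representable s"
  shows "representable (\<lambda>j. r j + Polynomial.smult e (s j))"
proof -
  obtain N1 c1 where 1: "(\<lambda>j. r j - lincomb_rows c1 zrow (n1 + m * N1) j) \<in> Tors"
    using assms(1) unfolding representable_def by blast
  obtain N2 c2 where 2: "(\<lambda>j. s j - lincomb_rows c2 zrow (n1 + m * N2) j) \<in> Tors"
    using assms(2) unfolding representable_def by blast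
  define N where "N = max N1 N2"
  obtain d1 where 3: "(\<lambda>j. r j - lincomb_rows d1 zrow (n1 + m * N) j) \<in> Tors"
    using representable_pad[OF 1, of N] by (auto simp: N_def)
  obtain d2 where 4: "(\<lambda>j. s j - lincomb_rows d2 zrow (n1 + m * N) j) \<in> Tors"
    using representable_pad[OF 2, of N] by (auto simp: N_def)
  have "(\<lambda>j. r j + Polynomial.smult e (s j) - lincomb_rows (\<lambda>i. d1 i + e * d2 i) zrow (n1 + m * N) j) \<in> Tors"
    using row_subspaceD(2)[OF subspace_Tors 3 4, of e]
    unfolding lincomb_rows_add lincomb_rows_smult by (simp add: smult_diff_right algebra_simps)
  then show ?thesis unfolding representable_def by blast
qed

lemma representable_Tors: "r \<in> Tors \<Longrightarrow> representable r"
  unfolding representable_def by (intro exI[of _ 0] exI[of _ "\<lambda>_. 0"]) simp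

lemma representable_mod_Tors:
  assumes "(\<lambda>j. r j - s j) \<in> Tors" "representable s"
  shows "representable r"
  using representable_add_smult[OF representable_Tors[OF assms(1)] assms(2), of 1] by simp

lemma representable_lincomb:
  assumes "\<And>i. i < N \<Longrightarrow> representable (b i)"
  shows "representable (lincomb_rows c b N)"
  using assms
proof (induction N)
  case 0
  then show ?case using representable_Tors[OF row_subspaceD(1)[OF subspace_Tors]]
    by (simp add: lincomb_rows_def[abs_def])
next
  case (Suc N)
  then have "representable (\<lambda>j. lincomb_rows c b N j + Polynomial.smult (c N) (b N j))"
    by (intro representable_add_smult) auto
  then show ?case by (simp add: lincomb_rows_def[abs_def])
qed

lemma representable_zrow:
  assumes "i < n1 + m * N"
  shows "representable (zrow i)"
proof -
  have "(\<lambda>j. zrow i j - lincomb_rows (\<lambda>i'. if i' = i then 1 else 0) zrow (n1 + m * N) j) \<in> Tors"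
    unfolding lincomb_rows_unit[OF assms] using row_subspaceD(1)[OF subspace_Tors] by simp
  then show ?thesis unfolding representable_def by blast
qed

lemma input_row_zrow:
  "input_row m (\<lambda>l. [:b l:]) = lincomb_rows (\<lambda>i. if i < n1 then 0 else b (i - n1)) zrow (n1 + m)"
proof
  fix j
  have "lincomb_rows (\<lambda>i. if i < n1 then 0 else b (i - n1)) zrow (n1 + m) j
      = (\<Sum>l<m. Polynomial.smult (b l) (if j = l mod m then monom 1 (l div m) else 0))"
    unfolding lincomb_rows_def sum_lessThan_add by (simp add: zrow_plus)
  also have "\<dots> = (\<Sum>l<m. if l = j then [:b l:] else 0)"
    by (rule sum.cong) auto
  finally show "input_row m (\<lambda>l. [:b l:]) j =
    lincomb_rows (\<lambda>i. if i < n1 then 0 else b (i - n1)) zrow (n1 + m) j"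
    by (simp add: input_row_def)
qed

lemma X_lincomb_zrow: "(\<lambda>j. lincomb_rows c X n j - lincomb_rows c zrow n1 j) \<in> Tors"
proof -
  define d where "d i = (if i < n1 then 0 else c i)" for i
  obtain n2 where n2: "n = n1 + n2" using n1_le_n le_Suc_ex by blast
  have "lincomb_rows c X n j - lincomb_rows c zrow n1 j = lincomb_rows d X n j" for j
    unfolding lincomb_rows_def n2 sum_lessThan_add by (simp add: d_def zrow_def)
  moreover have "lincomb_rows d X n \<in> Tors" by (rule lincomb_Tors) (simp add: d_def)
  ultimately show ?thesis by simp
qed

lemma representable_X_input:
  assumes "(\<lambda>j. r j - lincomb_rows c X n j - input_row m (\<lambda>l. [:b l:]) j) \<in> Ann"
  shows "representable r"
proof -
  have "representable (input_row m (\<lambda>l. [:b l:]))"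
    unfolding input_row_zrow by (rule representable_lincomb, rule representable_zrow[of _ 1]) simp
  moreover have "representable (lincomb_rows c X n)"
    by (rule representable_mod_Tors[OF X_lincomb_zrow], rule representable_lincomb, rule representable_zrow[of _ 0]) simp
  ultimately have rep: "representable (\<lambda>j. lincomb_rows c X n j + Polynomial.smult 1 (input_row m (\<lambda>l. [:b l:]) j))"
    by (intro representable_add_smult)
  have "(\<lambda>j. r j - (lincomb_rows c X n j + Polynomial.smult 1 (input_row m (\<lambda>l. [:b l:]) j))) \<in> Tors"
    using assms Ann_sub_Tors by (auto simp: algebra_simps)
  then show ?thesis using rep by (rule representable_mod_Tors)
qed

lemma xi_zrow: "n1 \<le> i \<Longrightarrow> i < n1 + m * N \<Longrightarrow> xi * zrow i j = zrow (i + m) j"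
proof -
  assume i: "n1 \<le> i" "i < n1 + m * N"
  then have "m > 0" by (cases m) auto
  moreover obtain i' where "i = n1 + i'" using i(1) le_Suc_ex by blast
  ultimately show ?thesis
    by (simp add: zrow_plus xi_mult monom_Suc add.assoc)
qed

lemma representable_shift:
  assumes "representable r"
  shows "representable (\<lambda>j. xi * r j)"
proof -
  obtain N c where c: "(\<lambda>j. r j - lincomb_rows c zrow (n1 + m * N) j) \<in> Tors"
    using assms unfolding representable_def by blast
  have "representable (\<lambda>j. xi * zrow i j)" if i: "i < n1 + m * N" for i
  proof (cases "i < n1")
    case True
    then show ?thesis using representable_X_input[OF state_eq[of i]] n1_le_n by (simp add: zrow_def)
  next
    case False
    then have "representable (zrow (i + m))" using i by (intro representable_zrow[of _ "Suc N"]) simp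
    then show ?thesis using xi_zrow[of i N] False i by simp
  qed
  then have "representable (lincomb_rows c (\<lambda>i j. xi * zrow i j) (n1 + m * N))" by (rule representable_lincomb)
  moreover have "lincomb_rows c (\<lambda>i j. xi * zrow i j) (n1 + m * N) = (\<lambda>j. xi * lincomb_rows c zrow (n1 + m * N) j)"
    unfolding lincomb_rows_def by (simp add: sum_distrib_left)
  ultimately have rep: "representable (\<lambda>j. xi * lincomb_rows c zrow (n1 + m * N) j)" by simp
  have "(\<lambda>j. xi * r j - xi * lincomb_rows c zrow (n1 + m * N) j) \<in> Tors"
    using Tors_mult[OF c, of xi] by (simp add: right_diff_distrib)
  then show ?thesis using rep by (rule representable_mod_Tors)
qed

lemma zrow_input: "l < m \<Longrightarrow> zrow (n1 + l) = (\<lambda>j. if j = l then 1 else 0)"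
  by (auto simp: zrow_def fun_eq_iff)

lemma representable_monom:
  assumes "j0 < m + P"
  shows "representable (\<lambda>j. if j = j0 then monom 1 d else 0)"
proof (induction d)
  case 0
  show ?case
  proof (cases "j0 < m")
    case True
    then show ?thesis using representable_zrow[of "n1 + j0" 1] zrow_input
      unfolding monom_0 one_pCons[symmetric] by simp
  next
    case False
    then have "j0 - m < P" "m + (j0 - m) = j0" using assms by auto
    then show ?thesis using representable_X_input[OF output_eq[of "j0 - m"]]
      unfolding monom_0 one_pCons[symmetric] by simp
  qed
next
  case (Suc k)
  from representable_shift[OF Suc] show ?case
    by (simp add: xi_mult monom_Suc if_distrib cong: if_cong)
qed

text \<open>Sorting the coefficients by \<open>mod\<close> and \<open>div\<close> turns the
  combination into states plus a polynomial operator on the inputs, to which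
  \<open>unique_Tors\<close> applies.\<close>

lemma zrow_independent:
  assumes "lincomb_rows c zrow (n1 + m * N) \<in> Tors" "i < n1 + m * N"
  shows "c i = 0"
proof -
  define d where "d i = (if i < n1 then c i else 0)" for i
  define a where "a l = (\<Sum>i<m * N. if l = i mod m then monom (c (n1 + i)) (i div m) else 0)" for l
  have eq: "lincomb_rows c zrow (n1 + m * N) j = lincomb_rows d X n j + input_row m a j" for j
  proof -
    obtain n2 where n2: "n = n1 + n2" using n1_le_n le_Suc_ex by blast
    have "lincomb_rows c zrow (n1 + m * N) j = lincomb_rows d X n j
      + (\<Sum>i<m * N. Polynomial.smult (c (n1 + i)) (zrow (n1 + i) j))"
      unfolding lincomb_rows_def sum_lessThan_add n2 by (simp add: d_def zrow_def)
    also have "(\<Sum>i<m * N. Polynomial.smult (c (n1 + i)) (zrow (n1 + i) j)) = input_row m a j"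
    proof (cases "j < m")
      case True
      then show ?thesis unfolding input_row_def a_def by (auto simp: zrow_plus smult_monom intro!: sum.cong)
    next
      case False
      have "zrow (n1 + i) j = 0" if "i < m * N" for i
      proof -
        have "m > 0" using that by (cases m) auto
        then have "i mod m < m" by simp
        then show ?thesis using False by (auto simp: zrow_plus)
      qed
      then show ?thesis using False by (simp add: input_row_def)
    qed
    finally show ?thesis .
  qed
  have "(\<lambda>j. lincomb_rows d X n j + input_row m a j) \<in> Tors" unfolding eq[symmetric] by (rule assms(1))
  note u = unique_Tors[OF this]
  show ?thesis
  proof (cases "i < n1")
    case True
    with u(1) show ?thesis by (simp add: d_def)
  next
    case False
    define i' where "i' = i - n1"
    have i': "i = n1 + i'" "i' < m * N" using False assms(2) by (auto simp: i'_def)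
    then have "m > 0" by (cases m) auto
    then have "coeff (a (i' mod m)) (i' div m) = 0" using u(2)[of "i' mod m"] by simp
    moreover have "coeff (a (i' mod m)) (i' div m) = (\<Sum>x<m * N. if x = i' then c (n1 + x) else 0)"
      unfolding a_def coeff_sum
    proof (rule sum.cong[OF refl])
      fix x
      have "x = i'" if "i' mod m = x mod m" "x div m = i' div m"
        using that by (metis div_mult_mod_eq)
      then show "coeff (if i' mod m = x mod m then monom (c (n1 + x)) (x div m) else 0) (i' div m)
          = (if x = i' then c (n1 + x) else 0)" by auto
    qed
    ultimately show ?thesis using i' by simp
  qed
qed

text \<open>Independence modulo \<open>Tors\<close> means that the coefficient vectors of the
  polynomial rows \<open>rM (zrow i)\<close> are independent. The linear equations for the jet of
  the latent variable at time 0 are therefore solvable for arbitrary coordinate values.\<close>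

lemma prescribed_coordinates:
  obtains v where "smooth_latent v" "\<And>i. i < n1 + m * N \<Longrightarrow> img (zrow i) v 0 = z i"
proof -
  let ?L = "n1 + m * N"
  define Dg where "Dg = (\<Sum>i<?L. \<Sum>j<m. degree (rM (zrow i) j))"
  have Dg: "degree (rM (zrow i) j) \<le> Dg" if "i < ?L" "j < m" for i j
  proof -
    have "degree (rM (zrow i) j) \<le> (\<Sum>j<m. degree (rM (zrow i) j))" by (rule member_le_sum) (use that in auto)
    also have "\<dots> \<le> Dg" unfolding Dg_def by (rule member_le_sum) (use that in auto)
    finally show ?thesis .
  qed
  have "\<exists>x. \<forall>i<?L. (\<Sum>jk\<in>{..<m} \<times> {..Dg}. coeff (rM (zrow i) (fst jk)) (snd jk) * x jk) = z i"
  proof (rule independent_rows_surjective)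
    fix c assume c: "\<forall>jk\<in>{..<m} \<times> {..Dg}. (\<Sum>i<?L. c i * coeff (rM (zrow i) (fst jk)) (snd jk)) = 0"
    have "rM (lincomb_rows c zrow ?L) j = 0" if j: "j < m" for j
    proof (rule poly_eqI)
      fix d
      have "coeff (rM (lincomb_rows c zrow ?L) j) d = (\<Sum>i<?L. c i * coeff (rM (zrow i) j) d)"
        unfolding rM_lincomb by (simp add: coeff_sum)
      also have "\<dots> = 0"
      proof (cases "d \<le> Dg")
        case True
        then show ?thesis using c[rule_format, of "(j, d)"] j by simp
      next
        case False
        have "coeff (rM (zrow i) j) d = 0" if "i < ?L" for i
          using Dg[OF that j] False by (intro coeff_eq_0) simp
        then show ?thesis by simp
      qed
      finally show "coeff (rM (lincomb_rows c zrow ?L) j) d = coeff 0 d" by simp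
    qed
    then have "lincomb_rows c zrow ?L \<in> Tors" unfolding Tors_def by simp
    then show "\<forall>i<?L. c i = 0" using zrow_independent by blast
  qed simp
  then obtain x where x: "\<And>i. i < ?L \<Longrightarrow>
    (\<Sum>jk\<in>{..<m} \<times> {..Dg}. coeff (rM (zrow i) (fst jk)) (snd jk) * x jk) = z i" by blast
  have "\<forall>j. \<exists>f. smooth f \<and> (\<forall>k\<le>Dg. (deriv ^^ k) f 0 = x (j, k))"
    by (intro allI prescribed_jets)
  from choice[OF this] obtain v where
    l: "\<And>j. smooth (v j)" "\<And>j k. k \<le> Dg \<Longrightarrow> (deriv ^^ k) (v j) 0 = x (j, k)" by blast
  show ?thesis
  proof (rule that[of v])
    show "smooth_latent v" using l by (simp add: smooth_latent_def)
    fix i assume i: "i < ?L"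
    have "img (zrow i) v 0 = (\<Sum>j<m. \<Sum>k\<le>Dg. coeff (rM (zrow i) j) k * x (j, k))"
      unfolding img_def rowop_def
    proof (rule sum.cong[OF refl])
      fix j assume "j \<in> {..<m}"
      then have "diff_op (rM (zrow i) j) (v j) 0 = (\<Sum>k\<le>Dg. coeff (rM (zrow i) j) k * (deriv ^^ k) (v j) 0)"
        using Dg[OF i] by (intro diff_op_altdef) auto
      also have "\<dots> = (\<Sum>k\<le>Dg. coeff (rM (zrow i) j) k * x (j, k))"
        by (rule sum.cong) (use l(2) in auto)
      finally show "diff_op (rM (zrow i) j) (v j) 0 = (\<Sum>k\<le>Dg. coeff (rM (zrow i) j) k * x (j, k))" .
    qed
    also have "\<dots> = z i" using x[OF i] by (simp add: sum.cartesian_product case_prod_beta)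
    finally show "img (zrow i) v 0 = z i" .
  qed
qed

text \<open>The time derivative of the coordinates, as \<open>deriv_coord\<close> shows: the state
  equation without torsion states, which vanish here, and for an input coordinate the next
  derivative, which stands \<open>m\<close> places further on.\<close>

definition next_coord :: "(nat \<Rightarrow> real) \<Rightarrow> nat \<Rightarrow> real" where
  "next_coord z i = (if i < n1 then (\<Sum>j<n1. A i j * z j) + (\<Sum>l<m. Bm i l * z (n1 + l)) else z (i + m))"

lemma img_X_input:
  assumes "(\<lambda>j. r j - lincomb_rows c X n j - input_row m (\<lambda>l. [:b l:]) j) \<in> Ann"
  shows "img r v t = (\<Sum>j<n1. c j * img (zrow j) v t) + (\<Sum>l<m. b l * img (zrow (n1 + l)) v t)"
proof -
  have "img (\<lambda>j. r j - lincomb_rows c X n j - input_row m (\<lambda>l. [:b l:]) j) v t = 0"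
    using assms Ann_sub_Tors by (intro img_Tors) blast
  moreover have "img (lincomb_rows c X n) v t = (\<Sum>j<n1. c j * img (zrow j) v t)"
    using img_mod_Tors[OF X_lincomb_zrow] by (simp add: img_lincomb)
  moreover have "img (input_row m (\<lambda>l. [:b l:])) v t = (\<Sum>l<m. b l * img (zrow (n1 + l)) v t)"
    unfolding input_row_zrow img_lincomb sum_lessThan_add by simp
  ultimately show ?thesis by (simp add: img_diff)
qed

lemma deriv_coord:
  assumes "smooth_latent v" "i < n1 + m * N"
  shows "(img (zrow i) v has_real_derivative next_coord (\<lambda>i. img (zrow i) v t) i) (at t)"
proof -
  have sm: "\<And>j. j < m \<Longrightarrow> smooth (v j)" using assms(1) by (simp add: smooth_latent_def)
  have "deriv (img (zrow i) v) t = img (\<lambda>j. xi * zrow i j) v t"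
    unfolding img_def rM_mult[abs_def] by (rule deriv_rowop[OF sm])
  also have "\<dots> = next_coord (\<lambda>i. img (zrow i) v t) i"
  proof (cases "i < n1")
    case True
    then show ?thesis using img_X_input[OF state_eq[of i]] n1_le_n by (simp add: zrow_def next_coord_def)
  next
    case False
    then have "(\<lambda>j. xi * zrow i j) = zrow (i + m)" using xi_zrow[of i N] assms(2) by auto
    then show ?thesis using False by (simp add: next_coord_def)
  qed
  finally show ?thesis
    using smooth_has_derivative[where k = 0 and t = t,
        OF smooth_rowop[where N = m and f = v and r = "rM (zrow i)", OF sm]] by (simp add: img_def)
qed

lemma image_components:
  assumes "smooth_latent v"
  shows "l < m \<Longrightarrow> rowop m (M l) v t = img (zrow (n1 + l)) v t"
    and "i < P \<Longrightarrow> rowop m (M (m + i)) v t =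
      (\<Sum>j<n1. C i j * img (zrow j) v t) + (\<Sum>l<m. D i l * img (zrow (n1 + l)) v t)"
proof -
  have sm: "\<And>j. j < m \<Longrightarrow> smooth (v j)" using assms by (simp add: smooth_latent_def)
  have unit: "rowop m (M j0) v t = img (\<lambda>j. if j = j0 then 1 else 0) v t" if "j0 < m + P" for j0
    using rowop_image[of v "\<lambda>j. if j = j0 then 1 else 0" t, OF sm] rowop_unit[OF that, of 1 "\<lambda>i. rowop m (M i) v" t]
    unfolding img_def by simp
  show "rowop m (M l) v t = img (zrow (n1 + l)) v t" if "l < m" using unit[of l] that by (simp add: zrow_input)
  show "rowop m (M (m + i)) v t =
      (\<Sum>j<n1. C i j * img (zrow j) v t) + (\<Sum>l<m. D i l * img (zrow (n1 + l)) v t)" if "i < P"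
    using unit[of "m + i"] img_X_input[OF output_eq[OF that]] that by simp
qed

definition quad :: "((nat \<Rightarrow> real \<Rightarrow> real) \<Rightarrow> real \<Rightarrow> real) \<Rightarrow> bool" where
  "quad F \<longleftrightarrow> (\<exists>N Q. \<forall>v t. smooth_latent v \<longrightarrow> F v t =
    (\<Sum>i<n1 + m * N. \<Sum>j<n1 + m * N. Q i j * img (zrow i) v t * img (zrow j) v t))"

lemma quad_prod:
  assumes "representable r" "representable s"
  shows "quad (\<lambda>v t. img r v t * c * img s v t)"
proof -
  obtain N1 c1 where 1: "(\<lambda>j. r j - lincomb_rows c1 zrow (n1 + m * N1) j) \<in> Tors"
    using assms(1) unfolding representable_def by blast
  obtain N2 c2 where 2: "(\<lambda>j. s j - lincomb_rows c2 zrow (n1 + m * N2) j) \<in> Tors"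
    using assms(2) unfolding representable_def by blast
  define N where "N = max N1 N2"
  obtain d1 where 3: "(\<lambda>j. r j - lincomb_rows d1 zrow (n1 + m * N) j) \<in> Tors"
    using representable_pad[OF 1, of N] by (auto simp: N_def)
  obtain d2 where 4: "(\<lambda>j. s j - lincomb_rows d2 zrow (n1 + m * N) j) \<in> Tors"
    using representable_pad[OF 2, of N] by (auto simp: N_def)
  have "img r v t * c * img s v t = (\<Sum>i<n1 + m * N. \<Sum>j<n1 + m * N.
      (d1 i * c * d2 j) * img (zrow i) v t * img (zrow j) v t)" for v t
    unfolding img_mod_Tors[OF 3] img_mod_Tors[OF 4] img_lincomb sum_distrib_right
    unfolding sum_distrib_left by (intro sum.cong refl) (simp add: algebra_simps)
  then show ?thesis unfolding quad_def
    by (intro exI[of _ N] exI[of _ "\<lambda>i j. d1 i * c * d2 j"] allI impI)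
qed

lemma quad_add:
  assumes "quad F" "quad G"
  shows "quad (\<lambda>v t. F v t + G v t)"
proof -
  have pad: "(\<Sum>i<n1 + m * N. \<Sum>j<n1 + m * N. Q i j * z i * z j) =
    (\<Sum>i<n1 + m * N'. \<Sum>j<n1 + m * N'.
      (if i < n1 + m * N \<and> j < n1 + m * N then Q i j else 0) * z i * z j)"
    if "N \<le> N'" for N N' :: nat and Q :: "nat \<Rightarrow> nat \<Rightarrow> real" and z
  proof -
    have le: "m * N \<le> m * N'" using that by simp
    show ?thesis
    proof (rule sum.mono_neutral_cong_left)
      fix i assume "i \<in> {..<n1 + m * N}"
      then show "(\<Sum>j<n1 + m * N. Q i j * z i * z j) =
        (\<Sum>j<n1 + m * N'. (if i < n1 + m * N \<and> j < n1 + m * N then Q i j else 0) * z i * z j)"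
        using le by (intro sum.mono_neutral_cong_left) auto
    qed (use le in auto)
  qed
  obtain N1 Q1 where 1: "\<And>v t. smooth_latent v \<Longrightarrow> F v t =
    (\<Sum>i<n1 + m * N1. \<Sum>j<n1 + m * N1. Q1 i j * img (zrow i) v t * img (zrow j) v t)"
    using assms(1) unfolding quad_def by (elim exE) simp
  obtain N2 Q2 where 2: "\<And>v t. smooth_latent v \<Longrightarrow> G v t =
    (\<Sum>i<n1 + m * N2. \<Sum>j<n1 + m * N2. Q2 i j * img (zrow i) v t * img (zrow j) v t)"
    using assms(2) unfolding quad_def by (elim exE) simp
  define N where "N = max N1 N2"
  define Q where "Q i j = (if i < n1 + m * N1 \<and> j < n1 + m * N1 then Q1 i j else 0)
    + (if i < n1 + m * N2 \<and> j < n1 + m * N2 then Q2 i j else 0)" for i j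
  have "F v t + G v t =
    (\<Sum>i<n1 + m * N. \<Sum>j<n1 + m * N. Q i j * img (zrow i) v t * img (zrow j) v t)" if "smooth_latent v" for v t
    unfolding 1[OF that] 2[OF that] pad[of N1 N, unfolded N_def, OF max.cobounded1, folded N_def]
      pad[of N2 N, unfolded N_def, OF max.cobounded2, folded N_def] Q_def distrib_right sum.distrib ..
  then show ?thesis unfolding quad_def by (intro exI[of _ N] exI[of _ Q] allI impI)
qed

lemma quad_zero: "quad (\<lambda>_ _. 0)"
  unfolding quad_def by (intro exI[of _ 0] exI[of _ "\<lambda>_ _. 0"]) simp

lemma quad_sum: "finite S \<Longrightarrow> (\<And>x. x \<in> S \<Longrightarrow> quad (F x)) \<Longrightarrow> quad (\<lambda>v t. \<Sum>x\<in>S. F x v t)"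
  by (induction S rule: finite_induct) (auto simp: quad_zero quad_add)

end

section \<open>The matrix inequality in coordinates\<close>

lemma ent_quadratic:
  assumes x: "proj {..<N} * x = x" and y: "proj {..<N'} * y = y"
  shows "ent (tr x * K * y) i j = (\<Sum>a<N. \<Sum>b<N'. ent x a i * ent K a b * ent y b j)"
proof -
  have x0: "ent x a i = 0" if "a \<ge> N" for a i using x that unfolding proj_mult_eq_iff by simp
  have y0: "ent y a i = 0" if "a \<ge> N'" for a i using y that unfolding proj_mult_eq_iff by simp
  have "ent (tr x * (K * y)) i j = (\<Sum>a<N. ent (tr x) i a * ent (K * y) a j)"
    by (rule ent_times) (use x0 in auto)
  also have "\<dots> = (\<Sum>a<N. ent x a i * (\<Sum>b<N'. ent K a b * ent y b j))"
  proof (rule sum.cong[OF refl])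
    fix a
    have "ent (K * y) a j = (\<Sum>b<N'. ent K a b * ent y b j)"
      by (rule ent_times) (use y0 in auto)
    then show "ent (tr x) i a * ent (K * y) a j = ent x a i * (\<Sum>b<N'. ent K a b * ent y b j)" by simp
  qed
  finally show ?thesis by (simp add: sum_distrib_left mult.assoc)
qed

lemma ent_block_mult:
  assumes "proj {..<N} * x = x" "a < I"
  shows "ent (block {..<I} {..<N} f * x) a j = (\<Sum>b<N. f a b * ent x b j)"
proof -
  have "ent (block {..<I} {..<N} f * x) a j = (\<Sum>b<N. ent (block {..<I} {..<N} f) a b * ent x b j)"
    by (rule ent_times) (auto simp: ent_block)
  then show ?thesis using assms(2) by (simp add: ent_block)
qed

definition sgn_block :: "nat \<Rightarrow> (nat \<Rightarrow> real) \<Rightarrow> rcmat" where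
  "sgn_block P \<sigma> = block {..<P} {..<P} (\<lambda>i j. if i = j then \<sigma> i else 0)"

lemma tr_sgn_block: "tr (sgn_block P \<sigma>) = sgn_block P \<sigma>"
  by (rule rcmat_eqI) (auto simp: sgn_block_def ent_block)

lemma ent_sgn_quadratic:
  assumes "proj {..<P} * y = y"
  shows "ent (tr y * sgn_block P \<sigma> * y) i i = (\<Sum>a<P. \<sigma> a * (ent y a i)\<^sup>2)"
proof -
  have "ent (tr y * sgn_block P \<sigma> * y) i i = (\<Sum>a<P. \<Sum>b<P. if b = a then \<sigma> a * (ent y a i)\<^sup>2 else 0)"
    unfolding ent_quadratic[OF assms assms]
    by (intro sum.cong refl) (auto simp: sgn_block_def ent_block power2_eq_square)
  then show ?thesis by simp
qed

lemma ent_sum_squares: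
  assumes "proj {..<N} * u = u"
  shows "ent (tr u * u) i i = (\<Sum>l<N. (ent u l i)\<^sup>2)"
proof -
  have "ent u a i = 0" if "a \<ge> N" for a i using assms that unfolding proj_mult_eq_iff by simp
  then have "ent (tr u * u) i i = (\<Sum>l<N. ent (tr u) i l * ent u l i)"
    by (intro ent_times) auto
  then show ?thesis by (simp add: power2_eq_square)
qed

text \<open>\<open>W\<close>, \<open>L\<close> and \<open>Q\<close> are the weights of the supply rate \<open>|u|\<^sup>2 + \<Sum> \<sigma>\<^sub>i y\<^sub>i\<^sup>2\<close> with \<open>y = C x + D u\<close>.\<close>

lemma ent_lmi:
  fixes N n m P :: nat and a b c d :: "nat \<Rightarrow> nat \<Rightarrow> real" and \<sigma> :: "nat \<Rightarrow> real"
  defines "Cm \<equiv> block {..<P} {..<n} c" and "Dm \<equiv> block {..<P} {..<m} d"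
  defines "J \<equiv> sgn_block P \<sigma>"
  defines "W \<equiv> proj {..<m} + tr Dm * J * Dm" and "L \<equiv> tr Dm * J * Cm" and "Q \<equiv> tr Cm * J * Cm"
  assumes N: "N \<le> n" and x: "proj {..<N} * x = x" and u: "proj {..<m} * u = u"
  defines "v \<equiv> (\<lambda>i. (\<Sum>j<N. a i j * ent x j 0) + (\<Sum>l<m. b i l * ent u l 0))"
  shows "ent (lmi (block {..<N} {..<N} a) (block {..<N} {..<m} b) Q L W K x u) 0 0 =
    (\<Sum>l<m. (ent u l 0)\<^sup>2)
    + (\<Sum>i<P. \<sigma> i * ((\<Sum>j<N. c i j * ent x j 0) + (\<Sum>l<m. d i l * ent u l 0))\<^sup>2)
    - (\<Sum>i<N. \<Sum>j<N. ent K i j * (ent x i 0 * v j + v i * ent x j 0))"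
proof -
  define y where "y = Cm * x + Dm * u"
  define w where "w = block {..<N} {..<N} a * x + block {..<N} {..<m} b * u"
  have "proj {..<P} * y = y"
    unfolding y_def Cm_def Dm_def by (simp add: distrib_left proj_block flip: mult.assoc)
  note y = ent_sgn_quadratic[OF this, of \<sigma> 0]
  have w: "proj {..<N} * w = w"
    unfolding w_def by (simp add: distrib_left proj_block flip: mult.assoc)
  have "tr u * proj {..<m} * u = tr u * u" using u by (simp add: mult.assoc)
  moreover have "tr y * J * y = tr u * (tr Dm * J * Dm) * u + tr u * L * x + tr x * tr L * u + tr x * Q * x"
    unfolding y_def L_def Q_def by (simp add: algebra_simps J_def tr_sgn_block)
  ultimately have eq: "lmi (block {..<N} {..<N} a) (block {..<N} {..<m} b) Q L W K x u =
      tr u * u + tr y * J * y - tr x * K * w - tr w * K * x"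
    unfolding lmi_def W_def w_def[symmetric] by (simp add: algebra_simps)
  have "x = proj {..<n} * x"
    using x N unfolding proj_mult_eq_iff by (intro rcmat_eqI) (auto simp: ent_proj_mult)
  then have xn: "proj {..<n} * x = x" by simp
  have x0: "ent x j 0 = 0" if "j \<ge> N" for j using x that unfolding proj_mult_eq_iff by simp
  have "ent y i 0 = (\<Sum>j<N. c i j * ent x j 0) + (\<Sum>l<m. d i l * ent u l 0)" if "i < P" for i
  proof -
    have "(\<Sum>j<n. c i j * ent x j 0) = (\<Sum>j<N. c i j * ent x j 0)"
      by (rule sum.mono_neutral_right) (use N x0 in auto)
    then show ?thesis unfolding y_def Cm_def Dm_def
      using ent_block_mult[OF xn that] ent_block_mult[OF u that] by simp
  qed
  moreover have wv: "ent w i 0 = v i" if "i < N" for i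
    unfolding w_def v_def using ent_block_mult[OF x that] ent_block_mult[OF u that] by simp
  moreover have "ent (tr x * K * w) 0 0 + ent (tr w * K * x) 0 0 =
      (\<Sum>i<N. \<Sum>j<N. ent K i j * (ent x i 0 * v j + v i * ent x j 0))"
    unfolding ent_quadratic[OF x w] ent_quadratic[OF w x] sum.distrib[symmetric]
    by (intro sum.cong refl) (simp add: wv algebra_simps)
  ultimately show ?thesis
    unfolding eq using y ent_sum_squares[OF u, of 0] by (simp add: J_def)
qed

context state_space
begin

definition supply_rate :: "(nat \<Rightarrow> real) \<Rightarrow> (nat \<Rightarrow> real) \<Rightarrow> real" where
  "supply_rate \<sigma> z = (\<Sum>l<m. (z (n1 + l))\<^sup>2)
    + (\<Sum>i<P. \<sigma> i * ((\<Sum>j<n1. C i j * z j) + (\<Sum>l<m. D i l * z (n1 + l)))\<^sup>2)"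

text \<open>The dissipation inequality as an algebraic statement about arbitrary coordinate values
  \<open>z\<close>; the storage function depends on the first \<open>L\<close> coordinates.\<close>

definition dissipation :: "(nat \<Rightarrow> real) \<Rightarrow> nat \<Rightarrow> (nat \<Rightarrow> nat \<Rightarrow> real) \<Rightarrow> bool" where
  "dissipation \<sigma> L Q \<longleftrightarrow> (\<forall>i j. Q i j = Q j i) \<and>
    (\<forall>z. (\<Sum>i<L. \<Sum>j<L. Q i j * (next_coord z i * z j + z i * next_coord z j)) \<le> supply_rate \<sigma> z)"

text \<open>Coordinates at time 0 are arbitrary by \<open>prescribed_coordinates\<close>, so an
  inequality along trajectories holds for all coordinate values.\<close>

lemma dissipation_of_quad:
  assumes "quad F"
    and diss: "\<And>v t. smooth_latent v \<Longrightarrow> deriv (F v) t \<le> supply_rate \<sigma> (\<lambda>i. img (zrow i) v t)"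
  shows "\<exists>N Q. dissipation \<sigma> (n1 + m * N) Q"
proof -
  obtain N Q0 where F: "\<And>v t. smooth_latent v \<Longrightarrow> F v t =
    (\<Sum>i<n1 + m * N. \<Sum>j<n1 + m * N. Q0 i j * img (zrow i) v t * img (zrow j) v t)"
    using assms(1) unfolding quad_def by (elim exE) simp
  let ?L = "n1 + m * N"
  define Q where "Q i j = (Q0 i j + Q0 j i) / 2" for i j
  have "(\<Sum>i<?L. \<Sum>j<?L. Q i j * (next_coord z i * z j + z i * next_coord z j)) \<le> supply_rate \<sigma> z" for z
  proof -
    \<comment> \<open>One block of input derivatives beyond those in the storage function is
      prescribed, since its derivative involves them.\<close>
    obtain v where v: "smooth_latent v" "\<And>i. i < n1 + m * Suc N \<Longrightarrow> img (zrow i) v 0 = z i"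
      using prescribed_coordinates[of "Suc N" z] by blast
    define zz where "zz i = img (zrow i) v 0" for i
    have nx: "next_coord zz i = next_coord z i" if "i < ?L" for i
      using v(2) that unfolding next_coord_def zz_def by (auto intro!: arg_cong2[where f = "(+)"] sum.cong)
    have Fv: "F v = (\<lambda>t. \<Sum>i<?L. \<Sum>j<?L. Q0 i j * img (zrow i) v t * img (zrow j) v t)" using F[OF v(1)] by auto
    have dv: "((\<lambda>t. \<Sum>i<?L. \<Sum>j<?L. Q0 i j * img (zrow i) v t * img (zrow j) v t) has_real_derivative
        (\<Sum>i<?L. \<Sum>j<?L. Q0 i j * next_coord zz i * zz j + Q0 i j * zz i * next_coord zz j)) (at 0)"
    proof (intro DERIV_sum)
      fix i j assume "i \<in> {..<?L}" "j \<in> {..<?L}"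
      then have "(img (zrow i) v has_real_derivative next_coord zz i) (at 0)"
        "(img (zrow j) v has_real_derivative next_coord zz j) (at 0)"
        unfolding zz_def by (intro deriv_coord[OF v(1)]; simp)+
      then show "((\<lambda>t. Q0 i j * img (zrow i) v t * img (zrow j) v t) has_real_derivative
          Q0 i j * next_coord zz i * zz j + Q0 i j * zz i * next_coord zz j) (at 0)"
        by (auto intro!: derivative_eq_intros simp: zz_def algebra_simps)
    qed
    have "deriv (F v) 0 = (\<Sum>i<?L. \<Sum>j<?L. Q0 i j * next_coord zz i * zz j + Q0 i j * zz i * next_coord zz j)"
      unfolding Fv by (rule DERIV_imp_deriv[OF dv])
    also have "\<dots> = (\<Sum>i<?L. \<Sum>j<?L. Q0 i j * (next_coord z i * z j + z i * next_coord z j))"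
      by (intro sum.cong refl) (use nx v(2) in \<open>auto simp: zz_def algebra_simps\<close>)
    finally have dF: "deriv (F v) 0 = (\<Sum>i<?L. \<Sum>j<?L. Q0 i j * (next_coord z i * z j + z i * next_coord z j))" .
    have swap: "(\<Sum>i<?L. \<Sum>j<?L. Q0 j i * (next_coord z i * z j + z i * next_coord z j)) =
        (\<Sum>i<?L. \<Sum>j<?L. Q0 i j * (next_coord z i * z j + z i * next_coord z j))"
      by (subst sum.swap) (intro sum.cong refl, simp add: algebra_simps)
    have "(\<Sum>i<?L. \<Sum>j<?L. Q i j * (next_coord z i * z j + z i * next_coord z j)) =
        ((\<Sum>i<?L. \<Sum>j<?L. Q0 i j * (next_coord z i * z j + z i * next_coord z j)) +
         (\<Sum>i<?L. \<Sum>j<?L. Q0 j i * (next_coord z i * z j + z i * next_coord z j))) / 2"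
      unfolding Q_def sum.distrib[symmetric] sum_divide_distrib
      by (intro sum.cong refl) (simp add: algebra_simps add_divide_distrib)
    then have "(\<Sum>i<?L. \<Sum>j<?L. Q i j * (next_coord z i * z j + z i * next_coord z j)) = deriv (F v) 0"
      unfolding swap dF by simp
    also have "\<dots> \<le> supply_rate \<sigma> (\<lambda>i. img (zrow i) v 0)" by (rule diss[OF v(1)])
    also have "\<dots> = supply_rate \<sigma> z"
      unfolding supply_rate_def using v(2) by (auto intro!: arg_cong2[where f = "(+)"] sum.cong)
    finally show ?thesis .
  qed
  moreover have "Q i j = Q j i" for i j by (simp add: Q_def)
  ultimately have "dissipation \<sigma> ?L Q" unfolding dissipation_def by simp
  then show ?thesis by blast
qed

text \<open>The dissipation inequality is affine in the highest input derivative, so its coefficient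
  vanishes; hence a storage function depends on the state only.\<close>

lemma dissipation_descent:
  assumes d: "dissipation \<sigma> (n1 + Suc l) Q" and m: "m > 0"
  shows "dissipation \<sigma> (n1 + l) Q"
proof -
  let ?p = "n1 + l"
  have sym: "Q i j = Q j i" for i j using d unfolding dissipation_def by blast
  have bound: "(\<Sum>i<Suc ?p. \<Sum>j<Suc ?p. Q i j * (next_coord z i * z j + z i * next_coord z j)) \<le> supply_rate \<sigma> z" for z
    using d unfolding dissipation_def add_Suc_right by blast
  have lin: "(\<Sum>i<Suc ?p. Q i ?p * z i) = 0" for z
  proof -
    \<comment> \<open>Coordinate \<open>?p + m\<close> is the derivative of coordinate
      \<open>?p\<close>. It affects neither the derivatives of the other coordinates involved nor
      the supply rate, so it is a free parameter, in which the left-hand side is affine with slope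
      \<open>b\<close>.\<close>
    define a where "a = (\<Sum>i<Suc ?p. \<Sum>j<Suc ?p. Q i j * (next_coord (z(?p + m := 0)) i * z j + z i * next_coord (z(?p + m := 0)) j))"
    define b where "b = 2 * (\<Sum>i<Suc ?p. Q i ?p * z i)"
    have "a + b * t \<le> supply_rate \<sigma> z" for t
    proof -
      define y where "y = z(?p + m := t)"
      define y0 where "y0 = z(?p + m := 0)"
      have nx: "next_coord y i = next_coord y0 i + (if i = ?p then t else 0)" if "i < Suc ?p" for i
      proof (cases "i < n1")
        case True
        have "y j = y0 j" if "j < n1" for j using that m by (simp add: y_def y0_def)
        moreover have "y (n1 + k) = y0 (n1 + k)" if "k < m" for k using that m by (simp add: y_def y0_def)
        ultimately show ?thesis using True by (simp add: next_coord_def)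
      next
        case False
        then show ?thesis using that by (auto simp: next_coord_def y_def y0_def)
      qed
      have yz: "y i = z i" if "i < Suc ?p" for i using that m by (simp add: y_def)
      have "(\<Sum>i<Suc ?p. \<Sum>j<Suc ?p. Q i j * (next_coord y i * y j + y i * next_coord y j)) =
          (\<Sum>i<Suc ?p. \<Sum>j<Suc ?p. Q i j * (next_coord y0 i * z j + z i * next_coord y0 j)
            + (if i = ?p then Q i j * t * z j else 0) + (if j = ?p then Q i j * z i * t else 0))"
        by (intro sum.cong refl) (use nx yz in \<open>auto simp: algebra_simps\<close>)
      also have "\<dots> = a + (\<Sum>j<Suc ?p. Q ?p j * t * z j) + (\<Sum>i<Suc ?p. Q i ?p * z i * t)"
      proof -
        have "(\<Sum>i<Suc ?p. \<Sum>j<Suc ?p. if i = ?p then Q i j * t * z j else 0) =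
            (\<Sum>i<Suc ?p. if i = ?p then (\<Sum>j<Suc ?p. Q i j * t * z j) else 0)"
          by (intro sum.cong refl) auto
        then have 1: "(\<Sum>i<Suc ?p. \<Sum>j<Suc ?p. if i = ?p then Q i j * t * z j else 0) = (\<Sum>j<Suc ?p. Q ?p j * t * z j)"
          by (simp only: sum.delta finite_lessThan lessThan_iff lessI if_True)
        have 2: "(\<Sum>j<Suc ?p. if j = ?p then Q i j * z i * t else 0) = Q i ?p * z i * t" for i
          by (simp only: sum.delta finite_lessThan lessThan_iff lessI if_True)
        show ?thesis unfolding sum.distrib 1 2 a_def y0_def ..
      qed
      also have "(\<Sum>j<Suc ?p. Q ?p j * t * z j) = t * (\<Sum>i<Suc ?p. Q i ?p * z i)"
        unfolding sum_distrib_left by (intro sum.cong refl) (simp add: sym[of ?p])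
      also have "(\<Sum>i<Suc ?p. Q i ?p * z i * t) = t * (\<Sum>i<Suc ?p. Q i ?p * z i)"
        unfolding sum_distrib_left by (intro sum.cong refl) simp
      finally have "a + b * t = (\<Sum>i<Suc ?p. \<Sum>j<Suc ?p. Q i j * (next_coord y i * y j + y i * next_coord y j))"
        unfolding b_def by (simp only: algebra_simps)
      also have "\<dots> \<le> supply_rate \<sigma> y" by (rule bound)
      also have "supply_rate \<sigma> y = supply_rate \<sigma> z"
      proof -
        have "y j = z j" if "j < n1 + m" for j using that by (simp add: y_def)
        then show ?thesis unfolding supply_rate_def by (auto intro!: arg_cong2[where f = "(+)"] sum.cong)
      qed
      finally show ?thesis .
    qed
    then have "b = 0" by (rule affine_bounded_imp_const)
    then show ?thesis by (simp add: b_def)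
  qed
  have zero: "Q i ?p = 0" if "i < Suc ?p" for i
  proof -
    have "(\<Sum>i'<Suc ?p. Q i' ?p * (if i' = i then 1 else 0)) = Q i ?p"
      using that by (simp add: if_distrib cong: if_cong)
    then show ?thesis using lin[of "\<lambda>i'. if i' = i then 1 else 0"] by simp
  qed
  have eq: "(\<Sum>i<Suc ?p. \<Sum>j<Suc ?p. Q i j * (next_coord z i * z j + z i * next_coord z j)) =
      (\<Sum>i<?p. \<Sum>j<?p. Q i j * (next_coord z i * z j + z i * next_coord z j))" for z
    using zero sym[of ?p] by simp
  have "(\<Sum>i<?p. \<Sum>j<?p. Q i j * (next_coord z i * z j + z i * next_coord z j)) \<le> supply_rate \<sigma> z" for z
    using bound[of z] unfolding eq .
  then show ?thesis unfolding dissipation_def using sym by blast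
qed

lemma dissipation_state:
  assumes "dissipation \<sigma> (n1 + m * N) Q"
  shows "dissipation \<sigma> n1 Q"
proof (cases "m = 0")
  case True
  then show ?thesis using assms by simp
next
  case False
  have "dissipation \<sigma> (n1 + l) Q \<Longrightarrow> dissipation \<sigma> n1 Q" for l
    by (induction l) (use dissipation_descent False in auto)
  then show ?thesis using assms by blast
qed

text \<open>The differential and the matrix argument meet here: the storage function on the
  controllable part becomes a matrix \<open>K0\<close>, \<open>lmi_extension\<close> extends it to
  all states, and the result is read along solutions. The hypothesis \<open>pos\<close> is the
  definiteness of the input weight \<open>W\<close>.\<close>

theorem storage_of_state:
  assumes "quad F"
    and diss: "\<And>v t. smooth_latent v \<Longrightarrow> deriv (F v) t \<le> supply_rate \<sigma> (\<lambda>i. img (zrow i) v t)"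
    and pos: "\<And>v. (\<exists>l<m. v l \<noteq> 0) \<Longrightarrow>
      (\<Sum>l<m. (v l)\<^sup>2) + (\<Sum>i<P. \<sigma> i * (\<Sum>l<m. D i l * v l)\<^sup>2) > (0 :: real)"
  shows "\<exists>K :: nat \<Rightarrow> nat \<Rightarrow> real. \<forall>w x t. solution w x \<longrightarrow>
    deriv (\<lambda>s. \<Sum>i<n. \<Sum>j<n. K i j * x i s * x j s) t \<le> (\<Sum>l<m. (w l t)\<^sup>2) + (\<Sum>i<P. \<sigma> i * (w (m + i) t)\<^sup>2)"
proof -
  obtain Q0 where Q0: "dissipation \<sigma> n1 Q0"
    using dissipation_of_quad[OF assms(1) diss] dissipation_state by blast
  define e1 where "e1 = proj {..<n1}"
  define em where "em = proj {..<m}"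
  define A1 where "A1 = block {..<n1} {..<n1} A"
  define A12 where "A12 = block {..<n1} {n1..<n} A"
  define B1 where "B1 = block {..<n1} {..<m} Bm"
  define Cm where "Cm = block {..<P} {..<n} C"
  define Dm where "Dm = block {..<P} {..<m} D"
  define J where "J = sgn_block P \<sigma>"
  define W where "W = proj {..<m} + tr Dm * J * Dm"
  define L where "L = tr Dm * J * Cm"
  define Q where "Q = tr Cm * J * Cm"
  define K0 where "K0 = block {..<n1} {..<n1} Q0"
  have trJ: "tr J = J" by (simp add: J_def tr_sgn_block)
  have emD: "em * tr Dm = tr Dm"
    using tr_mult_eq[of Dm em Dm] by (simp add: em_def Dm_def block_proj)
  have quadW: "ent (tr z * W * z) j j = (\<Sum>l<m. (ent z l j)\<^sup>2) + (\<Sum>i<P. \<sigma> i * (\<Sum>l<m. D i l * ent z l j)\<^sup>2)" for z j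
  proof -
    define u where "u = em * z"
    have u: "proj {..<m} * u = u" by (simp add: u_def em_def flip: mult.assoc)
    have uz: "ent u l j = ent z l j" if "l < m" for l using that by (simp add: u_def em_def ent_proj_mult)
    have Du: "proj {..<P} * (Dm * u) = Dm * u" by (simp add: Dm_def proj_block flip: mult.assoc)
    have DmU: "Dm * em = Dm" by (simp add: Dm_def em_def block_proj)
    have "tr z * W * z = tr u * u + tr (Dm * u) * J * (Dm * u)"
    proof -
      have "tr u * u = tr z * em * z" by (simp add: u_def em_def mult.assoc) (simp flip: mult.assoc)
      moreover have "Dm * u = Dm * z" using DmU by (simp add: u_def flip: mult.assoc)
      ultimately show ?thesis unfolding W_def by (simp add: em_def algebra_simps)
    qed
    then show ?thesis
      using ent_sum_squares[OF u, of j] ent_sgn_quadratic[OF Du, of \<sigma> j] uz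
        ent_block_mult[OF u, of _ P D j] by (simp add: J_def Dm_def)
  qed
  have posW: "em * z = 0" if "tr z * W * z = 0" for z
  proof (rule rcmat_eqI)
    fix i j
    have "\<not> (\<exists>l<m. ent z l j \<noteq> 0)" using pos[of "\<lambda>l. ent z l j"] quadW[of z j] that by auto
    then show "ent (em * z) i j = ent 0 i j" by (simp add: em_def ent_proj_mult)
  qed
  have psdW: "0 \<le> ent (tr z * W * z) 0 0" for z
  proof (cases "\<exists>l<m. ent z l 0 \<noteq> 0")
    case True
    then show ?thesis using pos[of "\<lambda>l. ent z l 0"] quadW[of z 0] by simp
  next
    case False
    then show ?thesis unfolding quadW by simp
  qed
  have lmi0: "0 \<le> ent (lmi A1 B1 Q L W K0 x u) 0 0" if x: "e1 * x = x" and u: "em * u = u" for x u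
  proof -
    define z where "z i = (if i < n1 then ent x i 0 else ent u (i - n1) 0)" for i
    have nz: "next_coord z i = (\<Sum>j<n1. A i j * ent x j 0) + (\<Sum>l<m. Bm i l * ent u l 0)" if "i < n1" for i
      using that by (simp add: next_coord_def z_def)
    have "ent (lmi A1 B1 Q L W K0 x u) 0 0 = supply_rate \<sigma> z -
        (\<Sum>i<n1. \<Sum>j<n1. Q0 i j * (next_coord z i * z j + z i * next_coord z j))"
      unfolding A1_def B1_def Q_def L_def W_def J_def Cm_def Dm_def
      by (subst ent_lmi[OF n1_le_n x[unfolded e1_def] u[unfolded em_def]])
        (auto simp: supply_rate_def z_def nz K0_def ent_block algebra_simps
          intro!: arg_cong2[where f = "(+)"] arg_cong2[where f = "(-)"] sum.cong)
    then show ?thesis using Q0 unfolding dissipation_def by simp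
  qed
  obtain p where p: "peval p A2 * e2 = 0" "coprime p (pcompose p [:0, -1:])"
    using unmixed_annihilator by blast
  have "tr K0 = K0"
    by (rule rcmat_eqI) (use Q0 in \<open>auto simp: K0_def ent_block dissipation_def\<close>)
  moreover have "e1 * K0 = K0" by (simp add: e1_def K0_def proj_block)
  moreover have "e1 * A1 = A1" "A1 * e1 = A1" "e1 * A12 = A12" "A12 * e2 = A12"
    unfolding e1_def A1_def A12_def by (simp_all add: proj_block block_proj)
  moreover have "e1 * B1 = B1" "B1 * em = B1" unfolding e1_def em_def B1_def by (simp_all add: proj_block block_proj)
  moreover have "tr Q = Q" "tr W = W" unfolding Q_def W_def using trJ by (simp_all add: mult.assoc)
  moreover have "em * L = L" unfolding L_def using emD by (simp flip: mult.assoc)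
  moreover have "em * W = W" unfolding W_def using emD by (simp add: em_def distrib_left flip: mult.assoc)
  ultimately have "\<exists>K. tr K = K \<and> (e1 + e2) * K = K \<and> (\<forall>x u. (e1 + e2) * x = x \<longrightarrow> em * u = u \<longrightarrow>
      0 \<le> ent (lmi (A1 + A12 + A2) B1 Q L W K x u) 0 0)"
    unfolding e1_def em_def
    by (intro lmi_extension[where p = p])
      (use A2_corner posW psdW lmi0 controllable_part p in \<open>auto simp: e1_def em_def A1_def B1_def\<close>)
  then obtain K where K: "\<And>x u. (e1 + e2) * x = x \<Longrightarrow> em * u = u \<Longrightarrow>
      0 \<le> ent (lmi (A1 + A12 + A2) B1 Q L W K x u) 0 0" by blast
  have e12: "e1 + e2 = proj {..<n}"
    by (rule rcmat_eqI) (use n1_le_n in \<open>auto simp: e1_def ent_proj\<close>)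
  have AA: "A1 + A12 + A2 = block {..<n} {..<n} A"
    by (rule rcmat_eqI) (use n1_le_n A_low in \<open>auto simp: A1_def A12_def A2_def ent_block not_less\<close>)
  have BB: "B1 = block {..<n} {..<m} Bm"
    by (rule rcmat_eqI) (use n1_le_n B_low in \<open>auto simp: B1_def ent_block not_less\<close>)
  have "deriv (\<lambda>s. \<Sum>i<n. \<Sum>j<n. ent K i j * x i s * x j s) t \<le> (\<Sum>l<m. (w l t)\<^sup>2) + (\<Sum>i<P. \<sigma> i * (w (m + i) t)\<^sup>2)"
    if sol: "solution w x" for w x t
  proof -
    define v where "v i = (\<Sum>j<n. A i j * x j t) + (\<Sum>l<m. Bm i l * w l t)" for i
    have dx: "(x i has_real_derivative v i) (at t)" if "i < n" for i
      using sol that smooth_has_derivative[of "x i" 0 t] unfolding solution_def v_def by simp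
    have out: "w (m + i) t = (\<Sum>j<n. C i j * x j t) + (\<Sum>l<m. D i l * w l t)" if "i < P" for i
      using sol that unfolding solution_def by blast
    have "((\<lambda>s. \<Sum>i<n. \<Sum>j<n. ent K i j * x i s * x j s) has_real_derivative
        (\<Sum>i<n. \<Sum>j<n. ent K i j * (x i t * v j + v i * x j t))) (at t)"
    proof (intro DERIV_sum)
      fix i j assume "i \<in> {..<n}" "j \<in> {..<n}"
      then show "((\<lambda>s. ent K i j * x i s * x j s) has_real_derivative ent K i j * (x i t * v j + v i * x j t)) (at t)"
        by (auto intro!: derivative_eq_intros dx simp: algebra_simps)
    qed
    then have deriv: "deriv (\<lambda>s. \<Sum>i<n. \<Sum>j<n. ent K i j * x i s * x j s) t =
        (\<Sum>i<n. \<Sum>j<n. ent K i j * (x i t * v j + v i * x j t))" by (rule DERIV_imp_deriv)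
    define xv where "xv = block {..<n} {0} (\<lambda>i _. x i t)"
    define uv where "uv = block {..<m} {0} (\<lambda>i _. w i t)"
    have xv: "proj {..<n} * xv = xv" "\<And>i. i < n \<Longrightarrow> ent xv i 0 = x i t"
      unfolding xv_def by (simp_all add: proj_block ent_block)
    have uv: "proj {..<m} * uv = uv" "\<And>i. i < m \<Longrightarrow> ent uv i 0 = w i t"
      unfolding uv_def by (simp_all add: proj_block ent_block)
    have "0 \<le> ent (lmi (A1 + A12 + A2) B1 Q L W K xv uv) 0 0"
      by (rule K) (use xv uv in \<open>simp_all add: e12 em_def\<close>)
    also have "\<dots> = (\<Sum>l<m. (w l t)\<^sup>2) + (\<Sum>i<P. \<sigma> i * (w (m + i) t)\<^sup>2)
        - (\<Sum>i<n. \<Sum>j<n. ent K i j * (x i t * v j + v i * x j t))"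
      unfolding AA BB Q_def L_def W_def J_def Cm_def Dm_def
      by (subst ent_lmi[OF le_refl xv(1) uv(1)])
        (auto simp: xv(2) uv(2) out v_def intro!: arg_cong2[where f = "(+)"] arg_cong2[where f = "(-)"] sum.cong)
    finally show ?thesis unfolding deriv by simp
  qed
  then show ?thesis by (intro exI[of _ "ent K"] allI impI)
qed

end

section \<open>Concatenation, and left inverses of polynomial matrices\<close>

text \<open>The fundamental theorem of calculus on \<open>{- a..0}\<close> and
  \<open>{0..a}\<close>: the outer boundary terms vanish by the support condition, and those at 0
  cancel because \<open>h1\<close> and \<open>h2\<close> agree there.\<close>

lemma integral_concat_derivatives:
  fixes h1 h2 g1 g2 :: "real \<Rightarrow> real"
  assumes h1: "\<And>t. (h1 has_real_derivative g1 t) (at t)" and h2: "\<And>t. (h2 has_real_derivative g2 t) (at t)"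
    and g: "continuous_on UNIV g1" "continuous_on UNIV g2"
    and a: "a > 0" and supp: "\<And>t. \<bar>t\<bar> \<ge> a \<Longrightarrow> h1 t = 0 \<and> h2 t = 0 \<and> g1 t = 0 \<and> g2 t = 0"
    and eq: "h1 0 = h2 0"
  shows "(LINT t|lborel. (if t \<le> 0 then g1 t else g2 t)) = 0"
proof -
  have "has_bochner_integral lborel (\<lambda>x. g1 x * indicator {- a..0} x) (h1 0 - h1 (- a))"
    by (rule has_bochner_integral_FTC_Icc_real)
      (use a h1 g in \<open>auto simp: continuous_on_eq_continuous_at\<close>)
  moreover have "has_bochner_integral lborel (\<lambda>x. g2 x * indicator {0..a} x) (h2 a - h2 0)"
    by (rule has_bochner_integral_FTC_Icc_real)
      (use a h2 g in \<open>auto simp: continuous_on_eq_continuous_at\<close>)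
  ultimately have "has_bochner_integral lborel (\<lambda>x. g1 x * indicator {- a..0} x + g2 x * indicator {0..a} x)
      ((h1 0 - h1 (- a)) + (h2 a - h2 0))"
    by (rule has_bochner_integral_add)
  then have int: "(LINT x|lborel. g1 x * indicator {- a..0} x + g2 x * indicator {0..a} x) = 0"
    using supp[of a] supp[of "- a"] a eq by (simp add: has_bochner_integral_integral_eq)
  have [measurable]: "g1 \<in> borel_measurable borel" "g2 \<in> borel_measurable borel"
    using g by (auto intro: borel_measurable_continuous_onI)
  have "(LINT t|lborel. (if t \<le> 0 then g1 t else g2 t)) =
      (LINT x|lborel. g1 x * indicator {- a..0} x + g2 x * indicator {0..a} x)"
  proof (rule integral_cong_AE)
    have "AE x in lborel. x \<noteq> (0::real)" by (rule AE_lborel_singleton)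
    then show "AE x in lborel. (if x \<le> 0 then g1 x else g2 x) = g1 x * indicator {- a..0} x + g2 x * indicator {0..a} x"
    proof eventually_elim
      case (elim x)
      show ?case using elim supp[of x] by (auto simp: indicator_def)
    qed
  qed simp_all
  then show ?thesis using int by simp
qed

lemma test_function_support:
  assumes "test_function \<phi>"
  obtains a where "a > 0" "\<And>t. \<bar>t\<bar> \<ge> a \<Longrightarrow> \<phi> t = 0 \<and> deriv \<phi> t = 0"
proof -
  have "bounded (closure {t. \<phi> t \<noteq> 0})" using assms unfolding test_function_def by (intro compact_imp_bounded) auto
  then obtain b where b: "b > 0" "\<And>t. t \<in> closure {t. \<phi> t \<noteq> 0} \<Longrightarrow> norm t \<le> b"
    unfolding bounded_pos by blast
  have zero: "\<phi> t = 0" if "\<bar>t\<bar> > b" for t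
    using b(2)[of t] that closure_subset[of "{t. \<phi> t \<noteq> 0}"] by force
  show ?thesis
  \<comment> \<open>The margin 1 leaves a neighbourhood on which \<open>\<phi>\<close> is zero, so
    that its derivative vanishes as well.\<close>
  proof (rule that[of "b + 1"])
    show "b + 1 > 0" using b by simp
    fix t assume t: "b + 1 \<le> \<bar>t\<bar>"
    have "open {t::real. b < \<bar>t\<bar>}" by (intro open_Collect_less continuous_intros)
    then have "\<forall>\<^sub>F s in nhds t. s \<in> {t. b < \<bar>t\<bar>}" using t by (intro eventually_nhds_in_open) auto
    then have "\<forall>\<^sub>F s in nhds t. \<phi> s = (\<lambda>_. 0) s" by eventually_elim (use zero in simp)
    then have "deriv \<phi> t = deriv (\<lambda>_. 0) t" by (rule deriv_cong_ev) simp
    then show "\<phi> t = 0 \<and> deriv \<phi> t = 0" using zero t by simp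
  qed
qed

section \<open>Left inverses over the polynomial ring\<close>

lemma clear_denominators:
  assumes "finite J"
  shows "\<exists>d v. d \<noteq> 0 \<and> (\<forall>j\<in>J. to_fract d * y j = to_fract (v j :: real poly))"
  using assms
proof (induction J rule: finite_induct)
  case empty
  show ?case by (intro exI[of _ 1] exI[of _ "\<lambda>_. 0"]) auto
next
  case (insert a J)
  then obtain d v where dv: "d \<noteq> 0" "\<And>j. j \<in> J \<Longrightarrow> to_fract d * y j = to_fract (v j)" by blast
  obtain b c where bc: "y a = Fraction_Field.Fract b c" "c \<noteq> 0" by (cases "y a")
  have ya: "to_fract c * y a = to_fract b" using bc by (simp add: to_fract_def eq_fract)
  define v' where "v' j = (if j = a then d * b else c * v j)" for j
  have "to_fract (c * d) * y j = to_fract (v' j)" if "j \<in> insert a J" for j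
  proof (cases "j = a")
    case True
    have "to_fract (c * d) * y a = to_fract d * (to_fract c * y a)" by (simp add: algebra_simps)
    then show ?thesis unfolding ya using True by (simp add: v'_def)
  next
    case False
    have "to_fract (c * d) * y j = to_fract c * (to_fract d * y j)" by (simp add: algebra_simps)
    also have "to_fract d * y j = to_fract (v j)" using dv(2) that False by blast
    finally show ?thesis using False by (simp add: v'_def)
  qed
  then show ?case using dv(1) bc(2) by (intro exI[of _ "c * d"] exI[of _ v']) simp
qed

text \<open>A trivial kernel over the rational functions puts every unit row into the row space;
  clearing denominators moves it into the row module at the price of a factor
  \<open>d\<close>.\<close>

lemma row_module_denominator:
  fixes G :: "nat \<Rightarrow> nat \<Rightarrow> real poly"
  assumes ker: "\<And>y. (\<And>l. l < k \<Longrightarrow> (\<Sum>j<N. to_fract (G l j) * y j) = 0) \<Longrightarrow> \<forall>j<N. y j = 0"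
    and i: "i < N"
  shows "\<exists>c d. d \<noteq> 0 \<and> (\<forall>j<N. (\<Sum>l<k. c l * G l j) = (if i = j then d else 0))"
proof -
  have "\<exists>c. \<forall>j\<in>{..<N}. (if i = j then 1 else 0) = (\<Sum>l<k. c l * to_fract (G l j))"
  proof (rule row_space_if_kernel)
    fix y assume "\<forall>l<k. (\<Sum>j<N. to_fract (G l j) * y j) = 0"
    then have "\<forall>j<N. y j = 0" by (intro ker) auto
    then show "(\<Sum>j<N. (if i = j then 1 else 0) * y j) = 0" by simp
  qed simp
  then obtain c where c: "\<And>j. j < N \<Longrightarrow> (if i = j then 1 else 0) = (\<Sum>l<k. c l * to_fract (G l j))" by auto
  obtain d v where dv: "d \<noteq> 0" "\<And>l. l < k \<Longrightarrow> to_fract d * c l = to_fract (v l)"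
    using clear_denominators[of "{..<k}" c] by auto
  have "(\<Sum>l<k. v l * G l j) = (if i = j then d else 0)" if "j < N" for j
  proof -
    have "to_fract (\<Sum>l<k. v l * G l j) = (\<Sum>l<k. to_fract d * c l * to_fract (G l j))"
      unfolding to_fract_sum by (rule sum.cong) (use dv(2) in auto)
    also have "\<dots> = to_fract d * (\<Sum>l<k. c l * to_fract (G l j))" by (simp add: sum_distrib_left mult.assoc)
    also have "\<dots> = to_fract (if i = j then d else 0)" using c[OF that] by auto
    finally show ?thesis by (rule to_fract_eq_iff[THEN iffD1])
  qed
  then show ?thesis using dv(1) by blast
qed

text \<open>Over the fraction field a trivial kernel yields \<open>d e\<^sub>i\<close> in the row module for some
  \<open>d \<noteq> 0\<close>; exponential trajectories show that no root of a minimal such \<open>d\<close> is an obstruction.\<close>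

lemma polynomial_left_inverse:
  fixes G :: "nat \<Rightarrow> nat \<Rightarrow> real poly"
  assumes inj: "\<And>x j. (\<And>j. j < N \<Longrightarrow> smooth (x j)) \<Longrightarrow> (\<And>l t. l < k \<Longrightarrow> rowop N (G l) x t = 0) \<Longrightarrow>
    j < N \<Longrightarrow> x j = (\<lambda>_. 0)"
  shows "\<exists>U. \<forall>i<N. \<forall>j<N. (\<Sum>l<k. U i l * G l j) = (if i = j then 1 else 0)"
proof -
  have den: "\<exists>c d. d \<noteq> 0 \<and> (\<forall>j<N. (\<Sum>l<k. c l * G l j) = (if i = j then d else 0))" if "i < N" for i
  proof (rule row_module_denominator[OF _ that])
    fix y assume y: "\<And>l. l < k \<Longrightarrow> (\<Sum>j<N. to_fract (G l j) * y j) = 0"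
    obtain d v where dv: "d \<noteq> 0" "\<And>j. j < N \<Longrightarrow> to_fract d * y j = to_fract (v j)"
      using clear_denominators[of "{..<N}" y] by auto
    have Gv: "(\<Sum>j<N. G l j * v j) = 0" if l: "l < k" for l
    proof -
      have "to_fract (\<Sum>j<N. G l j * v j) = (\<Sum>j<N. to_fract (G l j) * (to_fract d * y j))"
        unfolding to_fract_sum by (rule sum.cong) (use dv(2) in auto)
      also have "\<dots> = to_fract d * (\<Sum>j<N. to_fract (G l j) * y j)" by (simp add: sum_distrib_left algebra_simps)
      finally have "to_fract (\<Sum>j<N. G l j * v j) = to_fract 0" using y[OF l] by (simp only: mult_zero_right to_fract_0)
      then show ?thesis by (rule to_fract_eq_iff[THEN iffD1])
    qed
    \<comment> \<open>A polynomial kernel vector \<open>v\<close> gives the solutions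
      \<open>v(d/dt) f\<close> for every smooth \<open>f\<close>, and these must be zero.\<close>
    have "v j = 0" if j: "j < N" for j
    proof (rule diff_op_eq_zero_imp)
      fix f t assume f: "smooth f"
      have "(\<lambda>j. diff_op (v j) f) j = (\<lambda>_. 0)"
      proof (rule inj[OF _ _ j])
        show "smooth (diff_op (v j) f)" for j by (rule smooth_diff_op[OF f])
        fix l t assume "l < k"
        have "rowop N (G l) (\<lambda>j. diff_op (v j) f) t = diff_op (\<Sum>j<N. G l j * v j) f t"
          unfolding rowop_def diff_op_sum_poly by (simp add: diff_op_mult[OF f])
        then show "rowop N (G l) (\<lambda>j. diff_op (v j) f) t = 0" using Gv[OF \<open>l < k\<close>] by simp
      qed
      then show "diff_op (v j) f t = 0" by (simp add: fun_eq_iff)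
    qed
    then show "\<forall>j<N. y j = 0" using dv by (metis mult_eq_0_iff to_fract_0 to_fract_eq_0_iff)
  qed
  \<comment> \<open>One factor \<open>d\<close> common to all unit rows, so that the descent can
    lower it for all of them at once.\<close>
  define Pr where "Pr d \<longleftrightarrow> d \<noteq> 0 \<and> (\<forall>i<N. \<exists>c. \<forall>j<N. (\<Sum>l<k. c l * G l j) = (if i = j then d else 0))" for d
  have "\<exists>d. Pr d"
  proof -
    have "\<forall>i\<in>{..<N}. \<exists>d. d \<noteq> 0 \<and> (\<exists>c. \<forall>j<N. (\<Sum>l<k. c l * G l j) = (if i = j then d else 0))"
      using den by blast
    from bchoice[OF this] obtain d where d: "\<And>i. i < N \<Longrightarrow> d i \<noteq> 0"
      "\<And>i. i < N \<Longrightarrow> \<exists>c. \<forall>j<N. (\<Sum>l<k. c l * G l j) = (if i = j then d i else 0)" by auto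
    have "\<exists>c. \<forall>j<N. (\<Sum>l<k. c l * G l j) = (if i = j then \<Prod>i<N. d i else 0)" if i: "i < N" for i
    proof -
      obtain c where c: "\<forall>j<N. (\<Sum>l<k. c l * G l j) = (if i = j then d i else 0)" using d(2)[OF i] by blast
      obtain e where e: "(\<Prod>i<N. d i) = d i * e" using i by (metis dvdE dvd_prodI finite_lessThan lessThan_iff)
      have "(\<Sum>l<k. (e * c l) * G l j) = (if i = j then \<Prod>i<N. d i else 0)" if "j < N" for j
      proof -
        have "(\<Sum>l<k. (e * c l) * G l j) = e * (\<Sum>l<k. c l * G l j)" by (simp add: sum_distrib_left mult.assoc)
        then show ?thesis using c that e by simp
      qed
      then show ?thesis by (intro exI[of _ "\<lambda>l. e * c l"]) simp
    qed
    moreover have "(\<Prod>i<N. d i) \<noteq> 0" using d(1) by simp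
    ultimately show ?thesis unfolding Pr_def by blast
  qed
  then obtain d where "Pr d" and min: "\<And>f. Pr f \<Longrightarrow> degree d \<le> degree f"
    using ex_has_least_nat[of Pr _ degree] by metis
  have d: "d \<noteq> 0" using \<open>Pr d\<close> by (simp add: Pr_def)
  have "\<forall>i\<in>{..<N}. \<exists>c. \<forall>j<N. (\<Sum>l<k. c l * G l j) = (if i = j then d else 0)"
    using \<open>Pr d\<close> unfolding Pr_def by simp
  from bchoice[OF this] obtain c where
    c: "\<And>i j. i < N \<Longrightarrow> j < N \<Longrightarrow> (\<Sum>l<k. c i l * G l j) = (if i = j then d else 0)" by auto
  have "is_unit d"
  proof (rule ccontr)
    assume "\<not> is_unit d"
    then obtain s where s: "cev d s = 0" using cev_root_exists[OF d] by blast
    obtain q where q: "q \<noteq> 0" "cev q s = 0" "\<And>f. cev f s = 0 \<Longrightarrow> q dvd f"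
      using real_minimal_poly[OF d s] by blast
    obtain d' where d': "d = q * d'" using q(3)[OF s] by blast
    \<comment> \<open>A complex kernel vector at \<open>s\<close> gives real exponential solutions;
      the phases \<open>e = 1\<close> and \<open>e = \<i>\<close> detect its real and imaginary
      part.\<close>
    have ker: "y j = 0" if y: "\<forall>l<k. (\<Sum>j<N. cev (G l j) s * y j) = 0" and j: "j < N" for y j
    proof -
      have "Re (e * y j) = 0" for e
      proof -
        define x where "x j t = Re (e * y j * exp (s * of_real t))" for j t
        have "x j = (\<lambda>_. 0)"
        proof (rule inj[OF _ _ j])
          show "smooth (x j)" for j unfolding x_def by (rule smooth_Re_exp)
          fix l t assume l: "l < k"
          have "rowop N (G l) x t = (\<Sum>j<N. Re (cev (G l j) s * (e * y j) * exp (s * of_real t)))"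
            unfolding rowop_def x_def by (simp only: diff_op_Re_exp cev_def)
          also have "\<dots> = Re ((\<Sum>j<N. cev (G l j) s * y j) * (e * exp (s * of_real t)))"
            unfolding sum_distrib_right Re_sum by (intro sum.cong refl arg_cong[where f = Re]) (simp only: ac_simps)
          finally show "rowop N (G l) x t = 0" using y l by simp
        qed
        then show ?thesis unfolding x_def by (metis exp_zero mult.right_neutral mult_zero_right of_real_0)
      qed
      from this[of 1] this[of \<i>] show ?thesis by (simp add: complex_eq_iff)
    qed
    have "\<exists>g. \<forall>j<N. (\<Sum>l<k. g l * G l j) = (if i = j then d' else 0)" if i: "i < N" for i
    proof -
      define r where "r j = (if i = j then 1 else 0 :: real poly)" for j
      have "\<exists>a. \<forall>j\<in>{..<N}. cev (r j) s = (\<Sum>l<k. a l * cev (G l j) s)"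
        by (rule row_space_if_kernel) (use ker in \<open>auto intro!: sum.neutral\<close>)
      then obtain a where "\<And>j. j < N \<Longrightarrow> cev (r j) s = (\<Sum>l<k. a l * cev (G l j) s)" by auto
      from real_combination_at[where N = N and r = r and s = s and c = a, OF this] obtain g where
        g: "\<And>j. j < N \<Longrightarrow> cev (r j - (\<Sum>l<k. g l * G l j)) s = 0" by auto
      then have "\<forall>j\<in>{..<N}. \<exists>h. r j - (\<Sum>l<k. g l * G l j) = q * h"
        using q(3) unfolding dvd_def by simp
      from bchoice[OF this] obtain h where
        h: "\<And>j. j < N \<Longrightarrow> r j - (\<Sum>l<k. g l * G l j) = q * h j" by auto
      \<comment> \<open>Multiplying \<open>r = g G + q h\<close> by \<open>d'\<close> gives
        \<open>d' r = d' g G + d h\<close>, and \<open>d h\<close> is the combination of the rows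
        \<open>c i'\<close> with coefficients \<open>h i'\<close>.\<close>
      define g' where "g' l = d' * g l + (\<Sum>i'<N. h i' * c i' l)" for l
      have "(\<Sum>l<k. g' l * G l j) = (if i = j then d' else 0)" if j: "j < N" for j
      proof -
        have "(\<Sum>l<k. g' l * G l j) = d' * (\<Sum>l<k. g l * G l j) + (\<Sum>i'<N. h i' * (\<Sum>l<k. c i' l * G l j))"
          unfolding g'_def distrib_right sum.distrib sum_distrib_left sum_distrib_right
          by (subst (2) sum.swap) (simp only: mult.assoc)
        also have "(\<Sum>i'<N. h i' * (\<Sum>l<k. c i' l * G l j)) = (\<Sum>i'<N. if i' = j then h i' * d else 0)"
          by (rule sum.cong) (use c j in auto)
        also have "\<dots> = d' * (q * h j)" using j by (simp add: d')
        also have "d' * (\<Sum>l<k. g l * G l j) + d' * (q * h j) = d' * r j"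
          unfolding h[OF j, symmetric] by (simp add: algebra_simps)
        finally show ?thesis by (simp add: r_def)
      qed
      then show ?thesis by (intro exI[of _ g']) simp
    qed
    then have "Pr d'" using d d' unfolding Pr_def by auto
    then have "degree d \<le> degree d'" by (rule min)
    moreover have "degree q \<noteq> 0"
    proof
      assume "degree q = 0"
      then obtain a where "q = [:a:]" by (rule degree_eq_zeroE)
      then show False using q by simp
    qed
    moreover have "degree d = degree q + degree d'" unfolding d' using d d' by (intro degree_mult_eq) auto
    ultimately show False by simp
  qed
  then obtain e where e: "1 = d * e" by (elim dvdE)
  have "(\<Sum>l<k. (e * c i l) * G l j) = (if i = j then 1 else 0)" if "i < N" "j < N" for i j
  proof -
    have "(\<Sum>l<k. (e * c i l) * G l j) = e * (\<Sum>l<k. c i l * G l j)" by (simp add: sum_distrib_left mult.assoc)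
    then show ?thesis using c[OF that] e by (simp add: mult.commute)
  qed
  then show ?thesis by (intro exI[of _ "\<lambda>i l. e * c i l"]) simp
qed

section \<open>Trajectories, quadratic differential forms and transfer matrices\<close>

definition comps :: "(real \<Rightarrow> real vec) \<Rightarrow> nat \<Rightarrow> real \<Rightarrow> real" where
  "comps w j s = w s $ j"

definition traj :: "nat \<Rightarrow> (nat \<Rightarrow> real \<Rightarrow> real) \<Rightarrow> real \<Rightarrow> real vec" where
  "traj n f t = vec n (\<lambda>j. f j t)"

definition mrow :: "'a mat \<Rightarrow> nat \<Rightarrow> nat \<Rightarrow> 'a" where
  "mrow F i j = F $$ (i, j)"

lemma comps_traj [simp]: "j < n \<Longrightarrow> comps (traj n f) j = f j"
  by (auto simp: comps_def traj_def)

lemma traj_comps: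
  assumes "\<And>t. w t \<in> carrier_vec n"
  shows "traj n (comps w) = w"
proof
  fix t
  have "dim_vec (w t) = n" using assms by (rule carrier_vecD)
  then show "traj n (comps w) t = w t" by (intro eq_vecI) (auto simp: traj_def comps_def)
qed

lemma smooth_trajectories_iff:
  "w \<in> smooth_trajectories n \<longleftrightarrow> (\<forall>t. w t \<in> carrier_vec n) \<and> (\<forall>j<n. smooth (comps w j))"
  by (simp add: smooth_trajectories_def comps_def[abs_def])

lemma traj_smooth: "traj n f \<in> smooth_trajectories n \<longleftrightarrow> (\<forall>j<n. smooth (f j))"
  unfolding smooth_trajectories_iff by (auto simp: traj_def)

lemma mat_diff_op_index:
  "i < dim_row F \<Longrightarrow> mat_diff_op F w t $ i = rowop (dim_col F) (mrow F i) (comps w) t"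
  by (simp add: mat_diff_op_def rowop_def mrow_def comps_def[abs_def])

lemma mat_diff_op_dim: "dim_vec (mat_diff_op F w t) = dim_row F"
  by (simp add: mat_diff_op_def)

lemma kernel_behavior_iff:
  "w \<in> kernel_behavior F \<longleftrightarrow> w \<in> smooth_trajectories (dim_col F) \<and>
    (\<forall>i<dim_row F. \<forall>t. rowop (dim_col F) (mrow F i) (comps w) t = 0)"
  unfolding kernel_behavior_def
  by (auto simp: vec_eq_iff mat_diff_op_index mat_diff_op_dim)

lemma full_behavior_iff:
  assumes F: "dim_col F = nw + nx"
  shows "(w, x) \<in> full_behavior nw nx F \<longleftrightarrow>
    w \<in> smooth_trajectories nw \<and> x \<in> smooth_trajectories nx \<and>
    (\<forall>i<dim_row F. \<forall>t. rowop nw (mrow F i) (comps w) t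
      + rowop nx (\<lambda>j. mrow F i (nw + j)) (comps x) t = 0)"
proof -
  have split: "rowop (nw + nx) r (comps (pair_traj w x)) t
      = rowop nw r (comps w) t + rowop nx (\<lambda>j. r (nw + j)) (comps x) t"
    if "w \<in> smooth_trajectories nw" "x \<in> smooth_trajectories nx" for r t
  proof -
    have dims: "\<And>t. dim_vec (w t) = nw" "\<And>t. dim_vec (x t) = nx"
      using that unfolding smooth_trajectories_iff by auto
    have "comps (pair_traj w x) j = comps w j" if "j < nw" for j
      using that dims by (auto simp: comps_def pair_traj_def fun_eq_iff)
    moreover have "comps (pair_traj w x) (nw + j) = comps x j" if "j < nx" for j
      using that dims by (auto simp: comps_def pair_traj_def fun_eq_iff)
    ultimately show ?thesis unfolding rowop_def sum_lessThan_add by simp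
  qed
  have "pair_traj w x \<in> smooth_trajectories (nw + nx)"
    if "w \<in> smooth_trajectories nw" "x \<in> smooth_trajectories nx"
  proof -
    have dims: "\<And>t. w t \<in> carrier_vec nw" "\<And>t. x t \<in> carrier_vec nx"
      "\<And>t. dim_vec (w t) = nw" "\<And>t. dim_vec (x t) = nx"
      using that unfolding smooth_trajectories_iff by auto
    have "smooth (comps (pair_traj w x) j)" if j: "j < nw + nx" for j
    proof (cases "j < nw")
      case True
      then have "comps (pair_traj w x) j = comps w j"
        using dims(3,4) by (auto simp: comps_def pair_traj_def fun_eq_iff)
      then show ?thesis using that \<open>w \<in> smooth_trajectories nw\<close> True unfolding smooth_trajectories_iff by simp
    next
      case False
      then have "comps (pair_traj w x) j = comps x (j - nw)"
        using dims(3,4) j by (auto simp: comps_def pair_traj_def fun_eq_iff)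
      then show ?thesis using j \<open>x \<in> smooth_trajectories nx\<close> False unfolding smooth_trajectories_iff by simp
    qed
    moreover have "pair_traj w x t \<in> carrier_vec (nw + nx)" for t
      unfolding pair_traj_def using dims by auto
    ultimately show ?thesis unfolding smooth_trajectories_iff by blast
  qed
  then show ?thesis unfolding full_behavior_def using F split by (auto simp: kernel_behavior_iff)
qed

section \<open>Supply rates and quadratic differential forms\<close>

lemma scalar_prod_sum: "v \<in> carrier_vec n \<Longrightarrow> w \<in> carrier_vec n \<Longrightarrow> v \<bullet> w = (\<Sum>i<n. v $ i * w $ i)"
  by (simp add: scalar_prod_def lessThan_atLeast0)

lemma quadratic_form_sum:
  fixes A :: "real mat"
  assumes "A \<in> carrier_mat n n" "v \<in> carrier_vec n"
  shows "v \<bullet> (A *\<^sub>v v) = (\<Sum>i<n. \<Sum>j<n. A $$ (i, j) * v $ i * v $ j)"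
proof -
  have "v \<bullet> (A *\<^sub>v v) = (\<Sum>i<n. v $ i * (A *\<^sub>v v) $ i)"
    by (rule scalar_prod_sum) (use assms in auto)
  also have "\<dots> = (\<Sum>i<n. \<Sum>j<n. A $$ (i, j) * v $ i * v $ j)"
  proof (rule sum.cong[OF refl])
    fix i assume "i \<in> {..<n}"
    then have "(A *\<^sub>v v) $ i = (\<Sum>j<n. A $$ (i, j) * v $ j)"
      using assms by (simp add: scalar_prod_def lessThan_atLeast0)
    then show "v $ i * (A *\<^sub>v v) $ i = (\<Sum>j<n. A $$ (i, j) * v $ i * v $ j)"
      by (simp add: sum_distrib_left mult.left_commute mult.assoc)
  qed
  finally show ?thesis .
qed

lemma diag_block_mat_Cons_index:
  assumes "i < dim_row A + dim_row (diag_block_mat As)" "j < dim_col A + dim_col (diag_block_mat As)"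
  shows "diag_block_mat (A # As) $$ (i, j) =
    (if i < dim_row A then if j < dim_col A then A $$ (i, j) else 0
     else if j < dim_col A then 0 else diag_block_mat As $$ (i - dim_row A, j - dim_col A))"
  using assms unfolding diag_block_mat.simps Let_def by (simp add: index_mat_four_block(1))

lemma diag_block_mat_Cons_dims:
  "dim_row (diag_block_mat (A # As)) = dim_row A + dim_row (diag_block_mat As)"
  "dim_col (diag_block_mat (A # As)) = dim_col A + dim_col (diag_block_mat As)"
  unfolding diag_block_mat.simps Let_def by simp_all

lemma J_mat_carrier: "J_mat p q \<in> carrier_mat (q + p) (q + p)"
  unfolding J_mat_def carrier_mat_def by (simp add: diag_block_mat_Cons_dims del: diag_block_mat.simps(2))

lemma J_mat_index:
  assumes "i < q + p" "j < q + p"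
  shows "J_mat p q $$ (i, j) = (if i = j then if i < q then 1 else -1 else 0)"
  using assms unfolding J_mat_def
  by (simp add: diag_block_mat_Cons_dims diag_block_mat_Cons_index del: diag_block_mat.simps(2)) auto

lemma Sigma_mat_carrier: "Sigma_mat m q p \<in> carrier_mat (m + (q + p)) (m + (q + p))"
  unfolding Sigma_mat_def carrier_mat_def by (simp add: diag_block_mat_Cons_dims del: diag_block_mat.simps(2))

lemma Sigma_mat_index:
  assumes "i < m + (q + p)" "j < m + (q + p)"
  shows "Sigma_mat m q p $$ (i, j) = (if i = j then if i < m + q then 1 else -1 else 0)"
proof -
  have "Sigma_mat m q p $$ (i, j) = (if i < m then if j < m then 1\<^sub>m m $$ (i, j) else 0
      else if j < m then 0 else J_mat p q $$ (i - m, j - m))"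
    using assms unfolding Sigma_mat_def J_mat_def
    by (subst diag_block_mat_Cons_index) (simp_all add: diag_block_mat_Cons_dims del: diag_block_mat.simps(2))
  then show ?thesis using assms by (auto simp: J_mat_index)
qed

definition signature :: "nat \<Rightarrow> nat \<Rightarrow> real" where
  "signature q i = (if i < q then 1 else -1)"

lemma Sigma_mat_form:
  assumes "v \<in> carrier_vec (m + (q + p))"
  shows "v \<bullet> (Sigma_mat m q p *\<^sub>v v) = (\<Sum>l<m. (v $ l)\<^sup>2) + (\<Sum>i<q + p. signature q i * (v $ (m + i))\<^sup>2)"
proof -
  have "v \<bullet> (Sigma_mat m q p *\<^sub>v v) = (\<Sum>i<m + (q + p). \<Sum>j<m + (q + p).
      if j = i then (if i < m + q then 1 else -1) * (v $ i)\<^sup>2 else 0)"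
    unfolding quadratic_form_sum[OF Sigma_mat_carrier assms]
    by (intro sum.cong refl) (auto simp: Sigma_mat_index power2_eq_square)
  also have "\<dots> = (\<Sum>i<m + (q + p). (if i < m + q then 1 else -1) * (v $ i)\<^sup>2)"
    by (simp add: sum.delta)
  also have "\<dots> = (\<Sum>l<m. (v $ l)\<^sup>2) + (\<Sum>i<q + p. signature q i * (v $ (m + i))\<^sup>2)"
    unfolding sum_lessThan_add[of _ m "q + p"] by (simp add: signature_def)
  finally show ?thesis .
qed

text \<open>\<open>bilinear_op P f g\<close> applies \<open>P(\<zeta>, \<eta>)\<close> with \<open>\<zeta>\<close> differentiating \<open>f\<close> and \<open>\<eta>\<close>
  differentiating \<open>g\<close>.\<close>

definition bilinear_op :: "real poly poly \<Rightarrow> (real \<Rightarrow> real) \<Rightarrow> (real \<Rightarrow> real) \<Rightarrow> real \<Rightarrow> real" where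
  "bilinear_op P f g t = (\<Sum>j\<le>degree P. (deriv ^^ j) f t * diff_op (coeff P j) g t)"

lemma bilinear_op_altdef:
  assumes "degree P \<le> N"
  shows "bilinear_op P f g t = (\<Sum>j\<le>N. (deriv ^^ j) f t * diff_op (coeff P j) g t)"
  unfolding bilinear_op_def
  by (rule sum.mono_neutral_left) (use assms in \<open>auto simp: coeff_eq_0\<close>)

lemma bilinear_op_0 [simp]: "bilinear_op 0 f g t = 0"
  by (simp add: bilinear_op_def)

lemma bilinear_op_add: "bilinear_op (P + Q) f g t = bilinear_op P f g t + bilinear_op Q f g t"
proof -
  let ?N = "max (degree P) (degree Q)"
  have "degree (P + Q) \<le> ?N" by (rule degree_add_le) auto
  then show ?thesis
    by (simp add: bilinear_op_altdef[of _ ?N] diff_op_add sum.distrib algebra_simps)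
qed

lemma bilinear_op_sum: "bilinear_op (\<Sum>x\<in>X. P x) f g t = (\<Sum>x\<in>X. bilinear_op (P x) f g t)"
  by (induction X rule: infinite_finite_induct) (auto simp: bilinear_op_add)

lemma bilinear_op_product:
  "bilinear_op (map_poly (\<lambda>c. Polynomial.smult (c * s) b) a) f g t = diff_op a f t * s * diff_op b g t"
proof -
  have "bilinear_op (map_poly (\<lambda>c. Polynomial.smult (c * s) b) a) f g t =
      (\<Sum>j\<le>degree a. (deriv ^^ j) f t * diff_op (coeff (map_poly (\<lambda>c. Polynomial.smult (c * s) b) a) j) g t)"
    by (rule bilinear_op_altdef) (rule map_poly_degree_leq)
  then show ?thesis
    by (simp add: coeff_map_poly diff_op_smult diff_op_def[of a] sum_distrib_right mult.assoc)
      (simp add: algebra_simps)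
qed

lemma qdf_bilinear_op:
  "qdf \<Psi> w t = (\<Sum>a<dim_row \<Psi>. \<Sum>b<dim_col \<Psi>. bilinear_op (\<Psi> $$ (a, b)) (comps w a) (comps w b) t)"
  unfolding qdf_def bilinear_op_def diff_op_def comps_def[abs_def]
  by (simp add: sum_distrib_left mult.assoc)

lemma sum_swap_pairs:
  "(\<Sum>a\<in>S. \<Sum>b\<in>S. \<Sum>i\<in>T. \<Sum>j\<in>T. h a b i j) = (\<Sum>i\<in>T. \<Sum>j\<in>T. \<Sum>a\<in>S. \<Sum>b\<in>S. h a b i j)"
proof -
  have "(\<Sum>a\<in>S. \<Sum>b\<in>S. \<Sum>i\<in>T. \<Sum>j\<in>T. h a b i j) = (\<Sum>a\<in>S. \<Sum>i\<in>T. \<Sum>j\<in>T. \<Sum>b\<in>S. h a b i j)"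
    by (intro sum.cong refl) (rule trans[OF sum.swap], intro sum.cong refl, rule sum.swap)
  also have "\<dots> = (\<Sum>i\<in>T. \<Sum>j\<in>T. \<Sum>a\<in>S. \<Sum>b\<in>S. h a b i j)"
    by (rule trans[OF sum.swap], intro sum.cong refl, rule sum.swap)
  finally show ?thesis .
qed

text \<open>Taking \<open>w = 0\<close> in the observability condition shows that the columns of
  \<open>F\<close> acting on \<open>x\<close> have no non-zero smooth solution, hence a polynomial
  left inverse \<open>U\<close>. Applying \<open>U(d/dt)\<close> to the equations solves them for
  \<open>x\<close>.\<close>

lemma observable_imp_state_map:
  assumes F: "dim_col F = nw + nx"
    and obs: "\<And>w x1 x2. (w, x1) \<in> full_behavior nw nx F \<Longrightarrow> (w, x2) \<in> full_behavior nw nx F \<Longrightarrow> x1 = x2"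
  shows "\<exists>X. \<forall>(w, x)\<in>full_behavior nw nx F. \<forall>i<nx. \<forall>t. comps x i t = rowop nw (X i) (comps w) t"
proof -
  define G where "G l j = F $$ (l, nw + j)" for l j
  have G: "(\<lambda>j. mrow F i (nw + j)) = G i" for i by (rule ext) (simp add: G_def mrow_def)
  note full = full_behavior_iff[OF F, unfolded G]
  have zero: "rowop N r (comps (traj N (\<lambda>_ _. 0))) t = 0" for N r t
    unfolding rowop_def by (rule sum.neutral) simp
  have "\<exists>U. \<forall>i<nx. \<forall>j<nx. (\<Sum>l<dim_row F. U i l * G l j) = (if i = j then 1 else 0)"
  proof (rule polynomial_left_inverse)
    fix x j assume x: "\<And>j. j < nx \<Longrightarrow> smooth (x j)" "\<And>l t. l < dim_row F \<Longrightarrow> rowop nx (G l) x t = 0" and j: "j < nx"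
    have "rowop nx (G l) (comps (traj nx x)) t = rowop nx (G l) x t" for l t
      by (rule rowop_cong) auto
    then have "(traj nw (\<lambda>_ _. 0), traj nx x) \<in> full_behavior nw nx F"
      unfolding full using x by (simp add: traj_smooth zero)
    moreover have "(traj nw (\<lambda>_ _. 0), traj nx (\<lambda>_ _. 0)) \<in> full_behavior nw nx F"
      unfolding full by (simp add: traj_smooth zero)
    ultimately have "traj nx x = traj nx (\<lambda>_ _. 0)" by (rule obs)
    then have "comps (traj nx x) j = comps (traj nx (\<lambda>_ _. 0)) j" by simp
    then show "x j = (\<lambda>_. 0)" using j by simp
  qed
  then obtain U where "\<forall>i<nx. \<forall>j<nx. (\<Sum>l<dim_row F. U i l * G l j) = (if i = j then 1 else 0)" ..
  then have U: "\<And>i j. i < nx \<Longrightarrow> j < nx \<Longrightarrow> (\<Sum>l<dim_row F. U i l * G l j) = (if i = j then 1 else 0)" by simp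
  define X where "X i j = - (\<Sum>l<dim_row F. U i l * mrow F l j)" for i j
  have "comps x i t = rowop nw (X i) (comps w) t" if wx: "(w, x) \<in> full_behavior nw nx F" and i: "i < nx" for w x i t
  proof -
    have sw: "\<And>j. j < nw \<Longrightarrow> smooth (comps w j)" and sx: "\<And>j. j < nx \<Longrightarrow> smooth (comps x j)"
      and eq: "\<And>l t. l < dim_row F \<Longrightarrow> rowop nw (mrow F l) (comps w) t + rowop nx (G l) (comps x) t = 0"
      using wx unfolding full smooth_trajectories_iff by auto
    have "diff_op (U i l) (rowop nw (mrow F l) (comps w)) t + diff_op (U i l) (rowop nx (G l) (comps x)) t = 0"
      if "l < dim_row F" for l
    proof -
      \<comment> \<open>Additivity of \<open>diff_op\<close> in the function is available for finite
        sums; the sum of two operators is indexed by booleans.\<close>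
      have "(\<Sum>b\<in>{True, False}. (if b then rowop nw (mrow F l) (comps w) t else rowop nx (G l) (comps x) t)) = 0" for t
        using eq[OF that] by simp
      then have "diff_op (U i l) (\<lambda>t. \<Sum>b\<in>{True, False}. (if b then rowop nw (mrow F l) (comps w) else rowop nx (G l) (comps x)) t) t = 0"
        by (simp add: if_distrib[of "\<lambda>f. f _"] eq[OF that] cong: if_cong)
      moreover have "diff_op (U i l) (\<lambda>t. \<Sum>b\<in>{True, False}. (if b then rowop nw (mrow F l) (comps w) else rowop nx (G l) (comps x)) t) t
        = (\<Sum>b\<in>{True, False}. diff_op (U i l) (if b then rowop nw (mrow F l) (comps w) else rowop nx (G l) (comps x)) t)"
        by (rule diff_op_sum_fun') (auto intro: smooth_rowop sw sx)
      ultimately show ?thesis by simp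
    qed
    then have "(\<Sum>l<dim_row F. diff_op (U i l) (rowop nw (mrow F l) (comps w)) t)
        + (\<Sum>l<dim_row F. diff_op (U i l) (rowop nx (G l) (comps x)) t) = 0"
      unfolding sum.distrib[symmetric] by (intro sum.neutral) auto
    moreover have "(\<Sum>l<dim_row F. diff_op (U i l) (rowop nw (mrow F l) (comps w)) t) = - rowop nw (X i) (comps w) t"
      unfolding X_def using rowop_smult[of nw "-1" "\<lambda>j. \<Sum>l<dim_row F. U i l * mrow F l j"]
      by (simp add: rowop_sum rowop_mult[where f = "comps w", OF sw])
    moreover have "(\<Sum>l<dim_row F. diff_op (U i l) (rowop nx (G l) (comps x)) t) = comps x i t"
    proof -
      have "(\<Sum>l<dim_row F. diff_op (U i l) (rowop nx (G l) (comps x)) t) = rowop nx (\<lambda>j. \<Sum>l<dim_row F. U i l * G l j) (comps x) t"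
        by (simp add: rowop_sum rowop_mult[where f = "comps x", OF sx])
      also have "\<dots> = rowop nx (\<lambda>j. if j = i then 1 else 0) (comps x) t"
        by (rule rowop_cong) (use U i in auto)
      also have "\<dots> = comps x i t" using i by (simp add: rowop_unit)
      finally show ?thesis .
    qed
    ultimately show ?thesis by simp
  qed
  then show ?thesis by (intro exI[of _ X]) auto
qed

lemma state_storage_imp_qdf:
  assumes obs: "observable_state_variable nw nx \<BB> F" and K: "K \<in> carrier_mat nx nx"
    and diss: "\<forall>(w, x)\<in>full_behavior nw nx F. \<forall>t. deriv (\<lambda>s. x s \<bullet> (K *\<^sub>v x s)) t \<le> w t \<bullet> (\<Sigma> *\<^sub>v w t)"
  shows "\<exists>\<Psi>\<in>carrier_mat nw nw. is_storage_function \<Sigma> \<BB> \<Psi>"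
proof -
  have F: "dim_col F = nw + nx" and B: "fst ` full_behavior nw nx F = \<BB>"
    using obs unfolding observable_state_variable_def by auto
  have "\<And>w x1 x2. (w, x1) \<in> full_behavior nw nx F \<Longrightarrow> (w, x2) \<in> full_behavior nw nx F \<Longrightarrow> x1 = x2"
    using obs unfolding observable_state_variable_def by blast
  from observable_imp_state_map[OF F this]
  obtain X where "\<forall>(w, x)\<in>full_behavior nw nx F. \<forall>i<nx. \<forall>t. comps x i t = rowop nw (X i) (comps w) t" ..
  then have X: "\<And>w x i t. (w, x) \<in> full_behavior nw nx F \<Longrightarrow> i < nx \<Longrightarrow> comps x i t = rowop nw (X i) (comps w) t"
    by auto
  \<comment> \<open>The two-variable matrix \<open>X(\<zeta>)^T K X(\<eta>)\<close>, obtained by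
    substituting the state map into the quadratic form of \<open>K\<close>.\<close>
  define \<Psi> where "\<Psi> = mat nw nw (\<lambda>(a, b). \<Sum>i<nx. \<Sum>j<nx.
      map_poly (\<lambda>c. Polynomial.smult (c * K $$ (i, j)) (X j b)) (X i a))"
  have qdf: "qdf \<Psi> w = (\<lambda>s. x s \<bullet> (K *\<^sub>v x s))" if wx: "(w, x) \<in> full_behavior nw nx F" for w x
  proof
    fix t
    have xt: "x t \<in> carrier_vec nx" using wx unfolding full_behavior_iff[OF F] smooth_trajectories_iff by blast
    have "qdf \<Psi> w t = (\<Sum>a<nw. \<Sum>b<nw. \<Sum>i<nx. \<Sum>j<nx.
        diff_op (X i a) (comps w a) t * K $$ (i, j) * diff_op (X j b) (comps w b) t)"
      unfolding qdf_bilinear_op by (simp add: \<Psi>_def bilinear_op_sum bilinear_op_product)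
    also have "\<dots> = (\<Sum>i<nx. \<Sum>j<nx. \<Sum>a<nw. \<Sum>b<nw.
        diff_op (X i a) (comps w a) t * K $$ (i, j) * diff_op (X j b) (comps w b) t)"
      by (rule sum_swap_pairs)
    also have "\<dots> = (\<Sum>i<nx. \<Sum>j<nx. K $$ (i, j) * x t $ i * x t $ j)"
    proof (intro sum.cong refl)
      fix i j assume "i \<in> {..<nx}" "j \<in> {..<nx}"
      then have x: "x t $ i = (\<Sum>a<nw. diff_op (X i a) (comps w a) t)" "x t $ j = (\<Sum>b<nw. diff_op (X j b) (comps w b) t)"
        using X[OF wx] unfolding rowop_def comps_def[of x] by auto
      show "(\<Sum>a<nw. \<Sum>b<nw. diff_op (X i a) (comps w a) t * K $$ (i, j) * diff_op (X j b) (comps w b) t)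
          = K $$ (i, j) * x t $ i * x t $ j"
        unfolding x by (simp add: sum_distrib_left sum_distrib_right algebra_simps)
    qed
    also have "\<dots> = x t \<bullet> (K *\<^sub>v x t)" by (rule quadratic_form_sum[OF K xt, symmetric])
    finally show "qdf \<Psi> w t = x t \<bullet> (K *\<^sub>v x t)" .
  qed
  have "is_storage_function \<Sigma> \<BB> \<Psi>"
    unfolding is_storage_function_def
  proof (intro ballI allI)
    fix w t assume "w \<in> \<BB>"
    then obtain x where "(w, x) \<in> full_behavior nw nx F" using B by force
    then show "deriv (qdf \<Psi> w) t \<le> w t \<bullet> (\<Sigma> *\<^sub>v w t)" using qdf diss by auto
  qed
  moreover have "\<Psi> \<in> carrier_mat nw nw" by (simp add: \<Psi>_def)
  ultimately show ?thesis by blast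
qed

section \<open>Limits at infinity and the transfer matrix\<close>

lemma tendsto_poly_over_power:
  fixes p :: "real poly"
  assumes "degree p \<le> n"
  shows "((\<lambda>x. poly p x / x ^ n) \<longlongrightarrow> coeff p n) at_top"
proof -
  have "((\<lambda>x. \<Sum>k\<le>n. coeff p k * (x ^ k / x ^ n)) \<longlongrightarrow> (\<Sum>k\<le>n. coeff p k * (if k = n then 1 else 0))) at_top"
  proof (intro tendsto_sum tendsto_mult tendsto_const)
    fix k assume "k \<in> {..n}"
    then have k: "k \<le> n" by simp
    show "((\<lambda>x::real. x ^ k / x ^ n) \<longlongrightarrow> (if k = n then 1 else 0)) at_top"
    proof (cases "k = n")
      case True
      have "\<forall>\<^sub>F x::real in at_top. x ^ k / x ^ n = 1"
        using eventually_gt_at_top[of 0] by eventually_elim (simp add: True)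
      then show ?thesis using True by (simp add: tendsto_eventually)
    next
      case False
      then have "n - k > 0" using k by simp
      then have "((\<lambda>x::real. inverse (x ^ (n - k))) \<longlongrightarrow> 0) at_top"
        by (intro tendsto_inverse_0_at_top filterlim_pow_at_top filterlim_ident) auto
      moreover have "\<forall>\<^sub>F x::real in at_top. inverse (x ^ (n - k)) = x ^ k / x ^ n"
        using eventually_gt_at_top[of 0]
        by eventually_elim (use k in \<open>simp add: power_diff field_simps\<close>)
      ultimately show ?thesis using False by (simp add: tendsto_cong)
    qed
  qed
  moreover have "(\<Sum>k\<le>n. coeff p k * (if k = n then 1 else 0)) = coeff p n"
    by (simp add: if_distrib cong: if_cong)
  moreover have "(\<Sum>k\<le>n. coeff p k * (x ^ k / x ^ n)) = poly p x / x ^ n" for x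
  proof -
    have "poly p x = (\<Sum>k\<le>n. coeff p k * x ^ k)"
      unfolding poly_altdef by (rule sum.mono_neutral_left) (use assms in \<open>auto simp: coeff_eq_0\<close>)
    then show ?thesis by (simp add: sum_divide_distrib)
  qed
  ultimately show ?thesis by simp
qed

text \<open>Ties the matrix \<open>D\<close>, given by a limit, to the coefficients that polynomial
  division by \<open>\<delta>\<close> produces. The limit is taken along the positive real axis,
  where eventually \<open>a / b = H / \<delta>\<close>.\<close>

lemma limit_eq_coeff_ratio:
  fixes a b H \<delta> :: "real poly" and d :: real
  assumes nz: "b \<noteq> 0" "\<delta> \<noteq> 0" and deg: "degree H \<le> degree \<delta>" and eq: "a * \<delta> = H * b"
    and lim: "((\<lambda>s. cev a s / cev b s) \<longlongrightarrow> of_real d) at_infinity"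
  shows "d = coeff H (degree \<delta>) / lead_coeff \<delta>"
proof -
  have inf: "filterlim (of_real :: real \<Rightarrow> complex) at_infinity at_top"
    by (rule filterlim_of_real_at_infinity)
  have "((\<lambda>x::real. cev a (of_real x) / cev b (of_real x)) \<longlongrightarrow> of_real d) at_top"
    using filterlim_compose[OF lim inf] .
  then have "((\<lambda>x. complex_of_real (poly a x / poly b x)) \<longlongrightarrow> of_real d) at_top"
    by (simp add: cev_of_real)
  then have "((\<lambda>x. poly a x / poly b x) \<longlongrightarrow> d) at_top" by (simp only: tendsto_of_real_iff)
  have H: "((\<lambda>x. (poly H x / x ^ degree \<delta>) / (poly \<delta> x / x ^ degree \<delta>)) \<longlongrightarrow> coeff H (degree \<delta>) / lead_coeff \<delta>) at_top"
    using nz deg by (intro tendsto_divide tendsto_poly_over_power) auto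
  have ev: "\<forall>\<^sub>F x in at_top. (poly H x / x ^ degree \<delta>) / (poly \<delta> x / x ^ degree \<delta>) = poly a x / poly b x"
  proof -
    have "finite {x. poly (b * \<delta>) x = 0}" using nz by (intro poly_roots_finite) simp
    then have "bdd_above {x. poly (b * \<delta>) x = 0}" by (rule bdd_above_finite)
    then obtain c where c: "\<And>x. poly (b * \<delta>) x = 0 \<Longrightarrow> x \<le> c" unfolding bdd_above_def by auto
    show ?thesis
      using eventually_gt_at_top[of c] eventually_gt_at_top[of 0]
    proof eventually_elim
      case (elim x)
      then have "poly b x \<noteq> 0" "poly \<delta> x \<noteq> 0" using c[of x] by auto
      moreover have "poly a x * poly \<delta> x = poly H x * poly b x" using arg_cong[OF eq, of "\<lambda>p. poly p x"] by simp
      ultimately show ?case using elim by (simp add: field_simps)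
    qed
  qed
  have "((\<lambda>x. poly a x / poly b x) \<longlongrightarrow> coeff H (degree \<delta>) / lead_coeff \<delta>) at_top"
    by (rule Lim_transform_eventually[OF H ev])
  with \<open>((\<lambda>x. poly a x / poly b x) \<longlongrightarrow> d) at_top\<close> show ?thesis
    by (intro tendsto_unique[OF trivial_limit_at_top_linorder])
qed

text \<open>Cramer's rule: up to the factor \<open>det W1\<close>, the inverse of \<open>W1\<close>
  is the polynomial matrix \<open>adj_mat W1\<close>.\<close>

lemma transfer_matrix_adj:
  fixes W1 W2 :: "real poly mat"
  assumes W1: "W1 \<in> carrier_mat m m" and W2: "W2 \<in> carrier_mat P m" and det: "det W1 \<noteq> 0"
  shows "transfer_matrix W1 W2 \<in> carrier_mat P m"
    and "i < P \<Longrightarrow> l < m \<Longrightarrow> transfer_matrix W1 W2 $$ (i, l) * to_fract (det W1)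
      = to_fract (\<Sum>j<m. W2 $$ (i, j) * adj_mat W1 $$ (j, l))"
proof -
  interpret comm_ring_hom "to_fract :: real poly \<Rightarrow> real poly fract"
    by unfold_locales auto
  let ?h = "map_mat (to_fract :: real poly \<Rightarrow> real poly fract)"
  have hW1: "?h W1 \<in> carrier_mat m m" and hW2: "?h W2 \<in> carrier_mat P m" using W1 W2 by auto
  have "det (?h W1) \<noteq> 0" using det by simp
  then have "?h W1 \<in> Units (ring_mat TYPE(real poly fract) m ())"
    by (rule det_non_zero_imp_unit[OF hW1])
  then obtain V where V: "mat_inverse (?h W1) = Some V"
    using mat_inverse(1)[OF hW1, where b = "()"] by (cases "mat_inverse (?h W1)") auto
  from mat_inverse(2)[OF hW1 V] have VV: "V * ?h W1 = 1\<^sub>m m" "V \<in> carrier_mat m m" by auto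
  have T: "transfer_matrix W1 W2 = ?h W2 * V" unfolding transfer_matrix_def V by simp
  then show "transfer_matrix W1 W2 \<in> carrier_mat P m" using hW2 VV by auto
  note adj = adj_mat[OF W1]
  have hadj: "?h (adj_mat W1) \<in> carrier_mat m m" using adj by auto
  have "?h W1 * ?h (adj_mat W1) = to_fract (det W1) \<cdot>\<^sub>m 1\<^sub>m m"
  proof -
    have "?h W1 * ?h (adj_mat W1) = ?h (W1 * adj_mat W1)"
      by (rule mat_hom_mult[OF W1 adj(1), symmetric])
    also have "\<dots> = to_fract (det W1) \<cdot>\<^sub>m 1\<^sub>m m" unfolding adj(2) by (rule eq_matI) auto
    finally show ?thesis .
  qed
  then have "?h W2 * V * (to_fract (det W1) \<cdot>\<^sub>m 1\<^sub>m m) = ?h W2 * V * (?h W1 * ?h (adj_mat W1))" by simp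
  also have "\<dots> = ?h W2 * (V * (?h W1 * ?h (adj_mat W1)))"
    by (rule assoc_mult_mat[OF hW2 VV(2)]) (use hW1 hadj in auto)
  also have "V * (?h W1 * ?h (adj_mat W1)) = V * ?h W1 * ?h (adj_mat W1)"
    by (rule assoc_mult_mat[OF VV(2) hW1 hadj, symmetric])
  also have "\<dots> = ?h (adj_mat W1)" unfolding VV(1) using hadj by simp
  also have "?h W2 * ?h (adj_mat W1) = ?h (W2 * adj_mat W1)"
    by (rule mat_hom_mult[OF W2 adj(1), symmetric])
  finally have eq: "?h W2 * V * (to_fract (det W1) \<cdot>\<^sub>m 1\<^sub>m m) = ?h (W2 * adj_mat W1)" .
  show "transfer_matrix W1 W2 $$ (i, l) * to_fract (det W1) = to_fract (\<Sum>j<m. W2 $$ (i, j) * adj_mat W1 $$ (j, l))"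
    if "i < P" "l < m"
  proof -
    have TV: "?h W2 * V \<in> carrier_mat P m" using hW2 VV by auto
    have "?h W2 * V * (to_fract (det W1) \<cdot>\<^sub>m 1\<^sub>m m) = to_fract (det W1) \<cdot>\<^sub>m (?h W2 * V)"
      using mult_smult_distrib[OF TV one_carrier_mat] right_mult_one_mat[OF TV] by simp
    then have "(to_fract (det W1) \<cdot>\<^sub>m (?h W2 * V)) $$ (i, l) = ?h (W2 * adj_mat W1) $$ (i, l)" using eq by simp
    moreover have "(to_fract (det W1) \<cdot>\<^sub>m (?h W2 * V)) $$ (i, l) = to_fract (det W1) * transfer_matrix W1 W2 $$ (i, l)"
      unfolding T using TV that by (subst index_smult_mat(1)) auto
    moreover have "?h (W2 * adj_mat W1) $$ (i, l) = to_fract (\<Sum>j<m. W2 $$ (i, j) * adj_mat W1 $$ (j, l))"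
      using W2 adj(1) that by (simp add: scalar_prod_def lessThan_atLeast0)
    ultimately show ?thesis by (simp add: mult.commute)
  qed
qed

section \<open>State representations\<close>

text \<open>The kernel form of \<open>x' = A x + B u\<close>, \<open>y = C x + D u\<close>, with
  columns in the order inputs, outputs, states.\<close>

definition state_mat :: "nat \<Rightarrow> nat \<Rightarrow> nat \<Rightarrow> (nat \<Rightarrow> nat \<Rightarrow> real) \<Rightarrow> (nat \<Rightarrow> nat \<Rightarrow> real) \<Rightarrow>
    (nat \<Rightarrow> nat \<Rightarrow> real) \<Rightarrow> (nat \<Rightarrow> nat \<Rightarrow> real) \<Rightarrow> real poly mat" where
  "state_mat m P n A B C D = mat (n + P) (m + P + n) (\<lambda>(i, j).
    if i < n then
      (if j < m then [:- B i j:] else if j < m + P then 0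
       else (if j - (m + P) = i then xi else 0) - [:A i (j - (m + P)):])
    else
      (if j < m then [:- D (i - n) j:] else if j < m + P then (if j - m = i - n then 1 else 0)
       else [:- C (i - n) (j - (m + P)):]))"

lemma state_mat_dims [simp]: "dim_row (state_mat m P n A B C D) = n + P" "dim_col (state_mat m P n A B C D) = m + P + n"
  by (simp_all add: state_mat_def)

lemma state_mat_state_row:
  assumes "i < n"
  shows "(\<Sum>j<m + P + n. g (state_mat m P n A B C D $$ (i, j)) j) =
    (\<Sum>l<m. g [:- B i l:] l) + (\<Sum>l<P. g 0 (m + l))
    + (\<Sum>j<n. g ((if j = i then xi else 0) - [:A i j:]) (m + P + j))"
  unfolding sum_lessThan_add using assms by (simp add: state_mat_def)

lemma state_mat_output_row:
  assumes "i < P"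
  shows "(\<Sum>j<m + P + n. g (state_mat m P n A B C D $$ (n + i, j)) j) =
    (\<Sum>l<m. g [:- D i l:] l) + (\<Sum>l<P. g (if l = i then 1 else 0) (m + l))
    + (\<Sum>j<n. g [:- C i j:] (m + P + j))"
  unfolding sum_lessThan_add using assms by (simp add: state_mat_def)

definition state_equations_hold :: "nat \<Rightarrow> nat \<Rightarrow> nat \<Rightarrow> (nat \<Rightarrow> nat \<Rightarrow> real) \<Rightarrow> (nat \<Rightarrow> nat \<Rightarrow> real) \<Rightarrow>
    (nat \<Rightarrow> nat \<Rightarrow> real) \<Rightarrow> (nat \<Rightarrow> nat \<Rightarrow> real) \<Rightarrow> (nat \<Rightarrow> real \<Rightarrow> real) \<Rightarrow> (nat \<Rightarrow> real \<Rightarrow> real) \<Rightarrow> bool" where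
  "state_equations_hold m P n A B C D w x \<longleftrightarrow>
    (\<forall>i<n. \<forall>t. deriv (x i) t = (\<Sum>j<n. A i j * x j t) + (\<Sum>l<m. B i l * w l t)) \<and>
    (\<forall>i<P. \<forall>t. w (m + i) t = (\<Sum>j<n. C i j * x j t) + (\<Sum>l<m. D i l * w l t))"

lemma full_behavior_state_mat:
  "(w, x) \<in> full_behavior (m + P) n (state_mat m P n A B C D) \<longleftrightarrow>
    w \<in> smooth_trajectories (m + P) \<and> x \<in> smooth_trajectories n \<and>
    state_equations_hold m P n A B C D (comps w) (comps x)"
proof -
  let ?F = "state_mat m P n A B C D"
  let ?y = "\<lambda>j. if j < m + P then comps w j else comps x (j - (m + P))"
  have row: "rowop (m + P) (mrow ?F i) (comps w) t + rowop n (\<lambda>j. mrow ?F i (m + P + j)) (comps x) t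
      = (\<Sum>j<m + P + n. diff_op (?F $$ (i, j)) (?y j) t)" for i t
    unfolding sum_lessThan_add[of _ "m + P" n] rowop_def mrow_def by simp
  have s: "rowop (m + P) (mrow ?F i) (comps w) t + rowop n (\<lambda>j. mrow ?F i (m + P + j)) (comps x) t
      = deriv (comps x i) t - (\<Sum>j<n. A i j * comps x j t) - (\<Sum>l<m. B i l * comps w l t)" if i: "i < n" for i t
  proof -
    have "(\<Sum>j<n. diff_op (if j = i then xi else 0) (comps x j) t) = (\<Sum>j<n. if j = i then deriv (comps x j) t else 0)"
      by (rule sum.cong) (auto simp: diff_op_xi)
    then show ?thesis unfolding row state_mat_state_row[OF i, of "\<lambda>r j. diff_op r (?y j) t"]
      using i by (simp add: diff_op_diff sum_subtractf sum_negf)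
  qed
  have o: "rowop (m + P) (mrow ?F (n + i)) (comps w) t + rowop n (\<lambda>j. mrow ?F (n + i) (m + P + j)) (comps x) t
      = comps w (m + i) t - (\<Sum>j<n. C i j * comps x j t) - (\<Sum>l<m. D i l * comps w l t)" if i: "i < P" for i t
  proof -
    have "(\<Sum>l<P. diff_op (if l = i then 1 else 0) (comps w (m + l)) t) = (\<Sum>l<P. if l = i then comps w (m + l) t else 0)"
      by (rule sum.cong) auto
    then show ?thesis unfolding row state_mat_output_row[OF i, of "\<lambda>r j. diff_op r (?y j) t"]
      using i by (simp add: sum_negf)
  qed
  have split: "(\<forall>i<n + P. Q i) \<longleftrightarrow> (\<forall>i<n. Q i) \<and> (\<forall>i<P. Q (n + i))" for Q
    by (metis add_less_cancel_left le_add_diff_inverse not_le trans_less_add1)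
  have zero: "a - b = c \<longleftrightarrow> a = b + c" for a b c :: real by auto
  show ?thesis
    unfolding full_behavior_iff[OF state_mat_dims(2)] state_mat_dims(1) state_equations_hold_def split
    by (simp add: s o zero)
qed

text \<open>Against a test function \<open>\<phi>\<close>, the integrand of a state row is on each
  half-line the derivative of \<open>- (\<phi> * x i)\<close>, and the boundary terms at 0 cancel
  because the two states agree there. Output rows contain no derivative and hold pointwise.\<close>

lemma state_mat_state_property: "state_property (m + P) n (state_mat m P n A B C D)"
  unfolding state_property_def
proof (intro ballI case_prodI2 impI)
  fix w1 x1 w2 x2 z1 z2
  let ?F = "state_mat m P n A B C D"
  assume z: "z1 \<in> full_behavior (m + P) n ?F" "z2 \<in> full_behavior (m + P) n ?F"
    "z1 = (w1, x1)" "z2 = (w2, x2)" and init: "x1 0 = x2 0"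
  note traj = z(1)[unfolded z(3) full_behavior_state_mat] z(2)[unfolded z(4) full_behavior_state_mat]
  define f where "f = concat_at_0 (pair_traj w1 x1) (pair_traj w2 x2)"
  have dims: "dim_vec (w1 t) = m + P" "dim_vec (w2 t) = m + P" "dim_vec (x1 t) = n" "dim_vec (x2 t) = n" for t
    using traj unfolding smooth_trajectories_iff by auto
  have fw: "f t $ j = (if t \<le> 0 then comps w1 j t else comps w2 j t)" if "j < m + P" for j t
    using that dims by (simp add: f_def concat_at_0_def pair_traj_def comps_def)
  have fx: "f t $ (m + P + j) = (if t \<le> 0 then comps x1 j t else comps x2 j t)" if "j < n" for j t
    using that dims by (simp add: f_def concat_at_0_def pair_traj_def comps_def)
  have comp0: "pcompose [:c:] [:0, -1:] = [:c:]" for c :: real by simp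
  have compxi: "pcompose xi [:0, -1:] = - xi" by (simp add: xi_def pcompose_pCons)
  have "(LINT t|lborel. (\<Sum>j<m + P + n. diff_op (pcompose (?F $$ (i, j)) [:0, -1:]) \<phi> t * f t $ j)) = 0"
    if \<phi>: "test_function \<phi>" and i: "i < n + P" for \<phi> i
  proof (cases "i < n")
    case True
    define g where "g w x t = (\<Sum>l<m. - B i l * \<phi> t * w l t)
      + (\<Sum>j<n. ((if j = i then - deriv \<phi> t else 0) - A i j * \<phi> t) * x j t)" for w x :: "nat \<Rightarrow> real \<Rightarrow> real" and t
    have integrand: "(\<Sum>j<m + P + n. diff_op (pcompose (?F $$ (i, j)) [:0, -1:]) \<phi> t * f t $ j)
        = (if t \<le> 0 then g (comps w1) (comps x1) t else g (comps w2) (comps x2) t)" for t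
    proof -
      have "diff_op (pcompose ((if j = i then xi else 0) - [:A i j:]) [:0, -1:]) \<phi> t
          = (if j = i then - deriv \<phi> t else 0) - A i j * \<phi> t" for j
        by (simp add: pcompose_diff compxi diff_op_diff diff_op_minus diff_op_xi)
      then show ?thesis
        unfolding state_mat_state_row[OF True, of "\<lambda>r j. diff_op (pcompose r [:0, -1:]) \<phi> t * f t $ j"]
        by (simp add: fw fx g_def)
    qed
    have s\<phi>: "smooth \<phi>" using \<phi> unfolding test_function_def by blast
    have d\<phi>: "(\<phi> has_real_derivative deriv \<phi> t) (at t)" for t
      using smooth_has_derivative[OF s\<phi>, of 0 t] by simp
    have geq: "g (comps w) (comps x) t = - (deriv \<phi> t * comps x i t + \<phi> t * deriv (comps x i) t)"
      if "state_equations_hold m P n A B C D (comps w) (comps x)" for w x t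
    proof -
      have "(\<Sum>j<n. ((if j = i then - deriv \<phi> t else 0) - A i j * \<phi> t) * comps x j t)
          = (\<Sum>j<n. (if j = i then - deriv \<phi> t * comps x j t else 0) - \<phi> t * (A i j * comps x j t))"
        by (rule sum.cong) (auto simp: algebra_simps)
      also have "\<dots> = - deriv \<phi> t * comps x i t - \<phi> t * (\<Sum>j<n. A i j * comps x j t)"
        using True by (simp add: sum_subtractf sum_distrib_left)
      finally have "g (comps w) (comps x) t = - deriv \<phi> t * comps x i t
          - \<phi> t * ((\<Sum>j<n. A i j * comps x j t) + (\<Sum>l<m. B i l * comps w l t))"
        unfolding g_def by (simp add: sum_distrib_left sum_negf algebra_simps)
      then show ?thesis using that True unfolding state_equations_hold_def by simp
    qed
    obtain a where a: "a > 0" "\<And>t. \<bar>t\<bar> \<ge> a \<Longrightarrow> \<phi> t = 0 \<and> deriv \<phi> t = 0"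
      using test_function_support[OF \<phi>] by blast
    have dh: "((\<lambda>t. - (\<phi> t * comps x i t)) has_real_derivative g (comps w) (comps x) t) (at t)"
      and cg: "continuous_on UNIV (g (comps w) (comps x))"
      if "w \<in> smooth_trajectories (m + P) \<and> x \<in> smooth_trajectories n \<and>
        state_equations_hold m P n A B C D (comps w) (comps x)" for w x t
    proof -
      have sx: "smooth (comps x i)" using that True unfolding smooth_trajectories_iff by blast
      have dx: "(comps x i has_real_derivative deriv (comps x i) t) (at t)" for t
        using smooth_has_derivative[OF sx, of 0 t] by simp
      have "state_equations_hold m P n A B C D (comps w) (comps x)" using that by blast
      note geq = geq[OF this]
      show "((\<lambda>t. - (\<phi> t * comps x i t)) has_real_derivative g (comps w) (comps x) t) (at t)"
        unfolding geq by (auto intro!: derivative_eq_intros d\<phi> dx simp: algebra_simps)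
      have cont: "continuous_on UNIV h" if "smooth h" for h
        using smooth_has_derivative[OF that, of 0]
        by (auto intro!: continuous_at_imp_continuous_on DERIV_isCont)
      have "g (comps w) (comps x) = (\<lambda>t. - (deriv \<phi> t * comps x i t + \<phi> t * deriv (comps x i) t))"
        using geq by auto
      then show "continuous_on UNIV (g (comps w) (comps x))"
        using cont[OF s\<phi>] cont[OF sx] cont[OF smooth_deriv[OF s\<phi>]] cont[OF smooth_deriv[OF sx]]
        by (simp only:) (intro continuous_intros)
    qed
    show ?thesis unfolding integrand
    proof (rule integral_concat_derivatives[OF dh[OF traj(1)] dh[OF traj(2)] cg[OF traj(1)] cg[OF traj(2)] a(1)])
      fix t assume "a \<le> \<bar>t\<bar>"
      then have "\<phi> t = 0 \<and> deriv \<phi> t = 0" by (rule a(2))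
      then show "- (\<phi> t * comps x1 i t) = 0 \<and> - (\<phi> t * comps x2 i t) = 0 \<and>
          g (comps w1) (comps x1) t = 0 \<and> g (comps w2) (comps x2) t = 0"
        by (auto simp: g_def intro!: sum.neutral)
    next
      show "- (\<phi> 0 * comps x1 i 0) = - (\<phi> 0 * comps x2 i 0)" using init by (simp add: comps_def)
    qed
  next
    case False
    define i' where "i' = i - n"
    have i': "i = n + i'" "i' < P" using False i by (auto simp: i'_def)
    have zero: "\<phi> t * (comps w (m + i') t - (\<Sum>j<n. C i' j * comps x j t) - (\<Sum>l<m. D i' l * comps w l t)) = 0"
      if "state_equations_hold m P n A B C D (comps w) (comps x)" for w x t
      using that i'(2) unfolding state_equations_hold_def by simp
    have "(\<Sum>j<m + P + n. diff_op (pcompose (?F $$ (i, j)) [:0, -1:]) \<phi> t * f t $ j) = 0" for t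
    proof -
      have "(\<Sum>l<P. diff_op (pcompose (if l = i' then 1 else 0) [:0, -1:]) \<phi> t * f t $ (m + l))
          = (\<Sum>l<P. if l = i' then \<phi> t * f t $ (m + l) else 0)"
        by (rule sum.cong) (auto simp: pcompose_1)
      then have "(\<Sum>j<m + P + n. diff_op (pcompose (?F $$ (i, j)) [:0, -1:]) \<phi> t * f t $ j)
          = (\<Sum>l<m. - D i' l * \<phi> t * f t $ l) + \<phi> t * f t $ (m + i') + (\<Sum>j<n. - C i' j * \<phi> t * f t $ (m + P + j))"
        unfolding i'(1) state_mat_output_row[OF i'(2), of "\<lambda>r j. diff_op (pcompose r [:0, -1:]) \<phi> t * f t $ j"]
        using i'(2) by simp
      also have "\<dots> = (if t \<le> 0
          then \<phi> t * (comps w1 (m + i') t - (\<Sum>j<n. C i' j * comps x1 j t) - (\<Sum>l<m. D i' l * comps w1 l t))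
          else \<phi> t * (comps w2 (m + i') t - (\<Sum>j<n. C i' j * comps x2 j t) - (\<Sum>l<m. D i' l * comps w2 l t)))"
        using i'(2) by (simp add: fw fx) (simp add: right_diff_distrib sum_distrib_left sum_negf algebra_simps)
      also have "\<dots> = 0" using zero traj by simp
      finally show ?thesis .
    qed
    then show ?thesis by simp
  qed
  then show "distributional_solution ?F (concat_at_0 (pair_traj w1 x1) (pair_traj w2 x2))"
    unfolding distributional_solution_def f_def by simp
qed

section \<open>Behaviors with an observable image representation\<close>

locale behavior_data =
  fixes m q p :: nat and R W1 W2 :: "real poly mat" and D :: "real mat"
    and \<BB> \<BB>cont :: "(real \<Rightarrow> real vec) set"
  assumes dim_R: "dim_col R = m + q + p" and B_eq: "\<BB> = kernel_behavior R"
    and card: "input_cardinality R = m"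
    and modes: "uncontrollable_modes R \<inter> uminus ` uncontrollable_modes R = {}"
    and sub: "\<BB>cont \<subseteq> \<BB>" and W1: "W1 \<in> carrier_mat m m" and W2: "W2 \<in> carrier_mat (q + p) m"
    and img: "\<BB>cont = image_behavior (W1 @\<^sub>r W2)" and obs: "observable_image (W1 @\<^sub>r W2)"
    and det: "det W1 \<noteq> 0" and proper: "proper (transfer_matrix W1 W2)"
    and lim: "limit_at_infinity (transfer_matrix W1 W2) D"
    and pos: "positive_definite (1\<^sub>m m + D\<^sup>T * J_mat p q * D)"
begin

abbreviation "P \<equiv> q + p"
abbreviation "M \<equiv> mrow (W1 @\<^sub>r W2)"
abbreviation "Nt \<equiv> mrow (adj_mat W1)"
abbreviation "\<delta> \<equiv> det W1"
abbreviation "k \<equiv> dim_row R"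

definition Bf :: "(nat \<Rightarrow> real \<Rightarrow> real) set" where
  "Bf = {f. (\<forall>j<m + P. smooth (f j)) \<and> (\<forall>i<k. \<forall>t. rowop (m + P) (mrow R i) f t = 0)}"

lemma dim_R': "dim_col R = m + P"
  using dim_R by simp

lemma M_carrier: "W1 @\<^sub>r W2 \<in> carrier_mat (m + P) m"
  using W1 W2 by simp

lemma M_index: "j < m \<Longrightarrow> i < m \<Longrightarrow> M i j = W1 $$ (i, j)" "j < m \<Longrightarrow> i < P \<Longrightarrow> M (m + i) j = W2 $$ (i, j)"
  using W1 W2 unfolding mrow_def append_rows_def by auto

lemma B_iff: "w \<in> \<BB> \<longleftrightarrow> (\<forall>t. w t \<in> carrier_vec (m + P)) \<and> comps w \<in> Bf"
  unfolding B_eq kernel_behavior_iff dim_R' smooth_trajectories_iff Bf_def by auto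

lemma image_traj:
  assumes "\<And>j. j < m \<Longrightarrow> smooth (v j)"
  shows "mat_diff_op (W1 @\<^sub>r W2) (traj m v) \<in> \<BB>cont"
    and "i < m + P \<Longrightarrow> comps (mat_diff_op (W1 @\<^sub>r W2) (traj m v)) i = rowop m (M i) v"
proof -
  have dims: "dim_row (W1 @\<^sub>r W2) = m + P" "dim_col (W1 @\<^sub>r W2) = m" using M_carrier by auto
  show "mat_diff_op (W1 @\<^sub>r W2) (traj m v) \<in> \<BB>cont"
    unfolding img image_behavior_def dims using assms by (intro imageI) (simp add: traj_smooth)
  show "comps (mat_diff_op (W1 @\<^sub>r W2) (traj m v)) i = rowop m (M i) v" if "i < m + P"
  proof
    fix t
    have "rowop m (M i) (comps (traj m v)) t = rowop m (M i) v t" by (rule rowop_cong) auto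
    then show "comps (mat_diff_op (W1 @\<^sub>r W2) (traj m v)) i t = rowop m (M i) v t"
      using mat_diff_op_index[of i "W1 @\<^sub>r W2" "traj m v" t] that unfolding dims comps_def by simp
  qed
qed

lemma image_Bf:
  assumes "\<And>j. j < m \<Longrightarrow> smooth (v j)"
  shows "(\<lambda>i. rowop m (M i) v) \<in> Bf"
proof -
  have "comps (mat_diff_op (W1 @\<^sub>r W2) (traj m v)) \<in> Bf"
    using image_traj(1)[of v, OF assms] sub B_iff by blast
  moreover have "rowop (m + P) r (comps (mat_diff_op (W1 @\<^sub>r W2) (traj m v))) t = rowop (m + P) r (\<lambda>i. rowop m (M i) v) t" for r t
    by (rule rowop_cong) (use image_traj(2)[of v, OF assms] in auto)
  moreover have "smooth (rowop m (M i) v)" for i by (rule smooth_rowop) (rule assms)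
  ultimately show ?thesis unfolding Bf_def by auto
qed

lemma RM_zero:
  assumes l: "l < k" and i: "i < m"
  shows "(\<Sum>j<m + P. mrow R l j * M j i) = 0"
proof (rule rowop_eq_zero_imp[where r = "\<lambda>i. \<Sum>j<m + P. mrow R l j * M j i", OF _ i])
  fix v t assume v: "\<And>j. j < m \<Longrightarrow> smooth (v j :: real \<Rightarrow> real)"
  have "rowop (m + P) (mrow R l) (\<lambda>i. rowop m (M i) v) t = 0"
    using image_Bf[of v, OF v] l unfolding Bf_def by blast
  then show "rowop m (\<lambda>i. \<Sum>j<m + P. mrow R l j * M j i) v t = 0"
    using rowop_rowop[where l = v and N = "m + P" and M = M, OF v] by simp
qed

lemma MN: "i < m \<Longrightarrow> l < m \<Longrightarrow> (\<Sum>j<m. M i j * Nt j l) = (if i = l then \<delta> else 0)"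
proof -
  assume il: "i < m" "l < m"
  have "(\<Sum>j<m. M i j * Nt j l) = (W1 * adj_mat W1) $$ (i, l)"
    using il W1 adj_mat(1)[OF W1] M_index(1) by (simp add: scalar_prod_def lessThan_atLeast0 mrow_def[of "adj_mat W1"])
  then show ?thesis unfolding adj_mat(2)[OF W1] using il by simp
qed

lemma NM: "i < m \<Longrightarrow> l < m \<Longrightarrow> (\<Sum>j<m. Nt i j * M j l) = (if i = l then \<delta> else 0)"
proof -
  assume il: "i < m" "l < m"
  have "(\<Sum>j<m. Nt i j * M j l) = (adj_mat W1 * W1) $$ (i, l)"
    using il W1 adj_mat(1)[OF W1] M_index(1) by (simp add: scalar_prod_def lessThan_atLeast0 mrow_def[of "adj_mat W1"])
  then show ?thesis unfolding adj_mat(3)[OF W1] using il by simp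
qed

lemma rank_R: "poly_mat_rank R = P"
proof -
  have "poly_mat_rank R \<le> m + P"
    unfolding poly_mat_rank_def by (rule vec_space.rank_le_nc, rule carrier_matI) (simp_all add: dim_R')
  then show ?thesis using card unfolding input_cardinality_def dim_R' by simp
qed

lemma transfer_index:
  assumes "i < P" "l < m"
  shows "transfer_matrix W1 W2 $$ (i, l) * to_fract \<delta> = to_fract (\<Sum>j<m. M (m + i) j * Nt j l)"
proof -
  have "(\<Sum>j<m. M (m + i) j * Nt j l) = (\<Sum>j<m. W2 $$ (i, j) * adj_mat W1 $$ (j, l))"
    by (rule sum.cong) (use assms M_index(2) in \<open>auto simp: mrow_def[of "adj_mat W1"]\<close>)
  then show ?thesis using transfer_matrix_adj(2)[OF W1 W2 det assms] by simp
qed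

lemma transfer_fraction:
  assumes il: "i < P" "l < m" and ab: "b \<noteq> 0" "transfer_matrix W1 W2 $$ (i, l) = Fraction_Field.Fract a b"
  shows "a * \<delta> = (\<Sum>j<m. M (m + i) j * Nt j l) * b"
proof -
  have "Fraction_Field.Fract a b * to_fract \<delta> = to_fract (\<Sum>j<m. M (m + i) j * Nt j l)"
    using transfer_index[OF il] ab(2) by simp
  then show ?thesis using ab(1) unfolding to_fract_def by (simp add: eq_fract)
qed

lemma transfer_dims: "dim_row (transfer_matrix W1 W2) = P" "dim_col (transfer_matrix W1 W2) = m"
  using transfer_matrix_adj(1)[OF W1 W2 det] by auto

lemma degree_le:
  assumes il: "i < P" "l < m"
  shows "degree (\<Sum>j<m. M (m + i) j * Nt j l) \<le> degree \<delta>" (is "degree ?H \<le> _")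
proof (cases "?H = 0")
  case False
  obtain a b where ab: "b \<noteq> 0" "transfer_matrix W1 W2 $$ (i, l) = Fraction_Field.Fract a b" "degree a \<le> degree b"
    using proper il unfolding proper_def transfer_dims by metis
  have eq: "a * \<delta> = ?H * b" by (rule transfer_fraction[OF il ab(1,2)])
  then have "a \<noteq> 0" using False ab(1) by auto
  then have "degree a + degree \<delta> = degree ?H + degree b"
    using eq det ab(1) False by (metis degree_mult_eq)
  then show ?thesis using ab(3) by simp
qed simp

lemma D_carrier: "D \<in> carrier_mat P m"
  using lim unfolding limit_at_infinity_def transfer_dims by blast

lemma D_index:
  assumes il: "i < P" "l < m"
  shows "D $$ (i, l) = coeff (\<Sum>j<m. M (m + i) j * Nt j l) (degree \<delta>) / lead_coeff \<delta>"
proof -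
  obtain a b where ab: "b \<noteq> 0" "transfer_matrix W1 W2 $$ (i, l) = Fraction_Field.Fract a b"
    "((\<lambda>s. cev a s / cev b s) \<longlongrightarrow> of_real (D $$ (i, l))) at_infinity"
    using conjunct2[OF lim[unfolded limit_at_infinity_def transfer_dims], rule_format, OF il]
    unfolding cev_def by (elim exE conjE)
  show ?thesis
    by (rule limit_eq_coeff_ratio[OF ab(1) det degree_le[OF il] transfer_fraction[OF il ab(1,2)] ab(3)])
qed

text \<open>A rational kernel vector of the output columns, extended by zero inputs, would be
  independent of the \<open>m\<close> columns of \<open>M\<close>, whose input block is nonsingular.
  \<open>R\<close> would then have \<open>m + 1\<close> independent kernel vectors, which
  contradicts rank \<open>P\<close>.\<close>

lemma outputs:
  assumes "i < P"
  shows "\<exists>c d. d \<noteq> 0 \<and> (\<forall>j<P. (\<Sum>l<k. c l * mrow R l (m + j)) = (if i = j then d else 0))"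
proof (rule row_module_denominator[OF _ assms], rule ccontr)
  fix y assume y: "\<And>l. l < k \<Longrightarrow> (\<Sum>j<P. to_fract (mrow R l (m + j)) * y j) = 0" and "\<not> (\<forall>j<P. y j = 0)"
  then obtain j0 where j0: "j0 < P" "y j0 \<noteq> 0" by blast
  define X where "X l j = (if l < m then to_fract (M j l) else if j < m then 0 else y (j - m))" for l j
  have "vec_space.rank k (map_mat to_fract R) + Suc m \<le> m + P"
  proof (rule rank_plus_kernel_le[where X = X])
    show "map_mat to_fract R \<in> carrier_mat k (m + P)" by (rule carrier_matI) (simp_all add: dim_R')
    fix i l assume i: "i < k" and l: "l < Suc m"
    have R: "map_mat to_fract R $$ (i, j) = to_fract (mrow R i j)" if "j < m + P" for j
      using i that dim_R' by (simp add: mrow_def)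
    show "(\<Sum>j<m + P. map_mat to_fract R $$ (i, j) * X l j) = 0"
    proof (cases "l < m")
      case True
      have "(\<Sum>j<m + P. map_mat to_fract R $$ (i, j) * X l j) = to_fract (\<Sum>j<m + P. mrow R i j * M j l)"
        unfolding to_fract_sum by (rule sum.cong) (auto simp: R X_def True)
      then show ?thesis using RM_zero[OF i True] by (simp only: to_fract_0)
    next
      case False
      have "(\<Sum>j<m + P. map_mat to_fract R $$ (i, j) * X l j) = (\<Sum>j<m + P. to_fract (mrow R i j) * X l j)"
        by (rule sum.cong) (auto simp: R)
      then show ?thesis unfolding sum_lessThan_add[of _ m P] using y[OF i] False by (simp add: X_def)
    qed
  next
    fix c assume c: "\<And>j. j < m + P \<Longrightarrow> (\<Sum>l<Suc m. c l * X l j) = 0"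
    have low: "(\<Sum>l<m. c l * to_fract (M j l)) = 0" if "j < m" for j
      using c[of j] that by (simp add: X_def)
    have c0: "c i = 0" if i: "i < m" for i
    proof -
      have "0 = (\<Sum>j<m. to_fract (Nt i j) * (\<Sum>l<m. c l * to_fract (M j l)))" using low by simp
      also have "\<dots> = (\<Sum>l<m. c l * to_fract (\<Sum>j<m. Nt i j * M j l))"
        unfolding sum_distrib_left to_fract_sum by (subst sum.swap) (simp add: algebra_simps)
      also have "\<dots> = (\<Sum>l<m. if l = i then c l * to_fract \<delta> else 0)"
        by (rule sum.cong) (use NM i in auto)
      finally show ?thesis using i det by simp
    qed
    have "(\<Sum>l<m. c l * X l (m + j0)) = 0" using c0 by simp
    then have "c m * y j0 = 0" using c[of "m + j0"] j0 by (simp add: X_def)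
    then show "\<forall>l<Suc m. c l = 0" using c0 j0 by (auto simp: less_Suc_eq)
  qed
  then show False using rank_R unfolding poly_mat_rank_def by simp
qed

text \<open>The same count at a fixed frequency: away from the uncontrollable modes \<open>R\<close>
  still has rank at least \<open>P\<close>, and by observability the columns of \<open>M\<close>
  remain independent, so a kernel vector outside their span would be one too many.\<close>

lemma exact:
  assumes s: "s \<notin> uncontrollable_modes R"
    and x: "\<And>l. l < k \<Longrightarrow> (\<Sum>j<m + P. cev (mrow R l j) s * x j) = 0"
  shows "\<exists>c. \<forall>j<m + P. x j = (\<Sum>i<m. cev (M j i) s * c i)"
proof (rule ccontr)
  assume neg: "\<not> ?thesis"
  have M_ind: "\<forall>l<m. c l = 0" if c: "\<And>j. j < m + P \<Longrightarrow> (\<Sum>l<m. c l * cev (M j l) s) = 0" for c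
  proof (rule ccontr)
    assume "\<not> ?thesis"
    then obtain l0 where l0: "l0 < m" "c l0 \<noteq> 0" by blast
    have "vec_space.rank (m + P) (eval_poly_mat (W1 @\<^sub>r W2) s) + 1 \<le> m"
    proof (rule rank_plus_kernel_le[where X = "\<lambda>_. c"])
      show "eval_poly_mat (W1 @\<^sub>r W2) s \<in> carrier_mat (m + P) m"
        using M_carrier by (simp add: eval_poly_mat_def)
      fix i assume i: "i < m + P"
      have "(\<Sum>j<m. eval_poly_mat (W1 @\<^sub>r W2) s $$ (i, j) * c j) = (\<Sum>l<m. c l * cev (M i l) s)"
        using M_carrier i by (intro sum.cong) (auto simp: eval_poly_mat_def cev_def mrow_def)
      then show "(\<Sum>j<m. eval_poly_mat (W1 @\<^sub>r W2) s $$ (i, j) * c j) = 0" using c[OF i] by simp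
    next
      fix d :: "nat \<Rightarrow> complex" assume "\<And>j. j < m \<Longrightarrow> (\<Sum>l<1. d l * c j) = 0"
      from this[OF l0(1)] show "\<forall>l<1. d l = 0" using l0(2) by simp
    qed
    moreover have "vec_space.rank (m + P) (eval_poly_mat (W1 @\<^sub>r W2) s) = m"
      using obs M_carrier unfolding observable_image_def by auto
    ultimately show False by simp
  qed
  define X where "X l j = (if l < m then cev (M j l) s else x j)" for l j
  have "vec_space.rank k (eval_poly_mat R s) + Suc m \<le> m + P"
  proof (rule rank_plus_kernel_le[where X = X])
    show "eval_poly_mat R s \<in> carrier_mat k (m + P)" by (rule carrier_matI) (simp_all add: dim_R' eval_poly_mat_def)
    fix i l assume i: "i < k" and l: "l < Suc m"
    have R: "(\<Sum>j<m + P. eval_poly_mat R s $$ (i, j) * X l j) = (\<Sum>j<m + P. cev (mrow R i j) s * X l j)"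
      using dim_R' i by (intro sum.cong) (auto simp: eval_poly_mat_def cev_def mrow_def)
    show "(\<Sum>j<m + P. eval_poly_mat R s $$ (i, j) * X l j) = 0"
    proof (cases "l < m")
      case True
      have "(\<Sum>j<m + P. cev (mrow R i j) s * X l j) = cev (\<Sum>j<m + P. mrow R i j * M j l) s"
        unfolding cev_sum by (rule sum.cong) (auto simp: X_def True cev_mult)
      then show ?thesis unfolding R using RM_zero[OF i True] by simp
    next
      case False
      then show ?thesis unfolding R using x[OF i] by (simp add: X_def)
    qed
  next
    fix c assume c: "\<And>j. j < m + P \<Longrightarrow> (\<Sum>l<Suc m. c l * X l j) = 0"
    have c': "(\<Sum>l<m. c l * cev (M j l) s) + c m * x j = 0" if "j < m + P" for j
      using c[OF that] by (simp add: X_def)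
    have cm: "c m = 0"
    proof (rule ccontr)
      assume nz: "c m \<noteq> 0"
      have "x j = (\<Sum>i<m. cev (M j i) s * (- c i / c m))" if "j < m + P" for j
      proof -
        have "x j = - (\<Sum>l<m. c l * cev (M j l) s) / c m"
          using c'[OF that] nz by (simp add: field_simps eq_neg_iff_add_eq_0 add.commute)
        then show ?thesis by (simp add: sum_divide_distrib sum_negf mult.commute)
      qed
      then have "\<exists>c. \<forall>j<m + P. x j = (\<Sum>i<m. cev (M j i) s * c i)"
        by (intro exI[of _ "\<lambda>i. - c i / c m"]) simp
      with neg show False ..
    qed
    then have "\<forall>l<m. c l = 0" using c' by (intro M_ind) simp
    with cm show "\<forall>l<Suc m. c l = 0" by (auto simp: less_Suc_eq)
  qed
  moreover have "vec_space.rank k (eval_poly_mat R s) \<ge> P"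
    using s rank_R unfolding uncontrollable_modes_def by simp
  ultimately show False by simp
qed

lemma io_system: "io_system m P k Bf (mrow R) M Nt \<delta> (uncontrollable_modes R)"
proof
  show "Bf = {f. (\<forall>j<m + P. smooth (f j)) \<and> (\<forall>i<k. \<forall>t. rowop (m + P) (mrow R i) f t = 0)}"
    by (rule Bf_def)
  show "- s \<notin> uncontrollable_modes R" if "s \<in> uncontrollable_modes R" for s
  proof
    assume "- s \<in> uncontrollable_modes R"
    then have "- (- s) \<in> uminus ` uncontrollable_modes R" by (rule imageI)
    then show False using modes that by auto
  qed
  show "\<exists>c. \<forall>j<m + P. x j = (\<Sum>i<m. poly (map_poly of_real (M j i)) s * c i)"
    if "s \<notin> uncontrollable_modes R" "\<And>l. l < k \<Longrightarrow> (\<Sum>j<m + P. poly (map_poly of_real (mrow R l j)) s * x j) = 0"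
    for s x by (rule exact[unfolded cev_def, OF that])
  show "(\<lambda>i. rowop m (M i) v) \<in> Bf" if "\<And>j. j < m \<Longrightarrow> smooth (v j)" for v
    using that by (rule image_Bf)
qed (fact det | (rule MN NM degree_le outputs; assumption))+

end

context state_space
begin

lemma quad_cong:
  assumes "\<And>v t. smooth_latent v \<Longrightarrow> F v t = G v t" "quad G"
  shows "quad F"
  using assms unfolding quad_def by simp

lemma derivative_of_image:
  assumes v: "smooth_latent v" and a: "a < m + P"
  shows "(deriv ^^ j) (rowop m (M a) v) t = img (\<lambda>i. if i = a then monom 1 j else 0) v t"
proof -
  have sm: "\<And>j. j < m \<Longrightarrow> smooth (v j)" using v by (simp add: smooth_latent_def)
  have "img (\<lambda>i. if i = a then monom 1 j else 0) v t
      = rowop (m + P) (\<lambda>i. if i = a then monom 1 j else 0) (\<lambda>i. rowop m (M i) v) t"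
    unfolding img_def by (rule rowop_image[OF sm, symmetric])
  then show ?thesis by (simp add: rowop_unit[OF a] diff_op_monom)
qed

lemma solution_eq:
  "solution w x \<longleftrightarrow> (\<forall>j<m + P. smooth (w j)) \<and> (\<forall>i<n. smooth (x i)) \<and> state_equations_hold m P n A Bm C D w x"
  unfolding solution_def state_equations_hold_def by blast

end

context behavior_data
begin

text \<open>Translates the definiteness assumption into the scalar sums in which
  \<open>storage_of_state\<close> expects it.\<close>

lemma feedthrough_positive:
  assumes "\<exists>l<m. v l \<noteq> 0"
  shows "(\<Sum>l<m. (v l)\<^sup>2) + (\<Sum>i<P. signature q i * (\<Sum>l<m. D $$ (i, l) * v l)\<^sup>2) > 0"
proof -
  define u where "u = vec m v"
  have u: "u \<in> carrier_vec m" by (simp add: u_def)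
  note D = D_carrier and J = J_mat_carrier[of p q]
  have DT: "D\<^sup>T \<in> carrier_mat m P" using D by simp
  have JD: "J_mat p q * D \<in> carrier_mat P m" and DTJ: "D\<^sup>T * J_mat p q \<in> carrier_mat m P"
    using J D DT by auto
  have Du: "D *\<^sub>v u \<in> carrier_vec P" using D u by auto
  have "u \<noteq> 0\<^sub>v m" using assms by (auto simp: u_def vec_eq_iff)
  moreover have "dim_row (1\<^sub>m m + D\<^sup>T * J_mat p q * D) = m" using D by simp
  ultimately have "0 < u \<bullet> ((1\<^sub>m m + D\<^sup>T * J_mat p q * D) *\<^sub>v u)"
    using pos u unfolding positive_definite_def by metis
  also have "(1\<^sub>m m + D\<^sup>T * J_mat p q * D) *\<^sub>v u = u + D\<^sup>T *\<^sub>v (J_mat p q *\<^sub>v (D *\<^sub>v u))"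
  proof -
    have "(1\<^sub>m m + D\<^sup>T * J_mat p q * D) *\<^sub>v u = 1\<^sub>m m *\<^sub>v u + (D\<^sup>T * J_mat p q * D) *\<^sub>v u"
      by (rule add_mult_distrib_mat_vec[OF one_carrier_mat _ u]) (use DTJ D in auto)
    also have "(D\<^sup>T * J_mat p q * D) *\<^sub>v u = D\<^sup>T * J_mat p q *\<^sub>v (D *\<^sub>v u)"
      by (rule assoc_mult_mat_vec[OF DTJ D u])
    also have "\<dots> = D\<^sup>T *\<^sub>v (J_mat p q *\<^sub>v (D *\<^sub>v u))"
      by (rule assoc_mult_mat_vec[OF DT J Du])
    finally show ?thesis using u by simp
  qed
  also have "u \<bullet> (u + D\<^sup>T *\<^sub>v (J_mat p q *\<^sub>v (D *\<^sub>v u))) = u \<bullet> u + u \<bullet> (D\<^sup>T *\<^sub>v (J_mat p q *\<^sub>v (D *\<^sub>v u)))"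
    by (rule scalar_prod_add_distrib[OF u u]) (use DT J Du in auto)
  also have "u \<bullet> (D\<^sup>T *\<^sub>v (J_mat p q *\<^sub>v (D *\<^sub>v u))) = (D *\<^sub>v u) \<bullet> (J_mat p q *\<^sub>v (D *\<^sub>v u))"
  proof -
    have JDu: "J_mat p q *\<^sub>v (D *\<^sub>v u) \<in> carrier_vec P" using J Du by auto
    have "(D\<^sup>T *\<^sub>v (J_mat p q *\<^sub>v (D *\<^sub>v u))) \<bullet> u = (J_mat p q *\<^sub>v (D *\<^sub>v u)) \<bullet> (D *\<^sub>v u)"
      using transpose_vec_mult_scalar[OF D u JDu] by simp
    then show ?thesis using comm_scalar_prod[OF u, of "D\<^sup>T *\<^sub>v (J_mat p q *\<^sub>v (D *\<^sub>v u))"]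
        comm_scalar_prod[OF Du JDu] DT JDu by simp
  qed
  also have "u \<bullet> u = (\<Sum>l<m. (v l)\<^sup>2)"
    unfolding scalar_prod_sum[OF u u] by (rule sum.cong) (auto simp: u_def power2_eq_square)
  also have "(D *\<^sub>v u) \<bullet> (J_mat p q *\<^sub>v (D *\<^sub>v u)) = (\<Sum>i<P. signature q i * (\<Sum>l<m. D $$ (i, l) * v l)\<^sup>2)"
  proof -
    have "(D *\<^sub>v u) $ i = (\<Sum>l<m. D $$ (i, l) * v l)" if "i < P" for i
      using D that by (simp add: scalar_prod_def lessThan_atLeast0 u_def)
    then have "(D *\<^sub>v u) \<bullet> (J_mat p q *\<^sub>v (D *\<^sub>v u)) = (\<Sum>i<P. \<Sum>j<P.
        if j = i then signature q i * (\<Sum>l<m. D $$ (i, l) * v l)\<^sup>2 else 0)"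
      unfolding quadratic_form_sum[OF J Du]
      by (intro sum.cong refl) (auto simp: J_mat_index signature_def power2_eq_square)
    then show ?thesis by simp
  qed
  finally show ?thesis .
qed

theorem dissipative_imp_state_storage:
  assumes "dissipative (Sigma_mat m q p) \<BB>cont"
  shows "\<exists>n. \<exists>K\<in>carrier_mat n n. \<exists>F. observable_state_variable (m + q + p) n \<BB> F \<and>
    (\<forall>(w, x)\<in>full_behavior (m + q + p) n F. \<forall>t.
      deriv (\<lambda>s. x s \<bullet> (K *\<^sub>v x s)) t \<le> w t \<bullet> (Sigma_mat m q p *\<^sub>v w t))"
proof -
  interpret io: io_system m P k Bf "mrow R" M Nt \<delta> "uncontrollable_modes R" by (rule io_system)
  obtain n1 n X where "state_basis m P k Bf (mrow R) M Nt \<delta> (uncontrollable_modes R) n1 n X"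
    using io.state_basis_exists by blast
  then interpret sb: state_basis m P k Bf "mrow R" M Nt \<delta> "uncontrollable_modes R" n1 n X .
  obtain A Bm where AB: "\<forall>i<n. (\<lambda>j. xi * X i j - lincomb_rows (A i) X n j - input_row m (\<lambda>l. [:Bm i l:]) j) \<in> io.Ann \<and>
     (n1 \<le> i \<longrightarrow> (\<forall>j<n1. A i j = 0) \<and> (\<forall>l<m. Bm i l = 0))"
    using sb.state_equations by (elim exE)
  define D' where "D' i l = coeff (\<Sum>j<m. M (m + i) j * Nt j l) (degree \<delta>) / lead_coeff \<delta>" for i l
  obtain C where C: "\<forall>i<P. (\<lambda>j. (if j = m + i then 1 else 0) - lincomb_rows (C i) X n j - input_row m (\<lambda>l. [:D' i l:]) j) \<in> io.Ann"
    using sb.output_equations unfolding D'_def by (elim exE)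
  interpret ss: state_space m P k Bf "mrow R" M Nt \<delta> "uncontrollable_modes R" n1 n X A Bm C D'
    by unfold_locales (use AB C in auto)
  obtain \<Psi> where \<Psi>: "\<Psi> \<in> carrier_mat (m + P) (m + P)" "is_storage_function (Sigma_mat m q p) \<BB>cont \<Psi>"
    using assms Sigma_mat_carrier[of m q p] unfolding dissipative_def by auto
  define W where "W v = mat_diff_op (W1 @\<^sub>r W2) (traj m v)" for v
  have W: "W v \<in> \<BB>cont" "\<And>i. i < m + P \<Longrightarrow> comps (W v) i = rowop m (M i) v" if "ss.smooth_latent v" for v
    using image_traj[of v] that unfolding W_def ss.smooth_latent_def by auto
  \<comment> \<open>Along the image, each derivative of each component of \<open>w\<close> is a
    representable row, so the quadratic differential form is a quadratic form in the
    coordinates.\<close>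
  have "ss.quad (\<lambda>v t. qdf \<Psi> (W v) t)"
  proof (rule ss.quad_cong)
    let ?u = "\<lambda>a j. (\<lambda>i. if i = a then monom 1 j else 0)"
    fix v t assume v: "ss.smooth_latent v"
    show "qdf \<Psi> (W v) t = (\<Sum>a<m + P. \<Sum>b<m + P. \<Sum>j\<le>degree (\<Psi> $$ (a, b)). \<Sum>k\<le>degree (coeff (\<Psi> $$ (a, b)) j).
        ss.img (?u a j) v t * coeff (coeff (\<Psi> $$ (a, b)) j) k * ss.img (?u b k) v t)"
      using \<Psi>(1) W(2)[OF v] ss.derivative_of_image[OF v]
      unfolding qdf_def comps_def[symmetric, abs_def] by (simp add: comps_def[symmetric, abs_def])
  next
    show "ss.quad (\<lambda>v t. \<Sum>a<m + P. \<Sum>b<m + P. \<Sum>j\<le>degree (\<Psi> $$ (a, b)). \<Sum>k\<le>degree (coeff (\<Psi> $$ (a, b)) j).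
        ss.img (\<lambda>i. if i = a then monom 1 j else 0) v t * coeff (coeff (\<Psi> $$ (a, b)) j) k *
        ss.img (\<lambda>i. if i = b then monom 1 k else 0) v t)"
      by (intro ss.quad_sum ss.quad_prod) (auto intro: ss.representable_monom)
  qed
  moreover have "deriv (\<lambda>t. qdf \<Psi> (W v) t) t \<le> ss.supply_rate (signature q) (\<lambda>i. ss.img (ss.zrow i) v t)"
    if v: "ss.smooth_latent v" for v t
  proof -
    have "deriv (qdf \<Psi> (W v)) t \<le> W v t \<bullet> (Sigma_mat m q p *\<^sub>v W v t)"
      using \<Psi>(2) W(1)[OF v] unfolding is_storage_function_def by blast
    also have "W v t \<in> carrier_vec (m + P)" using W(1)[OF v] sub B_iff by blast
    then have "W v t \<bullet> (Sigma_mat m q p *\<^sub>v W v t) = (\<Sum>l<m. (comps (W v) l t)\<^sup>2)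
        + (\<Sum>i<P. signature q i * (comps (W v) (m + i) t)\<^sup>2)"
      unfolding comps_def by (rule Sigma_mat_form)
    also have "\<dots> = ss.supply_rate (signature q) (\<lambda>i. ss.img (ss.zrow i) v t)"
      unfolding ss.supply_rate_def using W(2)[OF v] ss.image_components[OF v] by simp
    finally show ?thesis .
  qed
  moreover have "(\<Sum>l<m. (v l)\<^sup>2) + (\<Sum>i<P. signature q i * (\<Sum>l<m. D' i l * v l)\<^sup>2) > 0"
    if "\<exists>l<m. v l \<noteq> 0" for v
    using feedthrough_positive[OF that] D_index by (simp add: D'_def)
  ultimately have "\<exists>K :: nat \<Rightarrow> nat \<Rightarrow> real. \<forall>w x t. ss.solution w x \<longrightarrow>
      deriv (\<lambda>s. \<Sum>i<n. \<Sum>j<n. K i j * x i s * x j s) t \<le>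
      (\<Sum>l<m. (w l t)\<^sup>2) + (\<Sum>i<P. signature q i * (w (m + i) t)\<^sup>2)"
    by (rule ss.storage_of_state)
  then obtain Kf :: "nat \<Rightarrow> nat \<Rightarrow> real" where Kf: "\<forall>w x t. ss.solution w x \<longrightarrow>
      deriv (\<lambda>s. \<Sum>i<n. \<Sum>j<n. Kf i j * x i s * x j s) t \<le>
      (\<Sum>l<m. (w l t)\<^sup>2) + (\<Sum>i<P. signature q i * (w (m + i) t)\<^sup>2)" ..
  define K where "K = mat n n (\<lambda>(i, j). Kf i j)"
  define F where "F = state_mat m P n A Bm C D'"
  have full: "(w, x) \<in> full_behavior (m + P) n F \<longleftrightarrow>
      (\<forall>t. w t \<in> carrier_vec (m + P)) \<and> (\<forall>t. x t \<in> carrier_vec n) \<and> ss.solution (comps w) (comps x)" for w x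
    unfolding F_def full_behavior_state_mat smooth_trajectories_iff ss.solution_eq by auto
  have "observable_state_variable (m + P) n \<BB> F"
    unfolding observable_state_variable_def
  proof (intro conjI allI impI)
    show "dim_col F = m + P + n" by (simp add: F_def)
    show "state_property (m + P) n F" unfolding F_def by (rule state_mat_state_property)
    show "fst ` full_behavior (m + P) n F = \<BB>"
    proof
      show "fst ` full_behavior (m + P) n F \<subseteq> \<BB>"
        using B_iff by (auto simp: full ss.solution_iff)
      show "\<BB> \<subseteq> fst ` full_behavior (m + P) n F"
      proof
        fix w assume w: "w \<in> \<BB>"
        define x where "x = traj n (\<lambda>i. rowop (m + P) (X i) (comps w))"
        have "ss.solution (comps w) (comps x)"
          unfolding ss.solution_iff using w B_iff by (simp add: x_def)
        moreover have "x t \<in> carrier_vec n" for t by (simp add: x_def traj_def)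
        ultimately have "(w, x) \<in> full_behavior (m + P) n F" unfolding full using w B_iff by blast
        then show "w \<in> fst ` full_behavior (m + P) n F" by force
      qed
    qed
    fix w x1 x2 assume "(w, x1) \<in> full_behavior (m + P) n F \<and> (w, x2) \<in> full_behavior (m + P) n F"
    then have x: "\<And>t. x1 t \<in> carrier_vec n" "\<And>t. x2 t \<in> carrier_vec n"
      "\<And>i. i < n \<Longrightarrow> comps x1 i = comps x2 i"
      unfolding full ss.solution_iff by simp_all
    have "traj n (comps x1) = traj n (comps x2)"
      unfolding traj_def by (intro ext eq_vecI) (use x(3) in auto)
    then show "x1 = x2" using traj_comps[of x1 n] traj_comps[of x2 n] x(1,2) by simp
  qed
  moreover have "deriv (\<lambda>s. x s \<bullet> (K *\<^sub>v x s)) t \<le> w t \<bullet> (Sigma_mat m q p *\<^sub>v w t)"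
    if wx: "(w, x) \<in> full_behavior (m + P) n F" for w x t
  proof -
    have c: "w t \<in> carrier_vec (m + P)" "\<And>s. x s \<in> carrier_vec n" and sol: "ss.solution (comps w) (comps x)"
      using wx unfolding full by auto
    have "x s \<bullet> (K *\<^sub>v x s) = (\<Sum>i<n. \<Sum>j<n. Kf i j * comps x i s * comps x j s)" for s
      using quadratic_form_sum[OF _ c(2), of K s] by (simp add: K_def comps_def)
    moreover have "w t \<bullet> (Sigma_mat m q p *\<^sub>v w t)
        = (\<Sum>l<m. (comps w l t)\<^sup>2) + (\<Sum>i<P. signature q i * (comps w (m + i) t)\<^sup>2)"
      unfolding comps_def by (rule Sigma_mat_form[OF c(1)])
    ultimately show ?thesis using Kf[rule_format, OF sol, of t] by simp
  qed
  moreover have "K \<in> carrier_mat n n" by (simp add: K_def)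
  ultimately show ?thesis unfolding add.assoc[of m q p] by blast
qed

end

theorem corollary4p1:
  fixes m q p :: nat
    and R W1 W2 :: "real poly mat"
    and D :: "real mat"
    and \<BB> \<BB>cont :: "(real \<Rightarrow> real vec) set"
  assumes "dim_col R = m + q + p"
    and "\<BB> = kernel_behavior R"
    and "\<not> controllable \<BB>"
    and "input_cardinality R = m"
    and "uncontrollable_modes R \<inter> uminus ` uncontrollable_modes R = {}"
    and "is_controllable_part (m + q + p) \<BB> \<BB>cont"
    and "W1 \<in> carrier_mat m m"
    and "W2 \<in> carrier_mat (q + p) m"
    and "\<BB>cont = image_behavior (W1 @\<^sub>r W2)"
    and "observable_image (W1 @\<^sub>r W2)"
    and "det W1 \<noteq> 0"
    and "proper (transfer_matrix W1 W2)"
    and "limit_at_infinity (transfer_matrix W1 W2) D"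
    and "positive_definite (1\<^sub>m m + D\<^sup>T * J_mat p q * D)"
  defines "\<Sigma> \<equiv> Sigma_mat m q p"
  shows "(dissipative \<Sigma> \<BB>cont \<longleftrightarrow>
            (\<exists>\<Psi>\<in>carrier_mat (m + q + p) (m + q + p). is_storage_function \<Sigma> \<BB> \<Psi>))
       \<and> ((\<exists>\<Psi>\<in>carrier_mat (m + q + p) (m + q + p). is_storage_function \<Sigma> \<BB> \<Psi>) \<longleftrightarrow>
            (\<exists>n. \<exists>K\<in>carrier_mat n n. \<exists>F. observable_state_variable (m + q + p) n \<BB> F \<and>
               (\<forall>(w, x)\<in>full_behavior (m + q + p) n F. \<forall>t.
                  deriv (\<lambda>s. x s \<bullet> (K *\<^sub>v x s)) t \<le> w t \<bullet> (\<Sigma> *\<^sub>v w t))))"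
proof -
  have sub: "\<BB>cont \<subseteq> \<BB>" using assms(6) unfolding is_controllable_part_def by blast
  interpret behavior_data m q p R W1 W2 D \<BB> \<BB>cont
    by unfold_locales (fact sub assms)+
  have "dim_row \<Sigma> = m + q + p" using Sigma_mat_carrier[of m q p] unfolding \<Sigma>_def by auto
  \<comment> \<open>Restriction to a smaller behavior gives the implication from 2 to 1, which
    closes the circle 1, 3, 2.\<close>
  then have "(\<exists>\<Psi>\<in>carrier_mat (m + q + p) (m + q + p). is_storage_function \<Sigma> \<BB> \<Psi>) \<Longrightarrow> dissipative \<Sigma> \<BB>cont"
    using sub unfolding dissipative_def is_storage_function_def by (metis subsetD)
  moreover note dissipative_imp_state_storage[folded \<Sigma>_def] state_storage_imp_qdf[of "m + q + p" _ \<BB> _ _ \<Sigma>]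
  ultimately show ?thesis by blast
qed

end
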